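(* Consider the Latent Block Model of the context under the standing assumptions (H1), (H2), (H3), and assume that $n,d\to\infty$ with $\log(d)/n\to0$ and $\log(n)/d\to0$. Let $\widehat{\boldsymbol\theta}_{var}=(\widehat{\boldsymbol\pi}_{var},\widehat{\boldsymbol\rho}_{var},\widehat{\boldsymbol\alpha}_{var})$ be the variational estimator, $$\widehat{\boldsymbol\theta}_{var}\in\arg\max_{\boldsymbol\theta\in\boldsymbol\Theta}\ \max_{\mathbb Q\in\mathcal Q}J(\mathbb Q,\boldsymbol\theta),$$ with $J$ and the set $\mathcal Q$ of factorized distributions as defined in the context. Then there exist permutations $s$ of $\{1,\dots,g\}$ and $t$ of $\{1,\dots,m\}$ such that $$\widehat{\boldsymbol\pi}(\mathbf z^\star)-\widehat{\boldsymbol\pi}_{var}^{\,s}=o_P(n^{-1/2}),\qquad \widehat{\boldsymbol\rho}(\mathbf w^\star)-\widehat{\boldsymbol\rho}_{var}^{\,t}=o_P(d^{-1/2}),$$ $$\widehat{\boldsymbol\alpha}(\mathbf z^\star,\mathbf w^\star)-\widehat{\boldsymbol\alpha}_{var}^{\,s,t}=o_P\bigl((nd)^{-1/2}\bigr).$$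
   Context: Latent Block Model (LBM). Integers $g,m\ge1$ are fixed and known. $\mathcal Z$ is the set of row assignments $\mathbf z=(z_{ik})\in\{0,1\}^{n\times g}$ with exactly one $1$ in each row; $\mathcal W$ is the set of column assignments $\mathbf w=(w_{j\ell})\in\{0,1\}^{d\times m}$ with exactly one $1$ in each row. A parameter is $\boldsymbol\theta=(\boldsymbol\pi,\boldsymbol\rho,\boldsymbol\alpha)\in\boldsymbol\Theta$ with $\boldsymbol\pi=(\pi_k)_{k\le g}$ and $\boldsymbol\rho=(\rho_\ell)_{\ell\le m}$ probability vectors and $\boldsymbol\alpha=(\alpha_{k\ell})$ a $g\times m$ matrix. Under $\boldsymbol\theta$, the rows of $\mathbf z$ are i.i.d. multinomial $\mathcal M(1,\boldsymbol\pi)$, the rows of $\mathbf w$ are i.i.d. multinomial $\mathcal M(1,\boldsymbol\rho)$, $\mathbf z$ and $\mathbf w$ are independent, and conditionally on $(\mathbf z,\mathbf w)$ the entries $x_{ij}$ of the $n\times d$ data matrix $\mathbf x$ are independent with $x_{ij}\sim\varphi(\cdot,\alpha_{k\ell})$ when $z_{ik}w_{j\ell}=1$. Here $\varphi(x,\alpha)=b(x)\exp(\alpha x-\psi(\alpha))$ is a regular univariate exponential family in canonical form with canonical parameter space $\mathcal A\subset\mathbb R$ (interior $\mathring{\mathcal A}$). The complete likelihood is $p(\mathbf x,\mathbf z,\mathbf w;\boldsymbol\theta)=\prod_{i,k}\pi_k^{z_{ik}}\prod_{j,\ell}\rho_\ell^{w_{j\ell}}\prod_{i,j,k,\ell}\varphi(x_{ij};\alpha_{k\ell})^{z_{ik}w_{j\ell}}$.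 The data are generated under the true parameter $\boldsymbol\theta^\star=(\boldsymbol\pi^\star,\boldsymbol\rho^\star,\boldsymbol\alpha^\star)$, with true assignments $(\mathbf z^\star,\mathbf w^\star)$; $o_P$ is with respect to $\mathbb P_{\boldsymbol\theta^\star}$ as $n,d\to\infty$. Standing assumptions: (H1) there are a constant $c>0$ and a compact $C_\alpha\subset\mathring{\mathcal A}$ with $\boldsymbol\Theta\subset[c,1-c]^g\times[c,1-c]^m\times C_\alpha^{g\times m}$; (H2) $\boldsymbol\theta^\star$ lies in the relative interior of $\boldsymbol\Theta$; (H3) $\boldsymbol\theta^\star$ is identifiable up to a permutation of the row-labels and column-labels (in particular $\alpha\mapsto\varphi(\cdot,\alpha)$ is injective and each row and each column of $\boldsymbol\alpha^\star$ is unique). Variational criterion: $\mathcal Q$ is the set of probability distributions $\mathbb Q$ on $\mathcal Z\times\mathcal W$ that factorize as $\mathbb Q(\mathbf z,\mathbf w)=\prod_{i,k}\mathbb Q(z_{ik}=1)^{z_{ik}}\prod_{j,\ell}\mathbb Q(w_{j\ell}=1)^{w_{j\ell}}$, and $J(\mathbb Q,\boldsymbol\theta)=\mathbb E_{\mathbb Q}[\log p(\mathbf x,\mathbf z,\mathbf w;\boldsymbol\theta)]+\mathcal H(\mathbb Q)$ with $\mathcal H(\mathbb Q)=-\mathbb E_{\mathbb Q}[\log\mathbb Q]$. Complete-data estimators: $\widehat\pi_k(\mathbf z)=\frac1n\sum_i z_{ik}$, $\widehat\rho_\ell(\mathbf w)=\frac1d\sum_j w_{j\ell}$, $\widehat x_{k\ell}(\mathbf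 z,\mathbf w)=\dfrac{\sum_{i,j}x_{ij}z_{ik}w_{j\ell}}{(\sum_i z_{ik})(\sum_j w_{j\ell})}$, $\widehat\alpha_{k\ell}(\mathbf z,\mathbf w)=(\psi')^{-1}(\widehat x_{k\ell}(\mathbf z,\mathbf w))$; bold symbols denote the corresponding vectors/matrices. Permutations: $\boldsymbol\pi^s=(\pi_{s(k)})_k$, $\boldsymbol\rho^t=(\rho_{t(\ell)})_\ell$, $\boldsymbol\alpha^{s,t}=(\alpha_{s(k)t(\ell)})_{k,\ell}$. *)

theory Defs
  imports "HOL-Probability.Probability"
begin

text \<open>
  The numbers of row and column classes are the cardinalities of the finite index types
  \<open>'g\<close> and \<open>'m\<close>.  A row assignment, i.e. a 0/1 matrix with exactly one 1 in each of its
  \<open>n\<close> rows, is encoded as the function \<open>z\<close> sending \<open>i < n\<close> to the position of that 1; the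
  matrix entry is recovered as \<open>asg z i k\<close>.  Column assignments are treated alike.  A data
  matrix is a function on the index set \<open>cells n d\<close>.
\<close>

type_synonym ('g, 'm) param = "(real ^ 'g) \<times> (real ^ 'm) \<times> (real ^ 'm ^ 'g)"

definition assignments :: "nat \<Rightarrow> (nat \<Rightarrow> 'k::finite) set" where
  "assignments n = ({..<n} \<rightarrow>\<^sub>E UNIV)"

definition asg :: "(nat \<Rightarrow> 'k) \<Rightarrow> nat \<Rightarrow> 'k \<Rightarrow> nat" where
  "asg z i k = of_bool (z i = k)"

definition cells :: "nat \<Rightarrow> nat \<Rightarrow> (nat \<times> nat) set" where
  "cells n d = {..<n} \<times> {..<d}"

definition prob_vectors :: "(real ^ 'k::finite) set" where
  "prob_vectors = {p. (\<forall>k. 0 \<le> p $ k) \<and> (\<Sum>k\<in>UNIV. p $ k) = 1}"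

text \<open>
  Interiors of parameter sets are taken relative to \<open>params\<close>, i.e. in the topology
  \<open>top_of_set params\<close>; the simplices have empty interior in the ambient spaces.
\<close>

definition params :: "('g::finite, 'm::finite) param set" where
  "params = prob_vectors \<times> prob_vectors \<times> UNIV"


subsection \<open>Exponential family\<close>

definition phi :: "(real \<Rightarrow> real) \<Rightarrow> (real \<Rightarrow> real) \<Rightarrow> real \<Rightarrow> real \<Rightarrow> real" where
  "phi b \<psi> x \<alpha> = b x * exp (\<alpha> * x - \<psi> \<alpha>)"

definition expfam ::
  "real measure \<Rightarrow> (real \<Rightarrow> real) \<Rightarrow> (real \<Rightarrow> real) \<Rightarrow> real \<Rightarrow> real measure" where
  "expfam \<nu> b \<psi> \<alpha> = density \<nu> (\<lambda>x. ennreal (phi b \<psi> x \<alpha>))"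

text \<open>
  \<open>\<nu>\<close> is the dominating measure (Lebesgue, counting, \<dots>).  Regular means that the
  natural parameter space is open.  Non-degeneracy is not included: it amounts to injectivity
  of \<open>expfam \<nu> b \<psi>\<close> on \<open>A\<close>.
\<close>

definition regular_expfam ::
  "real measure \<Rightarrow> (real \<Rightarrow> real) \<Rightarrow> (real \<Rightarrow> real) \<Rightarrow> real set \<Rightarrow> bool" where
  "regular_expfam \<nu> b \<psi> A \<longleftrightarrow>
     sigma_finite_measure \<nu> \<and> sets \<nu> = sets borel \<and>
     b \<in> borel_measurable borel \<and> (\<forall>x. 0 \<le> b x) \<and>
     A = {\<alpha>. integrable \<nu> (\<lambda>x. b x * exp (\<alpha> * x))} \<and> A \<noteq> {} \<and> open A \<and>
     (\<forall>\<alpha>\<in>A. (\<integral>x. phi b \<psi> x \<alpha> \<partial>\<nu>) = 1)"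


subsection \<open>Latent block model\<close>

definition multinomial1 :: "real ^ 'k::finite \<Rightarrow> 'k measure" where
  "multinomial1 p = point_measure UNIV (\<lambda>k. ennreal (p $ k))"

definition lbm_space ::
  "nat \<Rightarrow> nat \<Rightarrow> ((nat \<Rightarrow> 'g::finite) \<times> (nat \<Rightarrow> 'm::finite) \<times> (nat \<times> nat \<Rightarrow> real)) measure" where
  "lbm_space n d =
     PiM {..<n} (\<lambda>_. count_space UNIV) \<Otimes>\<^sub>M PiM {..<d} (\<lambda>_. count_space UNIV) \<Otimes>\<^sub>M
     PiM (cells n d) (\<lambda>_. borel)"

text \<open>Joint law of \<open>(z, w, x)\<close>: first draw \<open>(z, w)\<close>, then \<open>x\<close> given \<open>(z, w)\<close>.\<close>

definition lbm ::
  "real measure \<Rightarrow> (real \<Rightarrow> real) \<Rightarrow> (real \<Rightarrow> real) \<Rightarrow> nat \<Rightarrow> nat \<Rightarrow> ('g::finite, 'm::finite) param \<Rightarrow>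
   ((nat \<Rightarrow> 'g) \<times> (nat \<Rightarrow> 'm) \<times> (nat \<times> nat \<Rightarrow> real)) measure" where
  "lbm \<nu> b \<psi> n d = (\<lambda>(\<pi>, \<rho>, \<alpha>).
     (PiM {..<n} (\<lambda>_. multinomial1 \<pi>) \<Otimes>\<^sub>M PiM {..<d} (\<lambda>_. multinomial1 \<rho>)) \<bind>
     (\<lambda>(z, w). distr (PiM (cells n d) (\<lambda>(i, j). expfam \<nu> b \<psi> (\<alpha> $ z i $ w j)))
                     (lbm_space n d) (\<lambda>x. (z, w, x))))"

definition data_law ::
  "real measure \<Rightarrow> (real \<Rightarrow> real) \<Rightarrow> (real \<Rightarrow> real) \<Rightarrow> nat \<Rightarrow> nat \<Rightarrow> ('g::finite, 'm::finite) param \<Rightarrow>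
   (nat \<times> nat \<Rightarrow> real) measure" where
  "data_law \<nu> b \<psi> n d \<theta> =
     distr (lbm \<nu> b \<psi> n d \<theta>) (PiM (cells n d) (\<lambda>_. borel)) (\<lambda>(z, w, x). x)"

definition complete_lik ::
  "(real \<Rightarrow> real) \<Rightarrow> (real \<Rightarrow> real) \<Rightarrow> nat \<Rightarrow> nat \<Rightarrow> (nat \<times> nat \<Rightarrow> real) \<Rightarrow>
   (nat \<Rightarrow> 'g::finite) \<Rightarrow> (nat \<Rightarrow> 'm::finite) \<Rightarrow> ('g, 'm) param \<Rightarrow> real" where
  "complete_lik b \<psi> n d x z w = (\<lambda>(\<pi>, \<rho>, \<alpha>).
     (\<Prod>i<n. \<Prod>k\<in>UNIV. (\<pi> $ k) ^ asg z i k) *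
     (\<Prod>j<d. \<Prod>l\<in>UNIV. (\<rho> $ l) ^ asg w j l) *
     (\<Prod>i<n. \<Prod>j<d. \<Prod>k\<in>UNIV. \<Prod>l\<in>UNIV.
        phi b \<psi> (x (i, j)) (\<alpha> $ k $ l) ^ (asg z i k * asg w j l)))"


subsection \<open>Label permutations and identifiability\<close>

definition perm_vec :: "('k \<Rightarrow> 'k) \<Rightarrow> real ^ 'k::finite \<Rightarrow> real ^ 'k" where
  "perm_vec s p = (\<chi> k. p $ s k)"

definition perm_mat ::
  "('g \<Rightarrow> 'g) \<Rightarrow> ('m \<Rightarrow> 'm) \<Rightarrow> real ^ 'm::finite ^ 'g::finite \<Rightarrow> real ^ 'm ^ 'g" where
  "perm_mat s t \<alpha> = (\<chi> k l. \<alpha> $ s k $ t l)"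

definition identifiable_upto_labels ::
  "real measure \<Rightarrow> (real \<Rightarrow> real) \<Rightarrow> (real \<Rightarrow> real) \<Rightarrow> ('g::finite, 'm::finite) param set \<Rightarrow>
   ('g, 'm) param \<Rightarrow> bool" where
  "identifiable_upto_labels \<nu> b \<psi> \<Theta> = (\<lambda>(\<pi>, \<rho>, \<alpha>).
     \<forall>\<theta>\<in>\<Theta>. (\<forall>n d. data_law \<nu> b \<psi> n d \<theta> = data_law \<nu> b \<psi> n d (\<pi>, \<rho>, \<alpha>)) \<longrightarrow>
       (\<exists>s t. s permutes UNIV \<and> t permutes UNIV \<and>
              \<theta> = (perm_vec s \<pi>, perm_vec t \<rho>, perm_mat s t \<alpha>)))"


subsection \<open>Variational criterion\<close>

definition factorized ::
  "nat \<Rightarrow> nat \<Rightarrow> ((nat \<Rightarrow> 'g::finite) \<times> (nat \<Rightarrow> 'm::finite)) pmf set" where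
  "factorized n d = {Q. set_pmf Q \<subseteq> assignments n \<times> assignments d \<and>
     (\<forall>z\<in>assignments n. \<forall>w\<in>assignments d. pmf Q (z, w) =
        (\<Prod>i<n. \<Prod>k\<in>UNIV. measure_pmf.prob Q {(z', w'). asg z' i k = 1} ^ asg z i k) *
        (\<Prod>j<d. \<Prod>l\<in>UNIV. measure_pmf.prob Q {(z', w'). asg w' j l = 1} ^ asg w j l))}"

definition pmf_entropy :: "'a pmf \<Rightarrow> real" where
  "pmf_entropy Q = - measure_pmf.expectation Q (\<lambda>a. ln (pmf Q a))"

definition J ::
  "(real \<Rightarrow> real) \<Rightarrow> (real \<Rightarrow> real) \<Rightarrow> nat \<Rightarrow> nat \<Rightarrow> (nat \<times> nat \<Rightarrow> real) \<Rightarrow>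
   ((nat \<Rightarrow> 'g::finite) \<times> (nat \<Rightarrow> 'm::finite)) pmf \<Rightarrow> ('g, 'm) param \<Rightarrow> real" where
  "J b \<psi> n d x Q \<theta> =
     measure_pmf.expectation Q (\<lambda>(z, w). ln (complete_lik b \<psi> n d x z w \<theta>)) + pmf_entropy Q"

text \<open>
  For fixed \<open>\<theta>\<close>, \<open>J\<close> is continuous on the compact set of factorized distributions, so the
  supremum over \<open>Q\<close> is a maximum.
\<close>

definition variational_estimate ::
  "(real \<Rightarrow> real) \<Rightarrow> (real \<Rightarrow> real) \<Rightarrow> ('g::finite, 'm::finite) param set \<Rightarrow> nat \<Rightarrow> nat \<Rightarrow>
   (nat \<times> nat \<Rightarrow> real) \<Rightarrow> ('g, 'm) param \<Rightarrow> bool" where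
  "variational_estimate b \<psi> \<Theta> n d x =
     is_arg_max (\<lambda>\<theta>. SUP Q\<in>factorized n d. J b \<psi> n d x Q \<theta>) (\<lambda>\<theta>. \<theta> \<in> \<Theta>)"


subsection \<open>Complete-data estimators\<close>

definition prop_hat :: "nat \<Rightarrow> (nat \<Rightarrow> 'k::finite) \<Rightarrow> real ^ 'k" where
  "prop_hat n z = (\<chi> k. (\<Sum>i<n. real (asg z i k)) / real n)"

definition x_hat ::
  "nat \<Rightarrow> nat \<Rightarrow> (nat \<times> nat \<Rightarrow> real) \<Rightarrow> (nat \<Rightarrow> 'g::finite) \<Rightarrow> (nat \<Rightarrow> 'm::finite) \<Rightarrow>
   'g \<Rightarrow> 'm \<Rightarrow> real" where
  "x_hat n d x z w k l =
     (\<Sum>i<n. \<Sum>j<d. x (i, j) * real (asg z i k) * real (asg w j l)) /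
     ((\<Sum>i<n. real (asg z i k)) * (\<Sum>j<d. real (asg w j l)))"

definition alpha_hat ::
  "(real \<Rightarrow> real) \<Rightarrow> real set \<Rightarrow> nat \<Rightarrow> nat \<Rightarrow> (nat \<times> nat \<Rightarrow> real) \<Rightarrow>
   (nat \<Rightarrow> 'g::finite) \<Rightarrow> (nat \<Rightarrow> 'm::finite) \<Rightarrow> real ^ 'm ^ 'g" where
  "alpha_hat \<psi> A n d x z w =
     (\<chi> k l. inv_into (interior A) (deriv \<psi>) (x_hat n d x z w k l))"


subsection \<open>Stochastic order\<close>

text \<open>
  \<open>Y N = o\<^sub>P(r N)\<close>, where \<open>Y N\<close> lives on its own probability space \<open>M N\<close>.  Measurability of
  \<open>Y N\<close> is part of the notion; without it \<open>measure\<close> could be 0 for lack of measurability.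
\<close>

definition small_oP ::
  "(nat \<Rightarrow> 'a measure) \<Rightarrow> (nat \<Rightarrow> 'a \<Rightarrow> 'b::real_normed_vector) \<Rightarrow> (nat \<Rightarrow> real) \<Rightarrow> bool" where
  "small_oP M Y r \<longleftrightarrow>
     (\<forall>N. Y N \<in> borel_measurable (M N)) \<and>
     (\<forall>\<epsilon>>0. (\<lambda>N. measure (M N) {\<omega> \<in> space (M N). norm (Y N \<omega>) > \<epsilon> * r N}) \<longlonglongrightarrow> 0)"

end

theory Submission
  imports Defs
begin

text \<open>
  \<open>J\<close> depends on a factorized distribution only through its marginals \<open>\<tau>\<close> (rows) and \<open>\<nu>\<close> (columns), and
  it is the sum of a bilinear form in \<open>(\<tau>, \<nu>)\<close> and of entropies.  Hence the variational criterion can be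
  compared directly with the complete log-likelihood, without the observed likelihood.  Off an event of
  vanishing probability, a competitive \<open>(\<tau>, \<nu>, \<theta>)\<close> must, after a permutation of the labels, have \<open>\<alpha>\<close>
  close to \<open>\<alpha>0\<close> and \<open>\<nu>\<close> close to the true column labels \<open>w\<close>.  Then in each row the true label beats all others by
  a multiple of \<open>d\<close>, so Gibbs' inequality bounds the maximum over \<open>\<tau>\<close> by the value at the true row labels \<open>z\<close>
  up to \<open>n exp (- c' d)\<close>, and next the maximum over \<open>\<nu>\<close> up to \<open>d exp (- c' n)\<close>.  Both errors vanish
  in the regime considered.  Since the complete-data estimator lies in \<open>\<Theta>\<close> and the complete
  log-likelihood drops quadratically away from it, with weights \<open>n\<close>, \<open>d\<close> and \<open>n d\<close>, the variational estimator is within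
  the stated rates of it.
\<close>

section \<open>Regular exponential families\<close>

text \<open>The additive error has to tend to 0 itself, not only relative to n or d: the rates arise
  by dividing it by the weights n, d and nd and taking roots. Exponential gaps per row and column
  achieve this, since log n = o(d) and log d = o(n) make n exp(-c'd) and d exp(-c'n) vanish.

  The obstacle is that a competitive (tau, nu, theta) depends on the data. The coarse localisation
  therefore needs the noise to be small for all weights in [0,1] at once. A bilinear form is
  extremal at subsets, and the 2^(n+d) rectangles of cells are outweighed by a Chernoff bound
  exp(-const nd). This shows only that the misplaced column mass is a small fraction of d, not that
  every column is nearly right. So the noise of a row still carries data-dependent weights, and
  truncation at a level T controls the misplaced part. In the column step the rows already carry
  their true labels, so no truncation occurs there.

  The labelling of the estimator is arbitrary and may change with the sample. The permutations are
  thus random; they are chosen measurably as minimisers of one weighted loss, so that one pair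
  serves all three estimates.\<close>

text \<open>Serves to differentiate under the integral sign: in \<open>DERIV_moment\<close> a single
  dominating function provides the quadratic error.\<close>

lemma DERIV_from_quadratic_error:
  fixes f :: "real \<Rightarrow> real"
  assumes r: "r > 0" and err: "\<And>h. \<bar>h\<bar> < r \<Longrightarrow> \<bar>f (a + h) - f a - h * D\<bar> \<le> C * h\<^sup>2"
  shows "(f has_real_derivative D) (at a)"
proof -
  have "((\<lambda>h. (f (a + h) - f a) / h - D) \<longlongrightarrow> 0) (at 0)"
  proof (rule Lim_null_comparison)
    have "\<forall>\<^sub>F h in at (0::real). h \<noteq> 0 \<and> \<bar>h\<bar> < r"
      unfolding eventually_at using r by (intro exI[of _ r]) (auto simp: dist_real_def)
    then show "\<forall>\<^sub>F h in at 0. norm ((f (a + h) - f a) / h - D) \<le> C * \<bar>h\<bar>"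
    proof (rule eventually_mono)
      fix h :: real assume h: "h \<noteq> 0 \<and> \<bar>h\<bar> < r"
      have "(f (a + h) - f a) / h - D = (f (a + h) - f a - h * D) / h"
        using h by (simp add: field_simps)
      also have "\<bar>\<dots>\<bar> \<le> C * h\<^sup>2 / \<bar>h\<bar>"
        unfolding abs_divide using err[of h] h by (intro divide_right_mono) auto
      also have "\<dots> = C * \<bar>h\<bar>"
        using h by (simp add: power2_eq_square abs_if)
      finally show "norm ((f (a + h) - f a) / h - D) \<le> C * \<bar>h\<bar>" by simp
    qed
    show "((\<lambda>h. C * \<bar>h\<bar>) \<longlongrightarrow> 0) (at (0::real))"
      by (auto intro!: tendsto_eq_intros)
  qed
  then show ?thesis
    unfolding DERIV_def using LIM_zero_iff[of "\<lambda>h. (f (a + h) - f a) / h" D "at 0"] by simp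
qed

text \<open>The left side over \<open>fact k\<close> is one term of the exponential series. It
  trades a power for a little more exponential tilt.\<close>

lemma pow_le_exp: "0 \<le> (t::real) \<Longrightarrow> t ^ k \<le> fact k * exp t"
proof -
  assume t: "0 \<le> t"
  have "t ^ k /\<^sub>R fact k \<le> (\<Sum>i\<le>k. t ^ i /\<^sub>R fact i)"
    by (rule member_le_sum) (use t in auto)
  also have "\<dots> \<le> exp t"
    unfolding exp_def by (rule sum_le_suminf[OF summable_exp_generic]) (use t in auto)
  finally show ?thesis by (simp add: field_simps)
qed

text \<open>The Bregman divergence of \<open>\<psi>\<close>. For an exponential family it is the
  Kullback-Leibler divergence of the member \<open>a'\<close> from the member \<open>a\<close>, and
  also the log moment generating function of the centred member \<open>a\<close> at
  \<open>a' - a\<close> (see \<open>mgf_expfam\<close>).\<close>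

definition bregman :: "(real \<Rightarrow> real) \<Rightarrow> real \<Rightarrow> real \<Rightarrow> real" where
  "bregman \<psi> a a' = \<psi> a' - \<psi> a - (a' - a) * deriv \<psi> a"

locale exponential_family =
  fixes \<nu> :: "real measure" and b \<psi> :: "real \<Rightarrow> real" and A :: "real set"
  assumes family: "regular_expfam \<nu> b \<psi> A" and inj_family: "inj_on (expfam \<nu> b \<psi>) A"
begin

lemma sets_nu [simp, measurable_cong]: "sets \<nu> = sets borel"
  and b_measurable [measurable]: "b \<in> borel_measurable borel"
  and b_nonneg [simp]: "0 \<le> b x"
  and A_eq: "A = {\<alpha>. integrable \<nu> (\<lambda>x. b x * exp (\<alpha> * x))}"
  and A_open: "open A"
  and integral_phi: "\<alpha> \<in> A \<Longrightarrow> (\<integral>x. phi b \<psi> x \<alpha> \<partial>\<nu>) = 1"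
  using family by (auto simp: regular_expfam_def)

lemma space_nu [simp]: "space \<nu> = UNIV"
  using sets_eq_imp_space_eq[OF sets_nu] by simp

lemma integrable_b: "\<alpha> \<in> A \<Longrightarrow> integrable \<nu> (\<lambda>x. b x * exp (\<alpha> * x))"
  using A_eq by auto

text \<open>For \<open>t\<close> between \<open>a\<close> and \<open>c\<close>,
  \<open>exp (t * x)\<close> is dominated by \<open>exp (c * x)\<close> when \<open>x\<close> is
  nonnegative and by \<open>exp (a * x)\<close> otherwise.\<close>

lemma A_interval: "a \<in> A \<Longrightarrow> c \<in> A \<Longrightarrow> {a..c} \<subseteq> A"
proof
  fix t assume a: "a \<in> A" and c: "c \<in> A" and t: "t \<in> {a..c}"
  have "integrable \<nu> (\<lambda>x. b x * exp (t * x))"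
  proof (rule Bochner_Integration.integrable_bound)
    show "integrable \<nu> (\<lambda>x. b x * exp (a * x) + b x * exp (c * x))"
      using integrable_b a c by auto
    have "exp (t * x) \<le> exp (a * x) + exp (c * x)" for x
    proof (cases "x \<ge> 0")
      case True
      then have "exp (t * x) \<le> exp (c * x)" using t by (simp add: mult_right_mono)
      then show ?thesis by (smt (verit) exp_ge_zero)
    next
      case False
      then have "exp (t * x) \<le> exp (a * x)" using t by (simp add: mult_right_mono_neg)
      then show ?thesis by (smt (verit) exp_ge_zero)
    qed
    then show "AE x in \<nu>. norm (b x * exp (t * x)) \<le> norm (b x * exp (a * x) + b x * exp (c * x))"
      by (intro AE_I2) (simp add: abs_mult distrib_left[symmetric] mult_left_mono)
  qed simp
  then show "t \<in> A" using A_eq by auto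
qed

text \<open>The slack \<open>\<delta> - \<eta>\<close> absorbs the power, and
  \<open>exp (\<delta> * \<bar>x\<bar>)\<close> is at most the sum of the two one-sided tilts, both
  of which are integrable. The result is the dominating function for all moments and their
  derivatives.\<close>

lemma integrable_power_exp_abs:
  assumes "\<alpha> - \<delta> \<in> A" "\<alpha> + \<delta> \<in> A" "0 < \<eta>" "\<eta> < \<delta>"
  shows "integrable \<nu> (\<lambda>x. \<bar>x\<bar> ^ k * (b x * exp (\<alpha> * x + \<eta> * \<bar>x\<bar>)))"
proof (rule Bochner_Integration.integrable_bound)
  define c where "c = fact k / (\<delta> - \<eta>) ^ k"
  have c: "c \<ge> 0" using assms by (simp add: c_def)
  show "integrable \<nu> (\<lambda>x. c * (b x * exp ((\<alpha> - \<delta>) * x) + b x * exp ((\<alpha> + \<delta>) * x)))"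
    using integrable_b assms by auto
  have le: "\<bar>x\<bar> ^ k * exp (\<alpha> * x + \<eta> * \<bar>x\<bar>) \<le> c * (exp ((\<alpha> - \<delta>) * x) + exp ((\<alpha> + \<delta>) * x))" for x
  proof -
    have "((\<delta> - \<eta>) * \<bar>x\<bar>) ^ k \<le> fact k * exp ((\<delta> - \<eta>) * \<bar>x\<bar>)"
      by (rule pow_le_exp) (use assms in auto)
    then have "\<bar>x\<bar> ^ k \<le> c * exp ((\<delta> - \<eta>) * \<bar>x\<bar>)"
      unfolding c_def times_divide_eq_left power_mult_distrib
      using assms by (simp add: pos_le_divide_eq mult.commute)
    then have "\<bar>x\<bar> ^ k * exp (\<alpha> * x + \<eta> * \<bar>x\<bar>) \<le> c * exp ((\<delta> - \<eta>) * \<bar>x\<bar>) * exp (\<alpha> * x + \<eta> * \<bar>x\<bar>)"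
      by (intro mult_right_mono) auto
    also have "\<dots> = c * exp (\<alpha> * x + \<delta> * \<bar>x\<bar>)"
      by (simp add: mult.assoc exp_add[symmetric] algebra_simps)
    also have "\<dots> \<le> c * (exp ((\<alpha> - \<delta>) * x) + exp ((\<alpha> + \<delta>) * x))"
    proof (rule mult_left_mono[OF _ c])
      show "exp (\<alpha> * x + \<delta> * \<bar>x\<bar>) \<le> exp ((\<alpha> - \<delta>) * x) + exp ((\<alpha> + \<delta>) * x)"
        by (cases "x \<ge> 0") (simp_all add: algebra_simps)
    qed
    finally show ?thesis .
  qed
  show "AE x in \<nu>. norm (\<bar>x\<bar> ^ k * (b x * exp (\<alpha> * x + \<eta> * \<bar>x\<bar>)))
      \<le> norm (c * (b x * exp ((\<alpha> - \<delta>) * x) + b x * exp ((\<alpha> + \<delta>) * x)))"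
  proof (rule AE_I2)
    fix x
    have "b x * (\<bar>x\<bar> ^ k * exp (\<alpha> * x + \<eta> * \<bar>x\<bar>)) \<le> b x * (c * (exp ((\<alpha> - \<delta>) * x) + exp ((\<alpha> + \<delta>) * x)))"
      by (intro mult_left_mono le) simp
    then show "norm (\<bar>x\<bar> ^ k * (b x * exp (\<alpha> * x + \<eta> * \<bar>x\<bar>)))
      \<le> norm (c * (b x * exp ((\<alpha> - \<delta>) * x) + b x * exp ((\<alpha> + \<delta>) * x)))"
      using c by (simp add: abs_mult algebra_simps)
  qed
qed simp

lemma A_neighbourhood:
  assumes "\<alpha> \<in> A"
  obtains \<delta> where "\<delta> > 0" "\<And>t. \<bar>t - \<alpha>\<bar> \<le> \<delta> \<Longrightarrow> t \<in> A"
proof -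
  obtain e where "e > 0" "cball \<alpha> e \<subseteq> A"
    using A_open assms open_contains_cball by blast
  then show ?thesis by (intro that[of e]) (auto simp: dist_real_def abs_minus_commute)
qed

text \<open>Moments are left unnormalised: they are the successive derivatives of the Laplace
  transform, and can be differentiated before anything is known about the smoothness of
  \<open>\<psi>\<close>.\<close>

definition moment :: "nat \<Rightarrow> real \<Rightarrow> real" where
  "moment k \<alpha> = (\<integral>x. x ^ k * (b x * exp (\<alpha> * x)) \<partial>\<nu>)"

lemma integrable_moment:
  assumes "\<alpha> \<in> A"
  shows "integrable \<nu> (\<lambda>x. x ^ k * (b x * exp (\<alpha> * x)))"
proof -
  obtain \<delta> where d: "\<delta> > 0" "\<And>t. \<bar>t - \<alpha>\<bar> \<le> \<delta> \<Longrightarrow> t \<in> A" using A_neighbourhood[OF assms] by blast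
  show ?thesis
  proof (rule Bochner_Integration.integrable_bound)
    show "integrable \<nu> (\<lambda>x. \<bar>x\<bar> ^ k * (b x * exp (\<alpha> * x + (\<delta>/2) * \<bar>x\<bar>)))"
      by (rule integrable_power_exp_abs[of _ \<delta>]) (use d in auto)
    show "AE x in \<nu>. norm (x ^ k * (b x * exp (\<alpha> * x))) \<le> norm (\<bar>x\<bar> ^ k * (b x * exp (\<alpha> * x + (\<delta>/2) * \<bar>x\<bar>)))"
      using d(1) by (intro AE_I2) (auto simp: abs_mult power_abs intro!: mult_left_mono)
  qed simp
qed

text \<open>The first-order Taylor remainder of \<open>exp (h * x)\<close> is at most
  \<open>(h * x)^2 * exp \<bar>h * x\<bar>\<close>. With \<open>\<bar>h\<bar> < \<delta>/2\<close>
  this is \<open>h^2\<close> times a function integrable by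
  \<open>integrable_power_exp_abs\<close>.\<close>

lemma DERIV_moment:
  assumes "\<alpha> \<in> A"
  shows "(moment k has_real_derivative moment (Suc k) \<alpha>) (at \<alpha>)"
proof -
  obtain \<delta> where d: "\<delta> > 0" "\<And>t. \<bar>t - \<alpha>\<bar> \<le> \<delta> \<Longrightarrow> t \<in> A" using A_neighbourhood[OF assms] by blast
  define g where "g x = \<bar>x\<bar> ^ (k + 2) * (b x * exp (\<alpha> * x + (\<delta>/2) * \<bar>x\<bar>))" for x
  have g: "integrable \<nu> g"
    unfolding g_def by (rule integrable_power_exp_abs[of _ \<delta>]) (use d in auto)
  show ?thesis
  proof (rule DERIV_from_quadratic_error[of "\<delta>/2" _ _ _ "\<integral>x. g x \<partial>\<nu>"])
    fix h :: real assume h: "\<bar>h\<bar> < \<delta>/2"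
    let ?f = "\<lambda>x. x ^ k * (b x * exp ((\<alpha> + h) * x)) - x ^ k * (b x * exp (\<alpha> * x)) - h * (x ^ Suc k * (b x * exp (\<alpha> * x)))"
    have inA: "\<alpha> + h \<in> A" using h d by auto
    have int: "integrable \<nu> ?f"
      by (intro Bochner_Integration.integrable_diff integrable_moment integrable_mult_right inA assms)
    have eq: "moment k (\<alpha> + h) - moment k \<alpha> - h * moment (Suc k) \<alpha> = (\<integral>x. ?f x \<partial>\<nu>)"
      unfolding moment_def
      by (subst Bochner_Integration.integral_diff Bochner_Integration.integral_mult_right_zero
          | intro Bochner_Integration.integrable_diff integrable_moment integrable_mult_right inA assms)+
         (rule refl)
    have "\<bar>\<integral>x. ?f x \<partial>\<nu>\<bar> \<le> (\<integral>x. h\<^sup>2 * g x \<partial>\<nu>)"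
    proof (rule integral_abs_bound[THEN order_trans], rule integral_mono)
      show "integrable \<nu> (\<lambda>x. \<bar>?f x\<bar>)" using int by (rule integrable_abs)
      show "integrable \<nu> (\<lambda>x. h\<^sup>2 * g x)" using g by auto
      fix x
      have "norm (exp (h * x) - (\<Sum>i\<le>1. (h * x) ^ i / fact i)) \<le> exp (norm (h * x)) * norm (h * x) ^ Suc 1 / fact 1"
        by (rule Taylor_exp_field)
      then have t: "\<bar>exp (h * x) - 1 - h * x\<bar> \<le> exp \<bar>h * x\<bar> * (h * x)\<^sup>2"
        by (simp add: power2_eq_square abs_mult algebra_simps)
      have "exp \<bar>h * x\<bar> \<le> exp (\<delta>/2 * \<bar>x\<bar>)"
        unfolding exp_le_cancel_iff abs_mult using h by (intro mult_right_mono) auto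
      then have t2: "\<bar>exp (h * x) - 1 - h * x\<bar> \<le> exp (\<delta>/2 * \<bar>x\<bar>) * (h * x)\<^sup>2"
        using t by (smt (verit) mult_right_mono zero_le_power2)
      have feq: "?f x = x ^ k * (b x * exp (\<alpha> * x)) * (exp (h * x) - 1 - h * x)"
        by (simp add: algebra_simps exp_add)
      have pw: "\<bar>x\<bar> ^ (k + 2) = \<bar>x\<bar> ^ k * x\<^sup>2" by (simp add: power_add power2_eq_square)
      from feq have "\<bar>?f x\<bar> = \<bar>x\<bar> ^ k * (b x * exp (\<alpha> * x)) * \<bar>exp (h * x) - 1 - h * x\<bar>"
        by (simp add: abs_mult power_abs)
      also have "\<dots> \<le> \<bar>x\<bar> ^ k * (b x * exp (\<alpha> * x)) * (exp (\<delta>/2 * \<bar>x\<bar>) * (h * x)\<^sup>2)"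
        by (intro mult_left_mono t2) auto
      finally have "\<bar>?f x\<bar> \<le> \<bar>x\<bar> ^ k * (b x * exp (\<alpha> * x)) * (exp (\<delta>/2 * \<bar>x\<bar>) * (h * x)\<^sup>2)" .
      moreover have "\<bar>x\<bar> ^ k * (b x * exp (\<alpha> * x)) * (exp (\<delta>/2 * \<bar>x\<bar>) * (h * x)\<^sup>2) = h\<^sup>2 * g x"
        unfolding g_def pw exp_add power_mult_distrib by simp
      ultimately show "\<bar>?f x\<bar> \<le> h\<^sup>2 * g x" by simp
    qed
    also have "(\<integral>x. h\<^sup>2 * g x \<partial>\<nu>) = (\<integral>x. g x \<partial>\<nu>) * h\<^sup>2"
      unfolding Bochner_Integration.integral_mult_right_zero by (rule mult.commute)
    finally show "\<bar>moment k (\<alpha> + h) - moment k \<alpha> - h * moment (Suc k) \<alpha>\<bar> \<le> (\<integral>x. g x \<partial>\<nu>) * h\<^sup>2"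
      unfolding eq .
  qed (use d in auto)
qed

lemma integrable_phi: "\<alpha> \<in> A \<Longrightarrow> integrable \<nu> (\<lambda>x. phi b \<psi> x \<alpha>)"
  using integrable_b[of \<alpha>] by (auto simp: phi_def exp_diff)

lemma phi_measurable [measurable]: "(\<lambda>x. phi b \<psi> x \<alpha>) \<in> borel_measurable borel"
  unfolding phi_def by measurable

lemma phi_nonneg [simp]: "0 \<le> phi b \<psi> x \<alpha>"
  by (simp add: phi_def)

text \<open>Normalisation of the densities identifies \<open>\<psi>\<close> on \<open>A\<close> with
  the logarithm of the Laplace transform. All regularity of \<open>\<psi>\<close> is derived from
  this.\<close>

lemma moment_0: "\<alpha> \<in> A \<Longrightarrow> moment 0 \<alpha> = exp (\<psi> \<alpha>)"
proof -
  assume a: "\<alpha> \<in> A"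
  have "exp (\<alpha> * x - \<psi> \<alpha>) = exp (- \<psi> \<alpha>) * exp (\<alpha> * x)" for x
    unfolding exp_add[symmetric] by simp
  then have "(\<lambda>x. phi b \<psi> x \<alpha>) = (\<lambda>x. exp (- \<psi> \<alpha>) * (x ^ 0 * (b x * exp (\<alpha> * x))))"
    by (simp add: phi_def mult.left_commute)
  then have "exp (- \<psi> \<alpha>) * moment 0 \<alpha> = 1"
    using integral_phi[OF a] unfolding moment_def by (simp only: Bochner_Integration.integral_mult_right_zero)
  then show ?thesis
    unfolding exp_minus by (auto dest!: inverse_unique)
qed

lemma DERIV_psi: "\<alpha> \<in> A \<Longrightarrow> (\<psi> has_real_derivative moment 1 \<alpha> / moment 0 \<alpha>) (at \<alpha>)"
proof -
  assume a: "\<alpha> \<in> A"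
  have "((\<lambda>a. ln (moment 0 a)) has_real_derivative moment 1 \<alpha> / moment 0 \<alpha>) (at \<alpha>)"
  proof -
    have "moment 0 \<alpha> > 0" by (simp add: moment_0[OF a])
    then have "(ln has_real_derivative 1 / moment 0 \<alpha>) (at (moment 0 \<alpha>))" by (rule DERIV_ln_divide)
    then have "(ln \<circ> moment 0 has_real_derivative 1 / moment 0 \<alpha> * moment (Suc 0) \<alpha>) (at \<alpha>)"
      by (rule DERIV_chain) (rule DERIV_moment[OF a])
    then show ?thesis by (simp add: o_def)
  qed
  then show ?thesis
    by (rule has_field_derivative_transform_within_open[OF _ A_open a]) (simp add: moment_0)
qed

lemma deriv_psi: "\<alpha> \<in> A \<Longrightarrow> deriv \<psi> \<alpha> = moment 1 \<alpha> / moment 0 \<alpha>"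
  by (rule DERIV_imp_deriv[OF DERIV_psi])

lemma psi_has_deriv: "\<alpha> \<in> A \<Longrightarrow> (\<psi> has_real_derivative deriv \<psi> \<alpha>) (at \<alpha>)"
  using DERIV_psi deriv_psi by simp

text \<open>The variance of the member \<open>\<alpha>\<close>, written with unnormalised moments;
  it is the second derivative of \<open>\<psi>\<close>.\<close>

definition psi2 :: "real \<Rightarrow> real" where
  "psi2 \<alpha> = (moment 2 \<alpha> * moment 0 \<alpha> - (moment 1 \<alpha>)\<^sup>2) / (moment 0 \<alpha>)\<^sup>2"

lemma deriv_psi_has_deriv: "\<alpha> \<in> A \<Longrightarrow> (deriv \<psi> has_real_derivative psi2 \<alpha>) (at \<alpha>)"
proof -
  assume a: "\<alpha> \<in> A"
  have "((\<lambda>a. moment 1 a / moment 0 a) has_real_derivative psi2 \<alpha>) (at \<alpha>)"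
    by (rule derivative_eq_intros DERIV_moment a)+
       (auto simp: moment_0 a psi2_def power2_eq_square numeral_2_eq_2)
  then show ?thesis
    by (rule has_field_derivative_transform_within_open[OF _ A_open a]) (simp add: deriv_psi)
qed

lemma continuous_psi2: "continuous_on A psi2"
proof -
  have c: "continuous_on A (moment k)" for k
    by (intro continuous_at_imp_continuous_on ballI DERIV_isCont[OF DERIV_moment])
  then show ?thesis
    unfolding psi2_def by (intro continuous_intros c) (simp add: moment_0)
qed

text \<open>A vanishing variance would make all members of the family coincide.\<close>

lemma psi2_pos:
  assumes a: "\<alpha> \<in> A"
  shows "psi2 \<alpha> > 0"
proof -
  define M where "M = moment 0 \<alpha>"
  define \<mu> where "\<mu> = moment 1 \<alpha> / M"
  have M: "M > 0" using moment_0[OF a] by (simp add: M_def)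
  let ?w = "\<lambda>x. b x * exp (\<alpha> * x)"
  let ?q = "\<lambda>x. (x - \<mu>)\<^sup>2 * ?w x"
  have q: "?q = (\<lambda>x. x ^ 2 * ?w x - 2 * \<mu> * (x ^ 1 * ?w x) + \<mu>\<^sup>2 * (x ^ 0 * ?w x))"
    by (auto simp: power2_eq_square algebra_simps)
  have int: "integrable \<nu> ?q"
    unfolding q by (intro Bochner_Integration.integrable_diff Bochner_Integration.integrable_add integrable_moment integrable_mult_right a)
  have "(\<integral>x. ?q x \<partial>\<nu>) = moment 2 \<alpha> - 2 * \<mu> * moment 1 \<alpha> + \<mu>\<^sup>2 * moment 0 \<alpha>"
    unfolding q moment_def
    by (subst Bochner_Integration.integral_diff Bochner_Integration.integral_add Bochner_Integration.integral_mult_right_zero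
          | intro Bochner_Integration.integrable_diff Bochner_Integration.integrable_add integrable_moment integrable_mult_right a)+
         (rule refl)
  also have "\<dots> = M * psi2 \<alpha>"
    using M by (simp add: psi2_def \<mu>_def M_def[symmetric] power2_eq_square field_simps)
  finally have eq: "(\<integral>x. ?q x \<partial>\<nu>) = M * psi2 \<alpha>" .
  have "psi2 \<alpha> \<noteq> 0"
  proof
    assume "psi2 \<alpha> = 0"
    then have "(\<integral>x. ?q x \<partial>\<nu>) = 0" using eq by simp
    then have ae: "AE x in \<nu>. ?q x = 0"
      using integral_nonneg_eq_0_iff_AE[OF int] by auto
    obtain \<delta> where d: "\<delta> > 0" "\<And>t. \<bar>t - \<alpha>\<bar> \<le> \<delta> \<Longrightarrow> t \<in> A" using A_neighbourhood[OF a] by blast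
    define \<beta> where "\<beta> = \<alpha> + \<delta>"
    have \<beta>: "\<beta> \<in> A" "\<beta> \<noteq> \<alpha>" using d by (auto simp: \<beta>_def)
    \<comment> \<open>With zero variance, \<open>b x = 0\<close> for almost every \<open>x\<close>
      other than \<open>\<mu>\<close>. The density ratio of \<open>\<beta>\<close> to
      \<open>\<alpha>\<close> is then the constant \<open>K\<close>, and integrating both densities
      forces \<open>K = 1\<close>.\<close>
    define K where "K = exp ((\<beta> - \<alpha>) * \<mu> - (\<psi> \<beta> - \<psi> \<alpha>))"
    have ae2: "AE x in \<nu>. phi b \<psi> x \<beta> = K * phi b \<psi> x \<alpha>"
      using ae
    proof (rule AE_mp, intro AE_I2 impI)
      fix x assume "?q x = 0"
      then have "b x = 0 \<or> x = \<mu>" by auto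
      then show "phi b \<psi> x \<beta> = K * phi b \<psi> x \<alpha>"
        by (auto simp: phi_def K_def exp_add[symmetric] algebra_simps)
    qed
    have "1 = (\<integral>x. phi b \<psi> x \<beta> \<partial>\<nu>)" using integral_phi \<beta> by simp
    also have "\<dots> = (\<integral>x. K * phi b \<psi> x \<alpha> \<partial>\<nu>)"
      using ae2 by (intro integral_cong_AE) auto
    also have "\<dots> = K" using integral_phi[OF a] by simp
    finally have "AE x in \<nu>. ennreal (phi b \<psi> x \<beta>) = ennreal (phi b \<psi> x \<alpha>)" using ae2 by simp
    then have "expfam \<nu> b \<psi> \<beta> = expfam \<nu> b \<psi> \<alpha>"
      unfolding expfam_def by (intro density_cong) auto
    then show False using inj_family \<beta> a by (auto dest: inj_onD)
  qed
  moreover have "M * psi2 \<alpha> \<ge> 0"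
    unfolding eq[symmetric] by (intro integral_nonneg_AE AE_I2) simp
  ultimately show ?thesis using M by (simp add: zero_le_mult_iff less_le)
qed

text \<open>By Taylor's formula the divergence is \<open>psi2 t / 2 * (a - a')^2\<close> at an
  intermediate \<open>t\<close>, and the continuous positive function \<open>psi2\<close> attains
  its extrema on the interval. The lower bound measures separation of classes; the upper bound gives
  sub-Gaussian noise and the cost of small parameter errors.\<close>

lemma bregman_bounds:
  assumes "{lo..hi} \<subseteq> A" "lo \<le> hi"
  obtains \<kappa> K where "\<kappa> > 0" "K > 0"
    "\<And>a a'. a \<in> {lo..hi} \<Longrightarrow> a' \<in> {lo..hi} \<Longrightarrow> \<kappa> * (a - a')\<^sup>2 \<le> bregman \<psi> a a' \<and> bregman \<psi> a a' \<le> K * (a - a')\<^sup>2"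
proof -
  have cont: "continuous_on {lo..hi} psi2" using continuous_psi2 assms(1) by (rule continuous_on_subset)
  obtain u where u: "u \<in> {lo..hi}" "\<And>y. y \<in> {lo..hi} \<Longrightarrow> psi2 u \<le> psi2 y"
    using continuous_attains_inf[OF compact_Icc _ cont] assms(2) by auto
  obtain v where v: "v \<in> {lo..hi}" "\<And>y. y \<in> {lo..hi} \<Longrightarrow> psi2 y \<le> psi2 v"
    using continuous_attains_sup[OF compact_Icc _ cont] assms(2) by auto
  show thesis
  proof (rule that[of "psi2 u / 2" "psi2 v / 2"])
    show "psi2 u / 2 > 0" "psi2 v / 2 > 0" using psi2_pos u v assms(1) by auto
    fix a a' assume aa: "a \<in> {lo..hi}" "a' \<in> {lo..hi}"
    show "psi2 u / 2 * (a - a')\<^sup>2 \<le> bregman \<psi> a a' \<and> bregman \<psi> a a' \<le> psi2 v / 2 * (a - a')\<^sup>2"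
    proof (cases "a' = a")
      case False
      define diff where "diff m = (if m = 0 then \<psi> else if m = 1 then deriv \<psi> else psi2)" for m :: nat
      have "\<exists>t. (if a' < a then a' < t \<and> t < a else a < t \<and> t < a') \<and>
          \<psi> a' = (\<Sum>m<2. (diff m a / fact m) * (a' - a)^m) + (diff 2 t / fact 2) * (a' - a)^2"
      proof (rule Taylor[of 2 diff \<psi> lo hi])
        show "\<forall>m t. m < 2 \<and> lo \<le> t \<and> t \<le> hi \<longrightarrow> DERIV (diff m) t :> diff (Suc m) t"
        proof (intro allI impI, elim conjE)
          fix m :: nat and t assume "m < 2" "lo \<le> t" "t \<le> hi"
          then have "t \<in> A" "m = 0 \<or> m = 1" using assms(1) by auto
          then show "DERIV (diff m) t :> diff (Suc m) t"
            using psi_has_deriv deriv_psi_has_deriv by (auto simp: diff_def)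
        qed
      qed (use aa False in \<open>auto simp: diff_def\<close>)
      then obtain t where t: "if a' < a then a' < t \<and> t < a else a < t \<and> t < a'"
        "\<psi> a' = (\<Sum>m<2. (diff m a / fact m) * (a' - a)^m) + (diff 2 t / fact 2) * (a' - a)^2" by blast
      have tI: "t \<in> {lo..hi}" using t(1) aa by (auto split: if_splits)
      have "bregman \<psi> a a' = psi2 t / 2 * (a - a')\<^sup>2"
        using t(2) by (simp add: bregman_def diff_def numeral_2_eq_2 power2_commute algebra_simps)
      then show ?thesis using u(2)[OF tI] v(2)[OF tI] by (simp add: mult_right_mono)
    qed (simp add: bregman_def)
  qed
qed

lemma deriv_psi_strict_mono:
  assumes "a \<in> A" "c \<in> A" "a < c"
  shows "deriv \<psi> a < deriv \<psi> c"
  using assms(3)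
proof (rule DERIV_pos_imp_increasing)
  fix x assume "a \<le> x" "x \<le> c"
  then have "x \<in> A" using A_interval[OF assms(1,2)] by auto
  then show "\<exists>y. (deriv \<psi> has_real_derivative y) (at x) \<and> 0 < y"
    using deriv_psi_has_deriv psi2_pos by blast
qed

lemma inj_deriv_psi: "inj_on (deriv \<psi>) A"
  by (rule inj_onI) (metis deriv_psi_strict_mono less_irrefl linorder_less_linear)

lemma continuous_deriv_psi: "continuous_on A (deriv \<psi>)"
  by (intro continuous_at_imp_continuous_on ballI DERIV_isCont[OF deriv_psi_has_deriv])

text \<open>Monotone on the range of \<open>deriv \<psi>\<close>, which is an interval, and constant
  off it; both pieces are Borel.\<close>

lemma inv_deriv_psi_measurable: "inv_into (interior A) (deriv \<psi>) \<in> borel_measurable borel"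
proof -
  have int: "interior A = A" using A_open by (rule interior_open)
  let ?R = "deriv \<psi> ` A" and ?f = "inv_into A (deriv \<psi>)"
  have "connected A"
    unfolding is_interval_connected_1[symmetric] is_interval_1 using A_interval by fastforce
  then have "is_interval ?R"
    unfolding is_interval_connected_1 by (intro connected_continuous_image continuous_deriv_psi)
  then have R: "?R \<in> sets borel" by (rule real_interval_borel_measurable)
  have mono: "mono_on ?R ?f"
  proof (rule mono_onI)
    fix r s assume rs: "r \<in> ?R" "s \<in> ?R" "r \<le> s"
    then obtain a c where ac: "a \<in> A" "r = deriv \<psi> a" "c \<in> A" "s = deriv \<psi> c" by auto
    have "a \<le> c" using deriv_psi_strict_mono[of c a] ac rs by force
    then show "?f r \<le> ?f s" using ac inj_deriv_psi by simp
  qed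
  \<comment> \<open>Off the range the predicate inside the choice operator is identically false, so
    \<open>inv_into\<close> returns one fixed unspecified value.\<close>
  have out: "?f r = (SOME a. False)" if "r \<notin> ?R" for r
  proof -
    have "(\<lambda>a. a \<in> A \<and> deriv \<psi> a = r) = (\<lambda>a. False)" using that by auto
    then show ?thesis unfolding inv_into_def by simp
  qed
  have "(\<lambda>r. if r \<in> ?R then ?f r else (SOME a. False)) \<in> borel_measurable borel"
    using R borel_measurable_mono_on_fnc[OF mono] by (subst measurable_If_restrict_space_iff) auto
  moreover have "(\<lambda>r. if r \<in> ?R then ?f r else (SOME a. False)) = ?f" using out by auto
  ultimately show ?thesis unfolding int by simp
qed

text \<open>The intermediate value theorem on \<open>{a - s..a + s}\<close>. It gives continuity of
  the inverse at \<open>deriv \<psi> a\<close> together with solvability of the likelihood equation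
  for every mean nearby.\<close>

lemma inv_deriv_psi_near:
  assumes "a \<in> A" "e > 0"
  obtains r where "r > 0" "\<And>y. \<bar>y - deriv \<psi> a\<bar> \<le> r \<Longrightarrow>
    \<bar>inv_into (interior A) (deriv \<psi>) y - a\<bar> \<le> e \<and> deriv \<psi> (inv_into (interior A) (deriv \<psi>) y) = y"
proof -
  have int: "interior A = A" using A_open by (rule interior_open)
  obtain \<delta> where d: "\<delta> > 0" "\<And>t. \<bar>t - a\<bar> \<le> \<delta> \<Longrightarrow> t \<in> A" using A_neighbourhood[OF assms(1)] by blast
  define s where "s = min \<delta> e"
  have s: "s > 0" "s \<le> \<delta>" "s \<le> e" using d assms by (auto simp: s_def)
  have sA: "a - s \<in> A" "a + s \<in> A" using d s by auto
  have m: "deriv \<psi> (a - s) < deriv \<psi> a" "deriv \<psi> a < deriv \<psi> (a + s)"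
    using deriv_psi_strict_mono sA assms s by auto
  show thesis
  proof (rule that[of "min (deriv \<psi> a - deriv \<psi> (a - s)) (deriv \<psi> (a + s) - deriv \<psi> a)"])
    show "min (deriv \<psi> a - deriv \<psi> (a - s)) (deriv \<psi> (a + s) - deriv \<psi> a) > 0" using m by simp
    fix y assume y: "\<bar>y - deriv \<psi> a\<bar> \<le> min (deriv \<psi> a - deriv \<psi> (a - s)) (deriv \<psi> (a + s) - deriv \<psi> a)"
    have "\<exists>x\<ge>a - s. x \<le> a + s \<and> deriv \<psi> x = y"
    proof (rule IVT')
      show "continuous_on {a - s..a + s} (deriv \<psi>)"
        using A_interval[OF sA] continuous_deriv_psi continuous_on_subset by blast
    qed (use y s in auto)
    then obtain x where x: "a - s \<le> x" "x \<le> a + s" "deriv \<psi> x = y" by auto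
    then have "x \<in> A" using A_interval[OF sA] by auto
    then have "inv_into (interior A) (deriv \<psi>) y = x"
      unfolding int x(3)[symmetric] by (intro inv_into_f_f inj_deriv_psi)
    then show "\<bar>inv_into (interior A) (deriv \<psi>) y - a\<bar> \<le> e \<and> deriv \<psi> (inv_into (interior A) (deriv \<psi>) y) = y"
      using x s by auto
  qed
qed

lemma sets_expfam [simp, measurable_cong]: "sets (expfam \<nu> b \<psi> \<alpha>) = sets borel"
  by (simp add: expfam_def)

lemma space_expfam [simp]: "space (expfam \<nu> b \<psi> \<alpha>) = UNIV"
  by (simp add: expfam_def)

lemma nn_integral_phi: "\<alpha> \<in> A \<Longrightarrow> (\<integral>\<^sup>+x. ennreal (phi b \<psi> x \<alpha>) \<partial>\<nu>) = 1"
  using integral_phi[of \<alpha>] integrable_phi[of \<alpha>] by (subst nn_integral_eq_integral) auto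

lemma prob_space_expfam: "\<alpha> \<in> A \<Longrightarrow> prob_space (expfam \<nu> b \<psi> \<alpha>)"
  by (rule prob_spaceI) (simp add: expfam_def emeasure_density nn_integral_phi)

text \<open>Tilting the member \<open>\<alpha>\<close> by \<open>exp (t * x)\<close> yields the
  member \<open>\<alpha> + t\<close> up to normalisation; the normalising factor is the exponential
  of a divergence.\<close>

lemma mgf_expfam:
  assumes "\<alpha> \<in> A" "\<alpha> + t \<in> A"
  shows "(\<integral>\<^sup>+x. ennreal (exp (t * (x - deriv \<psi> \<alpha>))) \<partial>expfam \<nu> b \<psi> \<alpha>) = ennreal (exp (bregman \<psi> \<alpha> (\<alpha> + t)))"
proof -
  have "(\<integral>\<^sup>+x. ennreal (exp (t * (x - deriv \<psi> \<alpha>))) \<partial>expfam \<nu> b \<psi> \<alpha>)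
      = (\<integral>\<^sup>+x. ennreal (phi b \<psi> x \<alpha>) * ennreal (exp (t * (x - deriv \<psi> \<alpha>))) \<partial>\<nu>)"
    unfolding expfam_def by (rule nn_integral_density) auto
  also have "\<dots> = (\<integral>\<^sup>+x. ennreal (exp (bregman \<psi> \<alpha> (\<alpha> + t))) * ennreal (phi b \<psi> x (\<alpha> + t)) \<partial>\<nu>)"
    by (intro nn_integral_cong)
       (simp add: ennreal_mult[symmetric] phi_def bregman_def mult.assoc mult.left_commute exp_add[symmetric] algebra_simps)
  also have "\<dots> = ennreal (exp (bregman \<psi> \<alpha> (\<alpha> + t)))"
    using assms by (simp add: nn_integral_cmult nn_integral_phi)
  finally show ?thesis .
qed

text \<open>Lets the logarithm of the likelihood be split into a sum: \<open>ln\<close> of a product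
  is additive only when no factor vanishes.\<close>

lemma AE_expfam_b_pos: "AE x in expfam \<nu> b \<psi> \<alpha>. b x > 0"
  unfolding expfam_def by (subst AE_density) (auto simp: phi_def less_le)

end

section \<open>The variational objective as a function of the marginals\<close>

text \<open>The parameter-dependent part of the log density. The remaining part
  \<open>ln (b x)\<close> is the same for all parameters and labels and cancels in every
  comparison.\<close>

definition lin :: "(real \<Rightarrow> real) \<Rightarrow> real \<Rightarrow> real \<Rightarrow> real" where
  "lin \<psi> a y = a * y - \<psi> a"

text \<open>Separates a log-likelihood difference into noise centred at the true mean and two
  divergences from the true parameter \<open>a0\<close>.\<close>

lemma lin_diff:
  "lin \<psi> a1 y - lin \<psi> a y = (a1 - a) * (y - deriv \<psi> a0) + bregman \<psi> a0 a - bregman \<psi> a0 a1"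
  by (simp add: lin_def bregman_def algebra_simps)

lemma finite_assignments [simp]: "finite (assignments n :: (nat \<Rightarrow> 'k::finite) set)"
  unfolding assignments_def by (intro finite_PiE) auto

text \<open>Real-valued twin of \<open>asg\<close>, so that hard labels can stand where soft
  marginals are expected.\<close>

definition ind :: "(nat \<Rightarrow> 'k) \<Rightarrow> nat \<Rightarrow> 'k \<Rightarrow> real" where
  "ind z i k = of_bool (z i = k)"

lemma ind_nonneg [simp]: "0 \<le> ind z i k" and ind_le_1 [simp]: "ind z i k \<le> 1"
  by (auto simp: ind_def)

lemma ind_self [simp]: "ind z i (z i) = 1"
  by (simp add: ind_def)

lemma sum_ind_mult [simp]: "(\<Sum>k\<in>UNIV. ind z i k * f k) = f (z i :: 'k::finite)"
proof -
  have "(\<Sum>k\<in>UNIV. ind z i k * f k) = (\<Sum>k\<in>UNIV. if z i = k then f k else 0)"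
    by (intro sum.cong) (auto simp: ind_def)
  then show ?thesis by simp
qed

lemma sum_mult_ind [simp]: "(\<Sum>k\<in>UNIV. f k * ind z i k) = f (z i :: 'k::finite)"
  using sum_ind_mult[of z i f] by (simp add: mult.commute)

lemma sum_ind [simp]: "(\<Sum>k\<in>UNIV. ind z i (k :: 'k::finite)) = 1"
  using sum_ind_mult[of z i "\<lambda>_. 1"] by simp

definition simplex_rows :: "nat \<Rightarrow> (nat \<Rightarrow> 'k::finite \<Rightarrow> real) \<Rightarrow> bool" where
  "simplex_rows n \<tau> \<longleftrightarrow> (\<forall>i<n. (\<forall>k. 0 \<le> \<tau> i k) \<and> (\<Sum>k\<in>UNIV. \<tau> i k) = 1)"

lemma simplex_rowsD:
  assumes "simplex_rows n \<tau>" "i < n"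
  shows "0 \<le> \<tau> i k" "\<tau> i k \<le> 1" "(\<Sum>k\<in>UNIV. \<tau> i k) = 1"
  using assms member_le_sum[of k UNIV "\<tau> i"] by (auto simp: simplex_rows_def)

lemma simplex_rows_ind: "simplex_rows n (ind z)"
  by (simp add: simplex_rows_def)

text \<open>This is \<open>J\<close> without the constant \<open>ln (b x)\<close> terms. Where a
  marginal is 0, the value of \<open>ln 0\<close> is multiplied by 0, which is the usual convention
  for entropies.\<close>

definition variational_objective ::
  "(real \<Rightarrow> real) \<Rightarrow> nat \<Rightarrow> nat \<Rightarrow> (nat \<times> nat \<Rightarrow> real) \<Rightarrow> (nat \<Rightarrow> 'g::finite \<Rightarrow> real) \<Rightarrow> (nat \<Rightarrow> 'm::finite \<Rightarrow> real) \<Rightarrow>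
   ('g \<Rightarrow> real) \<Rightarrow> ('m \<Rightarrow> real) \<Rightarrow> ('g \<Rightarrow> 'm \<Rightarrow> real) \<Rightarrow> real" where
  "variational_objective \<psi> n d x \<tau> \<nu> \<pi> \<rho> \<alpha> =
     (\<Sum>i<n. \<Sum>k\<in>UNIV. \<tau> i k * (ln (\<pi> k) - ln (\<tau> i k))) +
     (\<Sum>j<d. \<Sum>l\<in>UNIV. \<nu> j l * (ln (\<rho> l) - ln (\<nu> j l))) +
     (\<Sum>i<n. \<Sum>j<d. \<Sum>k\<in>UNIV. \<Sum>l\<in>UNIV. \<tau> i k * \<nu> j l * lin \<psi> (\<alpha> k l) (x (i, j)))"

definition complete_loglik ::
  "(real \<Rightarrow> real) \<Rightarrow> nat \<Rightarrow> nat \<Rightarrow> (nat \<times> nat \<Rightarrow> real) \<Rightarrow> (nat \<Rightarrow> 'g::finite) \<Rightarrow> (nat \<Rightarrow> 'm::finite) \<Rightarrow>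
   ('g \<Rightarrow> real) \<Rightarrow> ('m \<Rightarrow> real) \<Rightarrow> ('g \<Rightarrow> 'm \<Rightarrow> real) \<Rightarrow> real" where
  "complete_loglik \<psi> n d x z w \<pi> \<rho> \<alpha> =
     (\<Sum>i<n. ln (\<pi> (z i))) + (\<Sum>j<d. ln (\<rho> (w j))) + (\<Sum>i<n. \<Sum>j<d. lin \<psi> (\<alpha> (z i) (w j)) (x (i, j)))"

text \<open>Gibbs' inequality: the maximum over \<open>\<tau>\<close> of the left-hand side is \<open>ln (\<Sum>k. p k * exp (a k))\<close>,
  and all but the \<open>k0\<close>-th term of this sum are negligible.\<close>

lemma gibbs_gap:
  fixes \<tau> p a :: "'k::finite \<Rightarrow> real"
  assumes tau: "\<And>k. 0 \<le> \<tau> k" "(\<Sum>k\<in>UNIV. \<tau> k) = 1"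
    and p: "\<And>k. c \<le> p k" "c > 0" "(\<Sum>k\<in>UNIV. p k) = 1"
    and gap: "\<And>k. k \<noteq> k0 \<Longrightarrow> a k \<le> a k0 - h"
  shows "(\<Sum>k\<in>UNIV. \<tau> k * (ln (p k) - ln (\<tau> k) + a k)) \<le> ln (p k0) + a k0 + exp (- h) / c"
proof -
  have p0: "p k > 0" for k using p(1)[of k] p(2) by simp
  define W where "W = (\<Sum>k\<in>UNIV. p k * exp (a k))"
  have W: "W > 0" unfolding W_def using p0 by (intro sum_pos) auto
  \<comment> \<open>This is \<open>ln s \<le> s - 1\<close> with
    \<open>s = p k * exp (a k) / (\<tau> k * W)\<close>. In the sum over \<open>k\<close> the last
    two terms cancel, as \<open>W\<close> normalises the first and \<open>\<tau>\<close> sums to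
    1.\<close>
  have "\<tau> k * (ln (p k) - ln (\<tau> k) + a k) \<le> \<tau> k * ln W + p k * exp (a k) / W - \<tau> k" for k
  proof (cases "\<tau> k = 0")
    case True
    then show ?thesis using p0[of k] W by simp
  next
    case False
    then have t: "\<tau> k > 0" using tau(1)[of k] by simp
    have "ln (p k) - ln (\<tau> k) + a k - ln W = ln (p k * exp (a k) / (\<tau> k * W))"
      using t p0[of k] W by (simp add: ln_div ln_mult)
    also have "\<dots> \<le> p k * exp (a k) / (\<tau> k * W) - 1"
      using t p0[of k] W by (intro ln_le_minus_one) simp
    finally have "\<tau> k * (ln (p k) - ln (\<tau> k) + a k - ln W) \<le> \<tau> k * (p k * exp (a k) / (\<tau> k * W) - 1)"
      using t by (intro mult_left_mono) auto
    then show ?thesis using t by (simp add: algebra_simps)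
  qed
  then have "(\<Sum>k\<in>UNIV. \<tau> k * (ln (p k) - ln (\<tau> k) + a k))
      \<le> (\<Sum>k\<in>UNIV. \<tau> k * ln W + p k * exp (a k) / W - \<tau> k)" by (rule sum_mono)
  also have "\<dots> = ln W"
    using W tau(2) by (simp add: sum.distrib sum_subtractf sum_distrib_right[symmetric] sum_divide_distrib[symmetric] W_def[symmetric])
  finally have le_W: "(\<Sum>k\<in>UNIV. \<tau> k * (ln (p k) - ln (\<tau> k) + a k)) \<le> ln W" .
  have "W \<le> p k0 * exp (a k0) * (1 + exp (- h) / p k0)"
  proof -
    have W_eq: "W = p k0 * exp (a k0) + (\<Sum>k\<in>UNIV - {k0}. p k * exp (a k))"
      unfolding W_def by (rule sum.remove) auto
    have "(\<Sum>k\<in>UNIV - {k0}. p k * exp (a k)) \<le> (\<Sum>k\<in>UNIV - {k0}. p k * exp (a k0 - h))"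
      using gap p0 by (intro sum_mono mult_left_mono) (auto simp: less_imp_le)
    also have "\<dots> = (\<Sum>k\<in>UNIV - {k0}. p k) * exp (a k0 - h)" by (simp add: sum_distrib_right)
    finally have "(\<Sum>k\<in>UNIV - {k0}. p k * exp (a k)) \<le> (\<Sum>k\<in>UNIV - {k0}. p k) * exp (a k0 - h)" .
    moreover have "(\<Sum>k\<in>UNIV - {k0}. p k) \<le> 1"
      using p(3) p0 sum_mono2[of UNIV "UNIV - {k0}" p] by (auto simp: less_imp_le)
    then have "(\<Sum>k\<in>UNIV - {k0}. p k) * exp (a k0 - h) \<le> 1 * exp (a k0 - h)"
      by (rule mult_right_mono) simp
    ultimately have "W \<le> p k0 * exp (a k0) + exp (a k0 - h)" using W_eq by linarith
    also have "\<dots> = p k0 * exp (a k0) * (1 + exp (- h) / p k0)"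
      using p0[of k0] by (simp add: exp_diff exp_minus field_simps)
    finally show ?thesis .
  qed
  then have "ln W \<le> ln (p k0 * exp (a k0) * (1 + exp (- h) / p k0))"
    using W by simp
  also have "\<dots> = ln (p k0) + a k0 + ln (1 + exp (- h) / p k0)"
    using p0[of k0] add_pos_pos[of 1 "exp (- h) / p k0"] by (simp add: ln_mult)
  also have "\<dots> \<le> ln (p k0) + a k0 + exp (- h) / p k0"
    using p0[of k0] by (intro add_left_mono ln_add_one_self_le_self) simp
  also have "\<dots> \<le> ln (p k0) + a k0 + exp (- h) / c"
    using p(1)[of k0] p(2) by (simp add: frac_le)
  finally show ?thesis using le_W by linarith
qed

text \<open>The sum is minus a Kullback-Leibler divergence.\<close>

lemma sum_entropy_le_0:
  fixes \<tau> p :: "'k::finite \<Rightarrow> real"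
  assumes "\<And>k. 0 \<le> \<tau> k" "(\<Sum>k\<in>UNIV. \<tau> k) = 1" "\<And>k. 0 < p k" "(\<Sum>k\<in>UNIV. p k) = 1"
  shows "(\<Sum>k\<in>UNIV. \<tau> k * (ln (p k) - ln (\<tau> k))) \<le> 0"
proof -
  have "\<tau> k * (ln (p k) - ln (\<tau> k)) \<le> p k - \<tau> k" for k
  proof (cases "\<tau> k = 0")
    case False
    then have t: "\<tau> k > 0" using assms(1)[of k] by simp
    have "\<tau> k * (ln (p k) - ln (\<tau> k)) = \<tau> k * ln (p k / \<tau> k)"
      using t assms(3)[of k] by (simp add: ln_div)
    also have "\<dots> \<le> \<tau> k * (p k / \<tau> k - 1)"
      using t assms(3)[of k] by (intro mult_left_mono ln_le_minus_one) auto
    finally show ?thesis using t by (simp add: algebra_simps)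
  qed (use assms(3)[of k] in simp)
  then have "(\<Sum>k\<in>UNIV. \<tau> k * (ln (p k) - ln (\<tau> k))) \<le> (\<Sum>k\<in>UNIV. p k - \<tau> k)" by (rule sum_mono)
  then show ?thesis using assms by (simp add: sum_subtractf)
qed

text \<open>The maximum over \<open>\<tau>\<close> for fixed \<open>\<nu>\<close> is computed row by row, then the maximum over \<open>\<nu>\<close> column by column.\<close>

lemma variational_objective_le:
  fixes \<tau> :: "nat \<Rightarrow> 'g::finite \<Rightarrow> real" and \<nu> :: "nat \<Rightarrow> 'm::finite \<Rightarrow> real"
  assumes tau: "simplex_rows n \<tau>" and nu: "simplex_rows d \<nu>"
    and p: "c > 0" "\<And>k. c \<le> \<pi> k" "(\<Sum>k\<in>UNIV. \<pi> k) = 1" "\<And>l. c \<le> \<rho> l" "(\<Sum>l\<in>UNIV. \<rho> l) = 1"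
    and row: "\<And>i k. i < n \<Longrightarrow> k \<noteq> z i \<Longrightarrow>
      (\<Sum>j<d. \<Sum>l\<in>UNIV. \<nu> j l * (lin \<psi> (\<alpha> k l) (x (i, j)) - lin \<psi> (\<alpha> (z i) l) (x (i, j)))) \<le> - h"
    and col: "\<And>j l. j < d \<Longrightarrow> l \<noteq> w j \<Longrightarrow>
      (\<Sum>i<n. lin \<psi> (\<alpha> (z i) l) (x (i, j)) - lin \<psi> (\<alpha> (z i) (w j)) (x (i, j))) \<le> - h'"
  shows "variational_objective \<psi> n d x \<tau> \<nu> \<pi> \<rho> \<alpha> \<le>
    complete_loglik \<psi> n d x z w \<pi> \<rho> \<alpha> + (real n * exp (- h) + real d * exp (- h')) / c"
proof -
  define a where "a i k = (\<Sum>j<d. \<Sum>l\<in>UNIV. \<nu> j l * lin \<psi> (\<alpha> k l) (x (i, j)))" for i k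
  define b where "b j l = (\<Sum>i<n. lin \<psi> (\<alpha> (z i) l) (x (i, j)))" for j l
  have s1: "variational_objective \<psi> n d x \<tau> \<nu> \<pi> \<rho> \<alpha> =
      (\<Sum>i<n. \<Sum>k\<in>UNIV. \<tau> i k * (ln (\<pi> k) - ln (\<tau> i k) + a i k)) + (\<Sum>j<d. \<Sum>l\<in>UNIV. \<nu> j l * (ln (\<rho> l) - ln (\<nu> j l)))"
  proof -
    have "(\<Sum>j<d. \<Sum>k\<in>UNIV. \<Sum>l\<in>UNIV. \<tau> i k * \<nu> j l * lin \<psi> (\<alpha> k l) (x (i, j))) = (\<Sum>k\<in>UNIV. \<tau> i k * a i k)" for i
      unfolding a_def by (subst sum.swap) (simp add: sum_distrib_left mult.assoc)
    then show ?thesis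
      by (simp add: variational_objective_def distrib_left sum.distrib)
  qed
  have s2: "(\<Sum>i<n. \<Sum>k\<in>UNIV. \<tau> i k * (ln (\<pi> k) - ln (\<tau> i k) + a i k))
      \<le> (\<Sum>i<n. ln (\<pi> (z i)) + a i (z i) + exp (- h) / c)"
  proof (rule sum_mono)
    fix i assume "i \<in> {..<n}"
    then have i: "i < n" by simp
    show "(\<Sum>k\<in>UNIV. \<tau> i k * (ln (\<pi> k) - ln (\<tau> i k) + a i k)) \<le> ln (\<pi> (z i)) + a i (z i) + exp (- h) / c"
    proof (rule gibbs_gap)
      show "a i k \<le> a i (z i) - h" if "k \<noteq> z i" for k
        using row[OF i that] unfolding a_def by (simp add: right_diff_distrib sum_subtractf)
    qed (use simplex_rowsD[OF tau i] p in auto)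
  qed
  \<comment> \<open>After the rows are set to \<open>z\<close>, what remains is linear in
    \<open>\<nu>\<close> with coefficients \<open>b j l\<close>, and Gibbs' inequality applies once
    more. So the hypothesis \<open>row\<close> concerns soft column weights, whereas
    \<open>col\<close> concerns hard row labels.\<close>
  have s3: "(\<Sum>i<n. ln (\<pi> (z i)) + a i (z i) + exp (- h) / c) =
      (\<Sum>i<n. ln (\<pi> (z i))) + (\<Sum>j<d. \<Sum>l\<in>UNIV. \<nu> j l * b j l) + real n * exp (- h) / c"
  proof -
    have "(\<Sum>i<n. a i (z i)) = (\<Sum>j<d. \<Sum>l\<in>UNIV. \<nu> j l * b j l)"
    proof -
      have "(\<Sum>i<n. a i (z i)) = (\<Sum>j<d. \<Sum>i<n. \<Sum>l\<in>UNIV. \<nu> j l * lin \<psi> (\<alpha> (z i) l) (x (i, j)))"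
        unfolding a_def by (rule sum.swap)
      also have "\<dots> = (\<Sum>j<d. \<Sum>l\<in>UNIV. \<nu> j l * b j l)"
        unfolding b_def by (subst sum.swap) (simp add: sum_distrib_left)
      finally show ?thesis .
    qed
    then show ?thesis by (simp add: sum.distrib)
  qed
  have s4: "(\<Sum>j<d. \<Sum>l\<in>UNIV. \<nu> j l * b j l) + (\<Sum>j<d. \<Sum>l\<in>UNIV. \<nu> j l * (ln (\<rho> l) - ln (\<nu> j l)))
      = (\<Sum>j<d. \<Sum>l\<in>UNIV. \<nu> j l * (ln (\<rho> l) - ln (\<nu> j l) + b j l))"
    by (simp add: distrib_left sum.distrib)
  have s5: "(\<Sum>j<d. \<Sum>l\<in>UNIV. \<nu> j l * (ln (\<rho> l) - ln (\<nu> j l) + b j l))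
      \<le> (\<Sum>j<d. ln (\<rho> (w j)) + b j (w j) + exp (- h') / c)"
  proof (rule sum_mono)
    fix j assume "j \<in> {..<d}"
    then have j: "j < d" by simp
    show "(\<Sum>l\<in>UNIV. \<nu> j l * (ln (\<rho> l) - ln (\<nu> j l) + b j l)) \<le> ln (\<rho> (w j)) + b j (w j) + exp (- h') / c"
    proof (rule gibbs_gap)
      show "b j l \<le> b j (w j) - h'" if "l \<noteq> w j" for l
        using col[OF j that] unfolding b_def by (simp add: sum_subtractf)
    qed (use simplex_rowsD[OF nu j] p in auto)
  qed
  have s6: "(\<Sum>j<d. ln (\<rho> (w j)) + b j (w j) + exp (- h') / c)
      = (\<Sum>j<d. ln (\<rho> (w j))) + (\<Sum>i<n. \<Sum>j<d. lin \<psi> (\<alpha> (z i) (w j)) (x (i, j))) + real d * exp (- h') / c"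
  proof -
    have "(\<Sum>j<d. b j (w j)) = (\<Sum>i<n. \<Sum>j<d. lin \<psi> (\<alpha> (z i) (w j)) (x (i, j)))"
      unfolding b_def by (rule sum.swap)
    then show ?thesis by (simp add: sum.distrib)
  qed
  show ?thesis
    using s1 s2 s3 s4 s5 s6 unfolding complete_loglik_def add_divide_distrib by linarith
qed

text \<open>By \<open>lin_diff\<close> the advantage of \<open>a1\<close> over \<open>a\<close>
  splits into noise (T1), the cost of \<open>a\<close> (T2, small since \<open>a\<close> is near
  \<open>a0\<close> and \<open>\<nu>\<close> near \<open>w\<close>) and the cost of
  \<open>a1\<close> (T3, large since \<open>a1\<close> is wrong on the class \<open>l0\<close>). It
  is used for a row with soft \<open>\<nu>\<close>, and for a column with the roles exchanged and
  hard weights.\<close>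

lemma row_gap:
  fixes \<nu> :: "nat \<Rightarrow> 'm::finite \<Rightarrow> real"
  assumes nu: "simplex_rows d \<nu>"
    and breg: "\<And>a a'. a \<in> {lo..hi} \<Longrightarrow> a' \<in> {lo..hi} \<Longrightarrow> \<kappa> * (a - a')\<^sup>2 \<le> bregman \<psi> a a' \<and> bregman \<psi> a a' \<le> K * (a - a')\<^sup>2"
    and \<kappa>: "\<kappa> > 0" and K: "K > 0" and I: "\<And>l. a0 l \<in> {lo..hi}" "\<And>l. a l \<in> {lo..hi}" "\<And>l. a1 l \<in> {lo..hi}"
    and e: "\<And>l. \<bar>a0 l - a l\<bar> \<le> e"
    and l0: "\<bar>a0 l0 - a1 l0\<bar> \<ge> \<Delta> / 2" "\<Delta> > 0"
    and freq: "(\<Sum>j<d. ind w j l0) \<ge> c0 * real d"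
    and near: "(\<Sum>j<d. 1 - \<nu> j (w j)) \<le> \<eta> * real d"
    and noise: "\<And>l. \<bar>\<Sum>j<d. \<nu> j l * (y j - deriv \<psi> (a0 (w j)))\<bar> \<le> \<epsilon> * real d"
    and D: "D = hi - lo"
  shows "(\<Sum>j<d. \<Sum>l\<in>UNIV. \<nu> j l * (lin \<psi> (a1 l) (y j) - lin \<psi> (a l) (y j)))
    \<le> - (\<kappa> * (\<Delta>\<^sup>2 / 4) * (c0 - \<eta>) - K * (e\<^sup>2 + \<eta> * D\<^sup>2) - real CARD('m) * D * \<epsilon>) * real d"
proof -
  note nuD = simplex_rowsD[OF nu]
  have D0: "D \<ge> 0" using I(1)[of undefined] D by auto
  have diffD: "\<bar>s - t\<bar> \<le> D" if "s \<in> {lo..hi}" "t \<in> {lo..hi}" for s t using that D by auto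
  have split: "(\<Sum>j<d. \<Sum>l\<in>UNIV. \<nu> j l * (lin \<psi> (a1 l) (y j) - lin \<psi> (a l) (y j)))
     = (\<Sum>j<d. \<Sum>l\<in>UNIV. (a1 l - a l) * (\<nu> j l * (y j - deriv \<psi> (a0 (w j)))))
     + (\<Sum>j<d. \<Sum>l\<in>UNIV. \<nu> j l * bregman \<psi> (a0 (w j)) (a l))
     - (\<Sum>j<d. \<Sum>l\<in>UNIV. \<nu> j l * bregman \<psi> (a0 (w j)) (a1 l))"
  proof -
    have "\<nu> j l * (lin \<psi> (a1 l) (y j) - lin \<psi> (a l) (y j)) = (a1 l - a l) * (\<nu> j l * (y j - deriv \<psi> (a0 (w j))))
        + \<nu> j l * bregman \<psi> (a0 (w j)) (a l) - \<nu> j l * bregman \<psi> (a0 (w j)) (a1 l)" for j l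
      unfolding lin_diff[of \<psi> "a1 l" "y j" "a l" "a0 (w j)"] by (simp add: algebra_simps)
    then show ?thesis
      by (simp only: sum.distrib sum_subtractf)
  qed
  have T1: "(\<Sum>j<d. \<Sum>l\<in>UNIV. (a1 l - a l) * (\<nu> j l * (y j - deriv \<psi> (a0 (w j))))) \<le> real CARD('m) * D * \<epsilon> * real d"
  proof -
    have "(\<Sum>j<d. \<Sum>l\<in>UNIV. (a1 l - a l) * (\<nu> j l * (y j - deriv \<psi> (a0 (w j)))))
       = (\<Sum>l\<in>UNIV. (a1 l - a l) * (\<Sum>j<d. \<nu> j l * (y j - deriv \<psi> (a0 (w j)))))"
      by (subst sum.swap) (simp add: sum_distrib_left)
    also have "\<dots> \<le> (\<Sum>l\<in>(UNIV :: 'm set). D * (\<epsilon> * real d))"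
    proof (rule sum_mono)
      fix l
      have "(a1 l - a l) * (\<Sum>j<d. \<nu> j l * (y j - deriv \<psi> (a0 (w j)))) \<le> \<bar>a1 l - a l\<bar> * \<bar>\<Sum>j<d. \<nu> j l * (y j - deriv \<psi> (a0 (w j)))\<bar>"
        unfolding abs_mult[symmetric] by simp
      also have "\<dots> \<le> D * (\<epsilon> * real d)"
        using diffD I noise D0 by (intro mult_mono) auto
      finally show "(a1 l - a l) * (\<Sum>j<d. \<nu> j l * (y j - deriv \<psi> (a0 (w j)))) \<le> D * (\<epsilon> * real d)" .
    qed
    finally show ?thesis by (simp add: mult.assoc)
  qed
  \<comment> \<open>Correctly placed mass pays at most \<open>K * e^2\<close>; the misplaced mass
    \<open>1 - \<nu> j (w j)\<close> pays at most \<open>K * D^2\<close>.\<close>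
  have T2: "(\<Sum>j<d. \<Sum>l\<in>UNIV. \<nu> j l * bregman \<psi> (a0 (w j)) (a l)) \<le> K * (e\<^sup>2 + \<eta> * D\<^sup>2) * real d"
  proof -
    have "(\<Sum>j<d. \<Sum>l\<in>UNIV. \<nu> j l * bregman \<psi> (a0 (w j)) (a l)) \<le> (\<Sum>j<d. K * e\<^sup>2 + K * D\<^sup>2 * (1 - \<nu> j (w j)))"
    proof (rule sum_mono)
      fix j assume "j \<in> {..<d}"
      then have j: "j < d" by simp
      have sq: "(a0 (w j) - a l)\<^sup>2 \<le> (if l = w j then e\<^sup>2 else D\<^sup>2)" for l
      proof (cases "l = w j")
        case True
        have "\<bar>a0 (w j) - a (w j)\<bar>\<^sup>2 \<le> e\<^sup>2" by (intro power_mono e) simp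
        with True show ?thesis by simp
      next
        case False
        have "\<bar>a0 (w j) - a l\<bar>\<^sup>2 \<le> D\<^sup>2" by (intro power_mono diffD I) simp
        with False show ?thesis by simp
      qed
      have "(\<Sum>l\<in>UNIV. \<nu> j l * bregman \<psi> (a0 (w j)) (a l)) \<le> (\<Sum>l\<in>UNIV. \<nu> j l * (K * (if l = w j then e\<^sup>2 else D\<^sup>2)))"
        using breg[OF I(1) I(2)] sq K nuD(1)[OF j]
        by (intro sum_mono mult_left_mono) (meson order_trans mult_left_mono less_imp_le)+
      also have "\<dots> = \<nu> j (w j) * (K * e\<^sup>2) + (\<Sum>l\<in>UNIV - {w j}. \<nu> j l * (K * D\<^sup>2))"
        by (subst sum.remove[of UNIV "w j"]) auto
      also have "\<dots> = \<nu> j (w j) * (K * e\<^sup>2) + (1 - \<nu> j (w j)) * (K * D\<^sup>2)"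
        using nuD(3)[OF j] by (simp add: sum_distrib_right[symmetric] sum.remove[of UNIV "w j"])
      finally have "(\<Sum>l\<in>UNIV. \<nu> j l * bregman \<psi> (a0 (w j)) (a l)) \<le> \<nu> j (w j) * (K * e\<^sup>2) + (1 - \<nu> j (w j)) * (K * D\<^sup>2)" .
      moreover have "\<nu> j (w j) * (K * e\<^sup>2) \<le> 1 * (K * e\<^sup>2)"
        using nuD(2)[OF j] K by (intro mult_right_mono) auto
      ultimately show "(\<Sum>l\<in>UNIV. \<nu> j l * bregman \<psi> (a0 (w j)) (a l)) \<le> K * e\<^sup>2 + K * D\<^sup>2 * (1 - \<nu> j (w j))"
        by (simp add: mult_ac)
    qed
    also have "\<dots> = K * e\<^sup>2 * real d + K * D\<^sup>2 * (\<Sum>j<d. 1 - \<nu> j (w j))"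
      by (simp add: sum.distrib sum_distrib_left)
    also have "\<dots> \<le> K * e\<^sup>2 * real d + K * D\<^sup>2 * (\<eta> * real d)"
      using near K by (intro add_left_mono mult_left_mono) auto
    finally show ?thesis by (simp add: algebra_simps)
  qed
  \<comment> \<open>Only columns of the true class \<open>l0\<close> are counted, and of these only
    the mass placed on \<open>l0\<close>, in total at least \<open>(c0 - \<eta>) * d\<close>.
    Everything else is dropped, divergences being nonnegative.\<close>
  have T3: "(\<Sum>j<d. \<Sum>l\<in>UNIV. \<nu> j l * bregman \<psi> (a0 (w j)) (a1 l)) \<ge> \<kappa> * (\<Delta>\<^sup>2 / 4) * (c0 - \<eta>) * real d"
  proof -
    have sq: "(\<Delta> / 2)\<^sup>2 \<le> (a0 l0 - a1 l0)\<^sup>2"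
      using l0 power_mono[of "\<Delta> / 2" "\<bar>a0 l0 - a1 l0\<bar>" 2] by simp
    have "\<kappa> * (\<Delta>\<^sup>2 / 4) * (c0 - \<eta>) * real d \<le> \<kappa> * (\<Delta>\<^sup>2 / 4) * ((\<Sum>j<d. ind w j l0) - (\<Sum>j<d. 1 - \<nu> j (w j)))"
      using freq near \<kappa> by (subst mult.assoc, intro mult_left_mono) (auto simp: algebra_simps)
    also have "\<dots> = (\<Sum>j<d. \<kappa> * (\<Delta> / 2)\<^sup>2 * (ind w j l0 - (1 - \<nu> j (w j))))"
      unfolding sum_subtractf[symmetric] sum_distrib_left by (simp add: power_divide)
    also have "\<dots> \<le> (\<Sum>j<d. \<Sum>l\<in>UNIV. \<nu> j l * bregman \<psi> (a0 (w j)) (a1 l))"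
    proof (rule sum_mono)
      fix j assume "j \<in> {..<d}"
      then have j: "j < d" by simp
      have bn: "0 \<le> bregman \<psi> (a0 (w j)) (a1 l)" for l
        using breg[OF I(1) I(3), of "w j" l] \<kappa> by (meson mult_nonneg_nonneg less_imp_le zero_le_power2 order_trans)
      have n0: "0 \<le> (\<Sum>l\<in>UNIV. \<nu> j l * bregman \<psi> (a0 (w j)) (a1 l))"
        using nuD(1)[OF j] bn by (intro sum_nonneg) auto
      show "\<kappa> * (\<Delta> / 2)\<^sup>2 * (ind w j l0 - (1 - \<nu> j (w j))) \<le> (\<Sum>l\<in>UNIV. \<nu> j l * bregman \<psi> (a0 (w j)) (a1 l))"
      proof (cases "w j = l0")
        case True
        have "\<kappa> * (\<Delta> / 2)\<^sup>2 \<le> \<kappa> * (a0 l0 - a1 l0)\<^sup>2" using sq \<kappa> by simp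
        also have "\<dots> \<le> bregman \<psi> (a0 l0) (a1 l0)" using breg[OF I(1) I(3)] by blast
        finally have "\<kappa> * (\<Delta> / 2)\<^sup>2 * \<nu> j l0 \<le> bregman \<psi> (a0 l0) (a1 l0) * \<nu> j l0"
          using nuD(1)[OF j] by (intro mult_right_mono)
        also have "\<dots> \<le> (\<Sum>l\<in>UNIV. \<nu> j l * bregman \<psi> (a0 (w j)) (a1 l))"
          using member_le_sum[of l0 UNIV "\<lambda>l. \<nu> j l * bregman \<psi> (a0 (w j)) (a1 l)"] nuD(1)[OF j] bn True by (simp add: mult.commute)
        finally show ?thesis using True by (simp add: ind_def)
      next
        case False
        have "\<kappa> * (\<Delta> / 2)\<^sup>2 * (ind w j l0 - (1 - \<nu> j (w j))) \<le> 0"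
          using False nuD(2)[OF j] \<kappa> by (intro mult_nonneg_nonpos) (auto simp: ind_def)
        then show ?thesis using n0 by simp
      qed
    qed
    finally show ?thesis .
  qed
  show ?thesis
    using T1 T2 T3 unfolding split by (simp add: left_diff_distrib)
qed

section \<open>Rearrangement of sums by true classes\<close>

lemma sum4_swap2:
  fixes f :: "_ \<Rightarrow> _ \<Rightarrow> _ \<Rightarrow> _ \<Rightarrow> 'x::comm_monoid_add"
  shows "(\<Sum>a\<in>A. \<Sum>b\<in>B. \<Sum>i\<in>I. \<Sum>j\<in>I'. f a b i j) = (\<Sum>i\<in>I. \<Sum>j\<in>I'. \<Sum>a\<in>A. \<Sum>b\<in>B. f a b i j)"
proof -
  have "(\<Sum>a\<in>A. \<Sum>b\<in>B. \<Sum>i\<in>I. \<Sum>j\<in>I'. f a b i j) = (\<Sum>a\<in>A. \<Sum>i\<in>I. \<Sum>b\<in>B. \<Sum>j\<in>I'. f a b i j)"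
    by (intro sum.cong refl sum.swap)
  also have "\<dots> = (\<Sum>i\<in>I. \<Sum>a\<in>A. \<Sum>b\<in>B. \<Sum>j\<in>I'. f a b i j)"
    by (rule sum.swap)
  also have "\<dots> = (\<Sum>i\<in>I. \<Sum>a\<in>A. \<Sum>j\<in>I'. \<Sum>b\<in>B. f a b i j)"
    by (intro sum.cong refl sum.swap)
  also have "\<dots> = (\<Sum>i\<in>I. \<Sum>j\<in>I'. \<Sum>a\<in>A. \<Sum>b\<in>B. f a b i j)"
    by (intro sum.cong refl sum.swap)
  finally show ?thesis .
qed

text \<open>Inserting the indicators of the true classes moves coefficients that depend on
  \<open>(z i, w j)\<close> out of the sums over cells. What stays inside is a bilinear form with
  weights in [0,1], to which the uniform noise bound applies; with \<open>y = 1\<close> it is a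
  product of confusion counts.\<close>

lemma sum_class_expand:
  fixes z :: "nat \<Rightarrow> 'g::finite" and w :: "nat \<Rightarrow> 'm::finite"
  shows "(\<Sum>i<n. \<Sum>j<d. \<Sum>k\<in>UNIV. \<Sum>l\<in>UNIV. \<tau> i k * \<nu> j l * (F (z i) (w j) k l * y i j)) =
    (\<Sum>k'\<in>UNIV. \<Sum>l'\<in>UNIV. \<Sum>k\<in>UNIV. \<Sum>l\<in>UNIV. F k' l' k l *
      (\<Sum>i<n. \<Sum>j<d. (ind z i k' * \<tau> i (k :: 'a::finite)) * (ind w j l' * \<nu> j (l :: 'b::finite)) * (y i j :: real)))"
proof -
  let ?G = "\<lambda>i j k l k' l'. F k' l' k l * ((ind z i k' * \<tau> i k) * (ind w j l' * \<nu> j l) * y i j)"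
  have *: "(\<Sum>k'\<in>UNIV. \<Sum>l'\<in>UNIV. ?G i j k l k' l') = \<tau> i k * \<nu> j l * (F (z i) (w j) k l * y i j)" for i j k l
  proof -
    have "(\<Sum>k'\<in>UNIV. \<Sum>l'\<in>UNIV. ?G i j k l k' l')
      = (\<Sum>k'\<in>UNIV. ind z i k' * (\<Sum>l'\<in>UNIV. ind w j l' * (\<tau> i k * \<nu> j l * (F k' l' k l * y i j))))"
      unfolding sum_distrib_left by (intro sum.cong refl) (simp add: mult_ac)
    then show ?thesis by simp
  qed
  have "(\<Sum>k'\<in>UNIV. \<Sum>l'\<in>UNIV. \<Sum>k\<in>UNIV. \<Sum>l\<in>UNIV. F k' l' k l *
      (\<Sum>i<n. \<Sum>j<d. (ind z i k' * \<tau> i k) * (ind w j l' * \<nu> j l) * y i j))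
    = (\<Sum>k'\<in>UNIV. \<Sum>l'\<in>UNIV. \<Sum>k\<in>UNIV. \<Sum>l\<in>UNIV. \<Sum>i<n. \<Sum>j<d. ?G i j k l k' l')"
    by (simp add: sum_distrib_left)
  also have "\<dots> = (\<Sum>k'\<in>UNIV. \<Sum>l'\<in>UNIV. \<Sum>i<n. \<Sum>j<d. \<Sum>k\<in>UNIV. \<Sum>l\<in>UNIV. ?G i j k l k' l')"
    by (intro sum.cong refl sum4_swap2)
  also have "\<dots> = (\<Sum>i<n. \<Sum>j<d. \<Sum>k'\<in>UNIV. \<Sum>l'\<in>UNIV. \<Sum>k\<in>UNIV. \<Sum>l\<in>UNIV. ?G i j k l k' l')"
    by (rule sum4_swap2)
  also have "\<dots> = (\<Sum>i<n. \<Sum>j<d. \<Sum>k\<in>UNIV. \<Sum>l\<in>UNIV. \<Sum>k'\<in>UNIV. \<Sum>l'\<in>UNIV. ?G i j k l k' l')"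
    by (intro sum.cong refl sum4_swap2)
  finally show ?thesis by (simp only: *)
qed

lemma sum_class_expand2:
  fixes z :: "nat \<Rightarrow> 'g::finite" and w :: "nat \<Rightarrow> 'm::finite" and G :: "'g \<Rightarrow> 'm \<Rightarrow> real"
  shows "(\<Sum>i<n. \<Sum>j<d. G (z i) (w j) * y i j) =
    (\<Sum>k\<in>UNIV. \<Sum>l\<in>UNIV. G k l * (\<Sum>i<n. \<Sum>j<d. ind z i k * ind w j l * y i j))"
proof -
  have *: "(\<Sum>k\<in>UNIV. \<Sum>l\<in>UNIV. G k l * (ind z i k * ind w j l * y i j)) = G (z i) (w j) * y i j" for i j
  proof -
    have "(\<Sum>k\<in>UNIV. \<Sum>l\<in>UNIV. G k l * (ind z i k * ind w j l * y i j))
      = (\<Sum>k\<in>UNIV. ind z i k * (\<Sum>l\<in>UNIV. ind w j l * (G k l * y i j)))"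
      unfolding sum_distrib_left by (intro sum.cong refl) (simp add: mult_ac)
    then show ?thesis by simp
  qed
  have "(\<Sum>k\<in>UNIV. \<Sum>l\<in>UNIV. G k l * (\<Sum>i<n. \<Sum>j<d. ind z i k * ind w j l * y i j))
    = (\<Sum>k\<in>UNIV. \<Sum>l\<in>UNIV. \<Sum>i<n. \<Sum>j<d. G k l * (ind z i k * ind w j l * y i j))"
    by (simp add: sum_distrib_left)
  also have "\<dots> = (\<Sum>i<n. \<Sum>j<d. \<Sum>k\<in>UNIV. \<Sum>l\<in>UNIV. G k l * (ind z i k * ind w j l * y i j))"
    by (rule sum4_swap2)
  finally show ?thesis by (simp only: *)
qed

lemma sum_ind_expand:
  fixes z :: "nat \<Rightarrow> 'g::finite" and f :: "'g \<Rightarrow> real"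
  shows "(\<Sum>i<n. f (z i)) = (\<Sum>k\<in>UNIV. (\<Sum>i<n. ind z i k) * f k)"
proof -
  have "(\<Sum>k\<in>UNIV. (\<Sum>i<n. ind z i k) * f k) = (\<Sum>i<n. \<Sum>k\<in>UNIV. ind z i k * f k)"
    unfolding sum_distrib_right by (rule sum.swap)
  then show ?thesis by simp
qed

text \<open>Averaging the cost of matching class \<open>k'\<close> to \<open>k\<close> and \<open>l'\<close> to \<open>l\<close> over the confusion matrices
  \<open>P\<close> and \<open>R\<close>: since the classes are separated, a small average forces both matchings to be permutations.\<close>

lemma near_permutation:
  fixes P :: "'g::finite \<Rightarrow> 'g \<Rightarrow> real" and R :: "'m::finite \<Rightarrow> 'm \<Rightarrow> real" and a0 a :: "'g \<Rightarrow> 'm \<Rightarrow> real"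
  assumes P: "\<And>k' k. 0 \<le> P k' k" "\<And>k'. c0 \<le> (\<Sum>k\<in>UNIV. P k' k)"
    and R: "\<And>l' l. 0 \<le> R l' l" "\<And>l'. c0 \<le> (\<Sum>l\<in>UNIV. R l' l)"
    and c0: "c0 > 0" and \<Delta>: "\<Delta> > 0"
    and rows: "\<And>k k'. k \<noteq> k' \<Longrightarrow> \<exists>l. \<Delta> \<le> \<bar>a0 k l - a0 k' l\<bar>"
    and cols: "\<And>l l'. l \<noteq> l' \<Longrightarrow> \<exists>k. \<Delta> \<le> \<bar>a0 k l - a0 k l'\<bar>"
    and S: "(\<Sum>k'\<in>UNIV. \<Sum>l'\<in>UNIV. \<Sum>k\<in>UNIV. \<Sum>l\<in>UNIV. P k' k * R l' l * (a0 k' l' - a k l)\<^sup>2) \<le> \<delta>"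
    and e: "0 < e" "e \<le> \<Delta> / 4"
    and \<delta>: "\<delta> \<le> (c0 / real CARD('g)) * (c0 / real CARD('m)) * e\<^sup>2" "4 * \<delta> \<le> (c0 / real CARD('g)) * \<Delta>\<^sup>2 * e"
  obtains s t where "s permutes UNIV" "t permutes UNIV"
    "\<And>k l. \<bar>a0 k l - a (s k) (t l)\<bar> \<le> e" "\<And>l' l. l \<noteq> t l' \<Longrightarrow> R l' l \<le> e"
proof -
  define p where "p = c0 / real CARD('g)"
  define r where "r = c0 / real CARD('m)"
  have p: "p > 0" and r: "r > 0" using c0 by (auto simp: p_def r_def)
  have nn: "0 \<le> P k' k * R l' l * (a0 k' l' - a k l)\<^sup>2" for k' k l' l
    using P(1) R(1) by simp
  have term_le: "P k' k * R l' l * (a0 k' l' - a k l)\<^sup>2 \<le> \<delta>" for k' k l' l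
  proof -
    let ?f = "\<lambda>k' l' k l. P k' k * R l' l * (a0 k' l' - a k l)\<^sup>2"
    have "?f k' l' k l \<le> (\<Sum>l\<in>UNIV. ?f k' l' k l)"
      using nn by (intro member_le_sum) auto
    also have "\<dots> \<le> (\<Sum>k\<in>UNIV. \<Sum>l\<in>UNIV. ?f k' l' k l)"
      by (rule member_le_sum[of k UNIV "\<lambda>k. \<Sum>l\<in>UNIV. ?f k' l' k l"]) (auto intro!: sum_nonneg nn)
    also have "\<dots> \<le> (\<Sum>l'\<in>UNIV. \<Sum>k\<in>UNIV. \<Sum>l\<in>UNIV. ?f k' l' k l)"
      by (rule member_le_sum[of l' UNIV "\<lambda>l'. \<Sum>k\<in>UNIV. \<Sum>l\<in>UNIV. ?f k' l' k l"]) (auto intro!: sum_nonneg nn)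
    also have "\<dots> \<le> (\<Sum>k'\<in>UNIV. \<Sum>l'\<in>UNIV. \<Sum>k\<in>UNIV. \<Sum>l\<in>UNIV. ?f k' l' k l)"
      by (rule member_le_sum[of k' UNIV "\<lambda>k'. \<Sum>l'\<in>UNIV. \<Sum>k\<in>UNIV. \<Sum>l\<in>UNIV. ?f k' l' k l"]) (auto intro!: sum_nonneg nn)
    finally show ?thesis using S by linarith
  qed
  \<comment> \<open>Pigeonhole: mass at least \<open>c0\<close> spread over \<open>CARD('g)\<close>
    labels leaves some label with at least the average.\<close>
  have "\<exists>k. p \<le> P k' k" for k'
  proof (rule ccontr)
    assume "\<not> ?thesis"
    then have "(\<Sum>k\<in>UNIV. P k' k) < (\<Sum>k\<in>(UNIV :: 'g set). p)"
      by (intro sum_strict_mono) (auto simp: not_le)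
    then show False using P(2)[of k'] by (simp add: p_def)
  qed
  then obtain s where s: "\<And>k'. p \<le> P k' (s k')" by metis
  have "\<exists>l. r \<le> R l' l" for l'
  proof (rule ccontr)
    assume "\<not> ?thesis"
    then have "(\<Sum>l\<in>UNIV. R l' l) < (\<Sum>l\<in>(UNIV :: 'm set). r)"
      by (intro sum_strict_mono) (auto simp: not_le)
    then show False using R(2)[of l'] by (simp add: r_def)
  qed
  then obtain t where t: "\<And>l'. r \<le> R l' (t l')" by metis
  \<comment> \<open>For matched classes both confusion weights are bounded below, so the single term
    of the sum already bounds the squared distance.\<close>
  have close: "\<bar>a0 k l - a (s k) (t l)\<bar> \<le> e" for k l
  proof -
    have "p * r * (a0 k l - a (s k) (t l))\<^sup>2 \<le> P k (s k) * R l (t l) * (a0 k l - a (s k) (t l))\<^sup>2"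
      using s t p r P R by (intro mult_right_mono mult_mono) auto
    also have "\<dots> \<le> p * r * e\<^sup>2" using term_le[of k "s k" l "t l"] \<delta>(1) by (simp add: p_def r_def)
    finally have "(a0 k l - a (s k) (t l))\<^sup>2 \<le> e\<^sup>2" using p r by simp
    then show ?thesis using e by (simp add: abs_le_square_iff[symmetric])
  qed
  \<comment> \<open>Two classes matched to the same label would be within \<open>2 * e\<close> of
    each other everywhere, which is less than \<open>\<Delta>\<close>.\<close>
  have "inj s"
  proof (rule injI, rule ccontr)
    fix k k' assume "s k = s k'" "k \<noteq> k'"
    obtain l where "\<Delta> \<le> \<bar>a0 k l - a0 k' l\<bar>" using rows[OF \<open>k \<noteq> k'\<close>] by blast
    then show False using close[of k l] close[of k' l] \<open>s k = s k'\<close> e \<Delta> by auto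
  qed
  have "inj t"
  proof (rule injI, rule ccontr)
    fix l l' assume "t l = t l'" "l \<noteq> l'"
    obtain k where "\<Delta> \<le> \<bar>a0 k l - a0 k l'\<bar>" using cols[OF \<open>l \<noteq> l'\<close>] by blast
    then show False using close[of k l] close[of k l'] \<open>t l = t l'\<close> e \<Delta> by auto
  qed
  have st: "bij s" "bij t"
    using \<open>inj s\<close> \<open>inj t\<close> by (auto simp: bij_def finite_UNIV_inj_surj)
  show thesis
  proof (rule that[of s t])
    show "s permutes UNIV" "t permutes UNIV"
      using st by (auto intro: bij_imp_permutes)
    show "\<bar>a0 k l - a (s k) (t l)\<bar> \<le> e" for k l by (rule close)
    \<comment> \<open>The label \<open>l\<close> belongs to another class \<open>l''\<close>. In a
      row \<open>k\<close> separating \<open>l'\<close> from \<open>l''\<close>, mass of class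
      \<open>l'\<close> sitting on \<open>l\<close> pays at least \<open>(\<Delta> / 2)^2\<close>,
      with row weight \<open>P k (s k)\<close> at least \<open>p\<close>.\<close>
    show "R l' l \<le> e" if "l \<noteq> t l'" for l' l
    proof -
      obtain l'' where l'': "l = t l''" using st(2) by (meson bij_pointE)
      then have "l' \<noteq> l''" using that by auto
      then obtain k where k: "\<Delta> \<le> \<bar>a0 k l' - a0 k l''\<bar>" using cols by blast
      have "\<Delta> / 2 \<le> \<bar>a0 k l' - a (s k) l\<bar>"
        using k close[of k l''] e \<Delta> unfolding l'' by linarith
      then have "(\<Delta> / 2)\<^sup>2 \<le> \<bar>a0 k l' - a (s k) l\<bar>\<^sup>2"
        using \<Delta> by (intro power_mono) auto
      then have "p * R l' l * (\<Delta> / 2)\<^sup>2 \<le> P k (s k) * R l' l * (a0 k l' - a (s k) l)\<^sup>2"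
        using s[of k] p P R by (intro mult_mono) auto
      also have "\<dots> \<le> \<delta>" by (rule term_le)
      also have "\<dots> \<le> p * e * (\<Delta> / 2)\<^sup>2" using \<delta>(2) by (simp add: p_def power_divide field_simps)
      finally show ?thesis using p \<Delta> by simp
    qed
  qed
qed

lemma variational_objective_permute:
  assumes "s permutes UNIV" "t permutes UNIV"
  shows "variational_objective \<psi> n d x \<tau> \<nu> \<pi> \<rho> \<alpha> =
    variational_objective \<psi> n d x (\<lambda>i k. \<tau> i (s k)) (\<lambda>j l. \<nu> j (t l)) (\<lambda>k. \<pi> (s k)) (\<lambda>l. \<rho> (t l)) (\<lambda>k l. \<alpha> (s k) (t l))"
proof -
  have s: "(\<Sum>k\<in>UNIV. f (s k)) = (\<Sum>k\<in>UNIV. f k)" for f :: "_ \<Rightarrow> real"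
    using sum.permute[OF assms(1), of f] by (simp add: o_def)
  have t: "(\<Sum>l\<in>UNIV. f (t l)) = (\<Sum>l\<in>UNIV. f l)" for f :: "_ \<Rightarrow> real"
    using sum.permute[OF assms(2), of f] by (simp add: o_def)
  show ?thesis
    unfolding variational_objective_def
    by (simp add: s[of "\<lambda>k. \<tau> _ k * (ln (\<pi> k) - ln (\<tau> _ k))"] t[of "\<lambda>l. \<nu> _ l * (ln (\<rho> l) - ln (\<nu> _ l))"]
        t[of "\<lambda>l. \<tau> _ _ * \<nu> _ l * lin \<psi> (\<alpha> _ l) _"] s[of "\<lambda>k. \<Sum>l\<in>UNIV. \<tau> _ k * \<nu> _ l * lin \<psi> (\<alpha> k l) _"])
qed

lemma complete_loglik_ge:
  assumes "c > 0" "\<And>k. c \<le> \<pi> k" "\<And>l. c \<le> \<rho> l"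
  shows "complete_loglik \<psi> n d x z w \<pi> \<rho> \<alpha> \<ge> (real n + real d) * ln c + (\<Sum>i<n. \<Sum>j<d. lin \<psi> (\<alpha> (z i) (w j)) (x (i, j)))"
proof -
  have "ln c \<le> ln (\<pi> k)" for k using assms(1) assms(2)[of k] by simp
  then have "(\<Sum>i<n. ln c) \<le> (\<Sum>i<n. ln (\<pi> (z i)))" by (intro sum_mono) auto
  moreover have "ln c \<le> ln (\<rho> l)" for l using assms(1) assms(3)[of l] by simp
  then have "(\<Sum>j<d. ln c) \<le> (\<Sum>j<d. ln (\<rho> (w j)))" by (intro sum_mono) auto
  ultimately show ?thesis by (simp add: complete_loglik_def algebra_simps)
qed

section \<open>Localisation of competitive marginals and parameters\<close>

text \<open>Entropies with prior terms are nonpositive on the left and at least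
  \<open>(n + d) * ln c\<close> on the right, so competitiveness compares the bilinear parts up to
  order \<open>n + d\<close>. Their difference is noise plus divergences, and the divergences
  dominate \<open>\<kappa>\<close> times the confusion-weighted squared distances.\<close>

lemma coarse_sum:
  fixes z :: "nat \<Rightarrow> 'g::finite" and w :: "nat \<Rightarrow> 'm::finite" and \<tau> :: "nat \<Rightarrow> 'g::finite \<Rightarrow> real" and \<nu> :: "nat \<Rightarrow> 'm::finite \<Rightarrow> real"
  assumes tau: "simplex_rows n \<tau>" and nu: "simplex_rows d \<nu>"
    and c: "c > 0" and p: "\<And>k. c \<le> \<pi> k" "(\<Sum>k\<in>UNIV. \<pi> k) = 1" "\<And>l. c \<le> \<rho> l" "(\<Sum>l\<in>UNIV. \<rho> l) = 1"
    and p0: "\<And>k. c \<le> \<pi>0 k" "\<And>l. c \<le> \<rho>0 l"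
    and breg: "\<And>a a'. a \<in> {lo..hi} \<Longrightarrow> a' \<in> {lo..hi} \<Longrightarrow> \<kappa> * (a - a')\<^sup>2 \<le> bregman \<psi> a a'"
    and I: "\<And>k l. \<alpha> k l \<in> {lo..hi}" "\<And>k l. \<alpha>0 k l \<in> {lo..hi}"
    and noise: "\<And>u v. (\<And>i. i < n \<Longrightarrow> 0 \<le> u i \<and> u i \<le> 1) \<Longrightarrow> (\<And>j. j < d \<Longrightarrow> 0 \<le> v j \<and> v j \<le> 1) \<Longrightarrow>
      \<bar>\<Sum>i<n. \<Sum>j<d. u i * v j * (x (i, j) - deriv \<psi> (\<alpha>0 (z i) (w j)))\<bar> \<le> \<epsilon> * (real n * real d)"
    and competitive: "variational_objective \<psi> n d x \<tau> \<nu> \<pi> \<rho> \<alpha> \<ge> complete_loglik \<psi> n d x z w \<pi>0 \<rho>0 \<alpha>0 - 1"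
  shows "\<kappa> * (\<Sum>k'\<in>UNIV. \<Sum>l'\<in>UNIV. \<Sum>k\<in>UNIV. \<Sum>l\<in>UNIV.
      (\<Sum>i<n. ind z i k' * \<tau> i k) * (\<Sum>j<d. ind w j l' * \<nu> j l) * (\<alpha>0 k' l' - \<alpha> k l)\<^sup>2)
    \<le> 1 - (real n + real d) * ln c + (real (CARD('g) * CARD('m)))\<^sup>2 * (hi - lo) * \<epsilon> * (real n * real d)"
proof -
  define \<xi> where "\<xi> i j = x (i, j) - deriv \<psi> (\<alpha>0 (z i) (w j))" for i j
  let ?lin0 = "\<lambda>i j. lin \<psi> (\<alpha>0 (z i) (w j)) (x (i, j))"
  have "(\<Sum>i<n. \<Sum>k\<in>UNIV. \<tau> i k * (ln (\<pi> k) - ln (\<tau> i k))) \<le> 0"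
    using c p by (intro sum_nonpos sum_entropy_le_0 simplex_rowsD[OF tau]) (auto intro: less_le_trans)
  moreover have "(\<Sum>j<d. \<Sum>l\<in>UNIV. \<nu> j l * (ln (\<rho> l) - ln (\<nu> j l))) \<le> 0"
    using c p by (intro sum_nonpos sum_entropy_le_0 simplex_rowsD[OF nu]) (auto intro: less_le_trans)
  moreover have "complete_loglik \<psi> n d x z w \<pi>0 \<rho>0 \<alpha>0 \<ge> (real n + real d) * ln c + (\<Sum>i<n. \<Sum>j<d. ?lin0 i j)"
    by (rule complete_loglik_ge[OF c]) (rule p0)+
  moreover note competitive
  ultimately have 1: "(\<Sum>i<n. \<Sum>j<d. ?lin0 i j)
      - (\<Sum>i<n. \<Sum>j<d. \<Sum>k\<in>UNIV. \<Sum>l\<in>UNIV. \<tau> i k * \<nu> j l * lin \<psi> (\<alpha> k l) (x (i, j))) \<le> 1 - (real n + real d) * ln c"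
    unfolding variational_objective_def by linarith
  have wt: "(\<Sum>k\<in>UNIV. \<Sum>l\<in>UNIV. \<tau> i k * \<nu> j l * q) = q" if "i < n" "j < d" for i j q
    using simplex_rowsD(3)[OF tau \<open>i < n\<close>] simplex_rowsD(3)[OF nu \<open>j < d\<close>]
    by (simp add: sum_distrib_left[symmetric] sum_distrib_right[symmetric])
  have "(\<Sum>i<n. \<Sum>j<d. ?lin0 i j)
      - (\<Sum>i<n. \<Sum>j<d. \<Sum>k\<in>UNIV. \<Sum>l\<in>UNIV. \<tau> i k * \<nu> j l * lin \<psi> (\<alpha> k l) (x (i, j)))
    = (\<Sum>i<n. \<Sum>j<d. \<Sum>k\<in>UNIV. \<Sum>l\<in>UNIV. \<tau> i k * \<nu> j l * (?lin0 i j - lin \<psi> (\<alpha> k l) (x (i, j))))"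
    unfolding right_diff_distrib sum_subtractf by (simp add: wt)
  also have "\<dots> = (\<Sum>i<n. \<Sum>j<d. \<Sum>k\<in>UNIV. \<Sum>l\<in>UNIV.
      \<tau> i k * \<nu> j l * ((\<alpha>0 (z i) (w j) - \<alpha> k l) * \<xi> i j) + \<tau> i k * \<nu> j l * bregman \<psi> (\<alpha>0 (z i) (w j)) (\<alpha> k l))"
  proof (intro sum.cong refl)
    fix i j k l
    have "?lin0 i j - lin \<psi> (\<alpha> k l) (x (i, j)) = (\<alpha>0 (z i) (w j) - \<alpha> k l) * \<xi> i j + bregman \<psi> (\<alpha>0 (z i) (w j)) (\<alpha> k l)"
      by (simp add: lin_def bregman_def \<xi>_def algebra_simps)
    then show "\<tau> i k * \<nu> j l * (?lin0 i j - lin \<psi> (\<alpha> k l) (x (i, j)))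
      = \<tau> i k * \<nu> j l * ((\<alpha>0 (z i) (w j) - \<alpha> k l) * \<xi> i j) + \<tau> i k * \<nu> j l * bregman \<psi> (\<alpha>0 (z i) (w j)) (\<alpha> k l)"
      by (simp add: distrib_left)
  qed
  also have "\<dots> = (\<Sum>i<n. \<Sum>j<d. \<Sum>k\<in>UNIV. \<Sum>l\<in>UNIV. \<tau> i k * \<nu> j l * ((\<alpha>0 (z i) (w j) - \<alpha> k l) * \<xi> i j))
     + (\<Sum>i<n. \<Sum>j<d. \<Sum>k\<in>UNIV. \<Sum>l\<in>UNIV. \<tau> i k * \<nu> j l * bregman \<psi> (\<alpha>0 (z i) (w j)) (\<alpha> k l))"
    by (simp only: sum.distrib)
  finally have 2: "(\<Sum>i<n. \<Sum>j<d. ?lin0 i j)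
      - (\<Sum>i<n. \<Sum>j<d. \<Sum>k\<in>UNIV. \<Sum>l\<in>UNIV. \<tau> i k * \<nu> j l * lin \<psi> (\<alpha> k l) (x (i, j))) = \<dots>" .
  have D0: "hi - lo \<ge> 0" using I(1)[of undefined undefined] by auto
  \<comment> \<open>There is one bilinear form for each of the
    \<open>(CARD('g) * CARD('m))^2\<close> quadruples of classes. Its weights depend on the data
    through \<open>\<tau>\<close> and \<open>\<nu>\<close>, so the uniformity of
    \<open>noise\<close> in the weights is essential here.\<close>
  have 3: "(\<Sum>i<n. \<Sum>j<d. \<Sum>k\<in>UNIV. \<Sum>l\<in>UNIV. \<tau> i k * \<nu> j l * ((\<alpha>0 (z i) (w j) - \<alpha> k l) * \<xi> i j))
      \<ge> - ((real (CARD('g) * CARD('m)))\<^sup>2 * (hi - lo) * \<epsilon> * (real n * real d))"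
  proof -
    let ?X = "\<lambda>k' l' k l. \<Sum>i<n. \<Sum>j<d. (ind z i k' * \<tau> i k) * (ind w j l' * \<nu> j l) * \<xi> i j"
    have le: "- ((hi - lo) * (\<epsilon> * (real n * real d))) \<le> (\<alpha>0 k' l' - \<alpha> k l) * ?X k' l' k l" for k' l' k l
    proof -
      have "\<bar>?X k' l' k l\<bar> \<le> \<epsilon> * (real n * real d)"
        unfolding \<xi>_def using simplex_rowsD(1,2)[OF tau] simplex_rowsD(1,2)[OF nu]
        by (intro noise) (auto intro!: mult_le_one)
      then have "\<bar>\<alpha>0 k' l' - \<alpha> k l\<bar> * \<bar>?X k' l' k l\<bar> \<le> (hi - lo) * (\<epsilon> * (real n * real d))"
        using I(1)[of k l] I(2)[of k' l'] D0 by (intro mult_mono) auto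
      then show ?thesis unfolding abs_mult[symmetric] by linarith
    qed
    have "(\<Sum>k'\<in>(UNIV::'g set). \<Sum>l'\<in>(UNIV::'m set). \<Sum>k\<in>(UNIV::'g set). \<Sum>l\<in>(UNIV::'m set). - ((hi - lo) * (\<epsilon> * (real n * real d))))
        \<le> (\<Sum>k'\<in>UNIV. \<Sum>l'\<in>UNIV. \<Sum>k\<in>UNIV. \<Sum>l\<in>UNIV. (\<alpha>0 k' l' - \<alpha> k l) * ?X k' l' k l)"
      by (intro sum_mono le)
    then show ?thesis
      unfolding sum_class_expand[where F = "\<lambda>k' l' k l. \<alpha>0 k' l' - \<alpha> k l"]
      by (simp add: power2_eq_square mult_ac)
  qed
  have 4: "(\<Sum>i<n. \<Sum>j<d. \<Sum>k\<in>UNIV. \<Sum>l\<in>UNIV. \<tau> i k * \<nu> j l * bregman \<psi> (\<alpha>0 (z i) (w j)) (\<alpha> k l))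
     \<ge> \<kappa> * (\<Sum>k'\<in>UNIV. \<Sum>l'\<in>UNIV. \<Sum>k\<in>UNIV. \<Sum>l\<in>UNIV.
      (\<Sum>i<n. ind z i k' * \<tau> i k) * (\<Sum>j<d. ind w j l' * \<nu> j l) * (\<alpha>0 k' l' - \<alpha> k l)\<^sup>2)"
  proof -
    have "\<kappa> * (\<Sum>k'\<in>UNIV. \<Sum>l'\<in>UNIV. \<Sum>k\<in>UNIV. \<Sum>l\<in>UNIV.
        (\<Sum>i<n. ind z i k' * \<tau> i k) * (\<Sum>j<d. ind w j l' * \<nu> j l) * (\<alpha>0 k' l' - \<alpha> k l)\<^sup>2)
      = (\<Sum>k'\<in>UNIV. \<Sum>l'\<in>UNIV. \<Sum>k\<in>UNIV. \<Sum>l\<in>UNIV. (\<kappa> * (\<alpha>0 k' l' - \<alpha> k l)\<^sup>2) *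
        (\<Sum>i<n. \<Sum>j<d. (ind z i k' * \<tau> i k) * (ind w j l' * \<nu> j l) * 1))"
      unfolding sum_distrib_left[of \<kappa>] sum_product mult_1_right
      by (intro sum.cong refl) (simp add: sum_distrib_left sum_distrib_right mult_ac)
    also have "\<dots> = (\<Sum>i<n. \<Sum>j<d. \<Sum>k\<in>UNIV. \<Sum>l\<in>UNIV. \<tau> i k * \<nu> j l * ((\<kappa> * (\<alpha>0 (z i) (w j) - \<alpha> k l)\<^sup>2) * 1))"
      by (rule sum_class_expand[symmetric, where F = "\<lambda>k' l' k l. \<kappa> * (\<alpha>0 k' l' - \<alpha> k l)\<^sup>2"])
    also have "\<dots> \<le> (\<Sum>i<n. \<Sum>j<d. \<Sum>k\<in>UNIV. \<Sum>l\<in>UNIV. \<tau> i k * \<nu> j l * bregman \<psi> (\<alpha>0 (z i) (w j)) (\<alpha> k l))"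
      unfolding mult_1_right using simplex_rowsD(1)[OF tau] simplex_rowsD(1)[OF nu] I
      by (intro sum_mono mult_left_mono breg) auto
    finally show ?thesis .
  qed
  show ?thesis using 1 2 3 4 by linarith
qed

text \<open>Since \<open>\<nu>\<close> may depend on \<open>\<xi>\<close>, it is compared with the
  hard labels, from which it differs by at most \<open>1 - \<nu> j (w j)\<close> in column
  \<open>j\<close>. There the noise up to \<open>T\<close> costs \<open>T\<close> times the
  misplaced mass, and the excess over \<open>T\<close> is bounded without weights. One
  \<open>\<epsilon>\<close> comes from \<open>cls\<close>, one from \<open>tail\<close>.\<close>

lemma row_noise:
  fixes \<nu> :: "nat \<Rightarrow> 'm::finite \<Rightarrow> real"
  assumes nu: "simplex_rows d \<nu>" and T: "T \<ge> 0"
    and near: "(\<Sum>j<d. 1 - \<nu> j (w j)) \<le> \<eta> * real d"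
    and cls: "\<bar>\<Sum>j<d. ind w j l * \<xi> j\<bar> \<le> \<epsilon> * real d"
    and tail: "(\<Sum>j<d. max 0 (\<bar>\<xi> j\<bar> - T)) \<le> \<epsilon> * real d"
  shows "\<bar>\<Sum>j<d. \<nu> j l * \<xi> j\<bar> \<le> (2 * \<epsilon> + T * \<eta>) * real d"
proof -
  have "(\<Sum>j<d. \<bar>(\<nu> j l - ind w j l) * \<xi> j\<bar>) \<le> (\<Sum>j<d. max 0 (\<bar>\<xi> j\<bar> - T) + T * (1 - \<nu> j (w j)))"
  proof (rule sum_mono)
    fix j assume "j \<in> {..<d}"
    then have j: "j < d" by simp
    note D = simplex_rowsD[OF nu j]
    have "\<bar>\<nu> j l - ind w j l\<bar> \<le> 1 - \<nu> j (w j)"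
    proof (cases "w j = l")
      case False
      have "\<nu> j l + \<nu> j (w j) = (\<Sum>k\<in>{l, w j}. \<nu> j k)" using False by auto
      also have "\<dots> \<le> (\<Sum>k\<in>UNIV. \<nu> j k)" by (rule sum_mono2) (use D in auto)
      finally show ?thesis using D(1)[of l] D(3) False by (simp add: ind_def)
    qed (use D(2)[of l] in \<open>auto simp: ind_def\<close>)
    then have "\<bar>(\<nu> j l - ind w j l) * \<xi> j\<bar> \<le> (1 - \<nu> j (w j)) * \<bar>\<xi> j\<bar>"
      unfolding abs_mult by (rule mult_right_mono) simp
    also have "\<dots> \<le> max 0 (\<bar>\<xi> j\<bar> - T) + T * (1 - \<nu> j (w j))"
    proof (cases "\<bar>\<xi> j\<bar> \<le> T")
      case True
      have "(1 - \<nu> j (w j)) * \<bar>\<xi> j\<bar> \<le> (1 - \<nu> j (w j)) * T" using D(2) True by (intro mult_left_mono) auto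
      then show ?thesis by (simp add: mult.commute)
    next
      case False
      have "(1 - \<nu> j (w j)) * (\<bar>\<xi> j\<bar> - T) \<le> 1 * (\<bar>\<xi> j\<bar> - T)"
        using D(1) False by (intro mult_right_mono) auto
      then show ?thesis using False by (simp add: algebra_simps)
    qed
    finally show "\<bar>(\<nu> j l - ind w j l) * \<xi> j\<bar> \<le> max 0 (\<bar>\<xi> j\<bar> - T) + T * (1 - \<nu> j (w j))" .
  qed
  then have "(\<Sum>j<d. \<bar>(\<nu> j l - ind w j l) * \<xi> j\<bar>) \<le> \<epsilon> * real d + T * (\<eta> * real d)"
    using tail mult_left_mono[OF near T] by (simp add: sum.distrib sum_distrib_left[symmetric])
  then have "\<bar>\<Sum>j<d. (\<nu> j l - ind w j l) * \<xi> j\<bar> \<le> \<epsilon> * real d + T * (\<eta> * real d)"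
    using sum_abs[of "\<lambda>j. (\<nu> j l - ind w j l) * \<xi> j" "{..<d}"] by linarith
  moreover have "(\<Sum>j<d. \<nu> j l * \<xi> j) = (\<Sum>j<d. (\<nu> j l - ind w j l) * \<xi> j) + (\<Sum>j<d. ind w j l * \<xi> j)"
    by (simp add: sum.distrib[symmetric] algebra_simps)
  ultimately show ?thesis using cls by (simp add: algebra_simps)
qed

text \<open>Chains the deterministic steps: \<open>coarse_sum\<close> makes the confusion cost
  small, \<open>near_permutation\<close> aligns the labels, and \<open>row_gap\<close> then supplies
  both gap hypotheses of \<open>variational_objective_le\<close>.\<close>

lemma criterion_bound:
  fixes z :: "nat \<Rightarrow> 'g::finite" and w :: "nat \<Rightarrow> 'm::finite" and \<tau> :: "nat \<Rightarrow> 'g::finite \<Rightarrow> real" and \<nu> :: "nat \<Rightarrow> 'm::finite \<Rightarrow> real"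
  assumes tau: "simplex_rows n \<tau>" and nu: "simplex_rows d \<nu>"
    and c: "c > 0" and p: "\<And>k. c \<le> \<pi> k" "(\<Sum>k\<in>UNIV. \<pi> k) = 1" "\<And>l. c \<le> \<rho> l" "(\<Sum>l\<in>UNIV. \<rho> l) = 1"
    and p0: "\<And>k. c \<le> \<pi>0 k" "\<And>l. c \<le> \<rho>0 l"
    and breg: "\<And>a a'. a \<in> {lo..hi} \<Longrightarrow> a' \<in> {lo..hi} \<Longrightarrow> \<kappa> * (a - a')\<^sup>2 \<le> bregman \<psi> a a' \<and> bregman \<psi> a a' \<le> K * (a - a')\<^sup>2"
    and \<kappa>: "\<kappa> > 0" and K: "K > 0"
    and I: "\<And>k l. \<alpha> k l \<in> {lo..hi}" "\<And>k l. \<alpha>0 k l \<in> {lo..hi}"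
    and sep: "\<Delta> > 0" "\<And>k k'. k \<noteq> k' \<Longrightarrow> \<exists>l. \<Delta> \<le> \<bar>\<alpha>0 k l - \<alpha>0 k' l\<bar>" "\<And>l l'. l \<noteq> l' \<Longrightarrow> \<exists>k. \<Delta> \<le> \<bar>\<alpha>0 k l - \<alpha>0 k l'\<bar>"
    and nd: "n > 0" "d > 0"
    and freq: "c0 > 0" "\<And>k. c0 * real n \<le> (\<Sum>i<n. ind z i k)" "\<And>l. c0 * real d \<le> (\<Sum>j<d. ind w j l)"
    and noise: "\<And>u v. (\<And>i. i < n \<Longrightarrow> 0 \<le> u i \<and> u i \<le> 1) \<Longrightarrow> (\<And>j. j < d \<Longrightarrow> 0 \<le> v j \<and> v j \<le> 1) \<Longrightarrow>
      \<bar>\<Sum>i<n. \<Sum>j<d. u i * v j * (x (i, j) - deriv \<psi> (\<alpha>0 (z i) (w j)))\<bar> \<le> \<epsilon>1 * (real n * real d)"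
    and noise_row: "\<And>i l. i < n \<Longrightarrow> \<bar>\<Sum>j<d. ind w j l * (x (i, j) - deriv \<psi> (\<alpha>0 (z i) (w j)))\<bar> \<le> \<epsilon>2 * real d"
    and noise_col: "\<And>j k. j < d \<Longrightarrow> \<bar>\<Sum>i<n. ind z i k * (x (i, j) - deriv \<psi> (\<alpha>0 (z i) (w j)))\<bar> \<le> \<epsilon>2 * real n"
    and noise_tail: "\<And>i. i < n \<Longrightarrow> (\<Sum>j<d. max 0 (\<bar>x (i, j) - deriv \<psi> (\<alpha>0 (z i) (w j))\<bar> - T)) \<le> \<epsilon>2 * real d"
    and T: "T \<ge> 0"
    and e: "0 < e" "e \<le> \<Delta> / 4"
    and \<delta>: "\<delta> \<le> (c0 / real CARD('g)) * (c0 / real CARD('m)) * e\<^sup>2" "4 * \<delta> \<le> (c0 / real CARD('g)) * \<Delta>\<^sup>2 * e"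
    and size: "1 - (real n + real d) * ln c \<le> \<kappa> * \<delta> / 2 * (real n * real d)"
    and eps1: "(real (CARD('g) * CARD('m)))\<^sup>2 * (hi - lo) * \<epsilon>1 \<le> \<kappa> * \<delta> / 2"
    and \<eta>: "\<eta> = (real CARD('m))\<^sup>2 * e"
    and gap_row: "c' \<le> \<kappa> * (\<Delta>\<^sup>2 / 4) * (c0 - \<eta>) - K * (e\<^sup>2 + \<eta> * (hi - lo)\<^sup>2) - real CARD('m) * (hi - lo) * (2 * \<epsilon>2 + T * \<eta>)"
    and gap_col: "c' \<le> \<kappa> * (\<Delta>\<^sup>2 / 4) * c0 - K * e\<^sup>2 - real CARD('g) * (hi - lo) * \<epsilon>2"
    and competitive: "variational_objective \<psi> n d x \<tau> \<nu> \<pi> \<rho> \<alpha> \<ge> complete_loglik \<psi> n d x z w \<pi>0 \<rho>0 \<alpha>0 - 1"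
  obtains s t where "s permutes UNIV" "t permutes UNIV"
    "variational_objective \<psi> n d x \<tau> \<nu> \<pi> \<rho> \<alpha> \<le>
      complete_loglik \<psi> n d x z w (\<lambda>k. \<pi> (s k)) (\<lambda>l. \<rho> (t l)) (\<lambda>k l. \<alpha> (s k) (t l)) +
      (real n * exp (- (c' * real d)) + real d * exp (- (c' * real n))) / c"
proof -
  \<comment> \<open>Normalised confusion matrices: \<open>P k' k\<close> is the proportion of all
    rows that belong to true class \<open>k'\<close> and carry label \<open>k\<close>. Their row
    sums are the true class frequencies.\<close>
  define P where "P k' k = (\<Sum>i<n. ind z i k' * \<tau> i k) / real n" for k' k
  define R where "R l' l = (\<Sum>j<d. ind w j l' * \<nu> j l) / real d" for l' l
  note tauD = simplex_rowsD[OF tau] and nuD = simplex_rowsD[OF nu]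
  let ?S = "\<Sum>k'\<in>UNIV. \<Sum>l'\<in>UNIV. \<Sum>k\<in>UNIV. \<Sum>l\<in>UNIV.
      (\<Sum>i<n. ind z i k' * \<tau> i k) * (\<Sum>j<d. ind w j l' * \<nu> j l) * (\<alpha>0 k' l' - \<alpha> k l)\<^sup>2"
  have "\<kappa> * ?S \<le> 1 - (real n + real d) * ln c + (real (CARD('g) * CARD('m)))\<^sup>2 * (hi - lo) * \<epsilon>1 * (real n * real d)"
    by (rule coarse_sum[where \<pi> = \<pi> and \<rho> = \<rho> and ?\<pi>0.0 = \<pi>0 and ?\<rho>0.0 = \<rho>0 and \<psi> = \<psi> and x = x])
       (fact tau nu c p p0 I noise competitive breg[THEN conjunct1])+
  \<comment> \<open>The errors of order \<open>n + d\<close> and of order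
    \<open>\<epsilon>1 * n * d\<close> each take half of the budget.\<close>
  also have "\<dots> \<le> \<kappa> * \<delta> / 2 * (real n * real d) + \<kappa> * \<delta> / 2 * (real n * real d)"
    by (intro add_mono size mult_right_mono eps1) simp
  also have "\<dots> = \<kappa> * (\<delta> * (real n * real d))" by simp
  finally have S: "?S \<le> \<delta> * (real n * real d)" using \<kappa> by simp
  have "(\<Sum>k'\<in>UNIV. \<Sum>l'\<in>UNIV. \<Sum>k\<in>UNIV. \<Sum>l\<in>UNIV. P k' k * R l' l * (\<alpha>0 k' l' - \<alpha> k l)\<^sup>2) = ?S / (real n * real d)"
    unfolding sum_divide_distrib by (intro sum.cong refl) (simp add: P_def R_def)
  also have "\<dots> \<le> \<delta>" using S nd by (simp add: pos_divide_le_eq)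
  finally have S': "(\<Sum>k'\<in>UNIV. \<Sum>l'\<in>UNIV. \<Sum>k\<in>UNIV. \<Sum>l\<in>UNIV. P k' k * R l' l * (\<alpha>0 k' l' - \<alpha> k l)\<^sup>2) \<le> \<delta>" .
  have P0: "0 \<le> P k' k" for k' k unfolding P_def using tauD by (intro divide_nonneg_nonneg sum_nonneg) auto
  have R0: "0 \<le> R l' l" for l' l unfolding R_def using nuD by (intro divide_nonneg_nonneg sum_nonneg) auto
  have "(\<Sum>k\<in>UNIV. P k' k) = (\<Sum>i<n. ind z i k') / real n" for k'
  proof -
    have "(\<Sum>k\<in>UNIV. \<Sum>i<n. ind z i k' * \<tau> i k) = (\<Sum>i<n. ind z i k' * (\<Sum>k\<in>UNIV. \<tau> i k))"
      unfolding sum_distrib_left by (rule sum.swap)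
    then show ?thesis by (simp add: P_def sum_divide_distrib[symmetric] tauD)
  qed
  then have Psum: "c0 \<le> (\<Sum>k\<in>UNIV. P k' k)" for k'
    using freq(2)[of k'] nd by (simp add: pos_le_divide_eq)
  have "(\<Sum>l\<in>UNIV. R l' l) = (\<Sum>j<d. ind w j l') / real d" for l'
  proof -
    have "(\<Sum>l\<in>UNIV. \<Sum>j<d. ind w j l' * \<nu> j l) = (\<Sum>j<d. ind w j l' * (\<Sum>l\<in>UNIV. \<nu> j l))"
      unfolding sum_distrib_left by (rule sum.swap)
    then show ?thesis by (simp add: R_def sum_divide_distrib[symmetric] nuD)
  qed
  then have Rsum: "c0 \<le> (\<Sum>l\<in>UNIV. R l' l)" for l'
    using freq(3)[of l'] nd by (simp add: pos_le_divide_eq)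
  obtain s t where s: "s permutes UNIV" and t: "t permutes UNIV"
    and close: "\<And>k l. \<bar>\<alpha>0 k l - \<alpha> (s k) (t l)\<bar> \<le> e" and off: "\<And>l' l. l \<noteq> t l' \<Longrightarrow> R l' l \<le> e"
    by (rule near_permutation[OF P0 Psum R0 Rsum freq(1) sep S' e \<delta>]) blast+
  define \<nu>' where "\<nu>' j l = \<nu> j (t l)" for j l
  define \<tau>' where "\<tau>' i k = \<tau> i (s k)" for i k
  have nu': "simplex_rows d \<nu>'"
    using nuD(1,3) sum.permute[OF t, of "\<nu> _"] by (auto simp: simplex_rows_def \<nu>'_def o_def)
  have tau': "simplex_rows n \<tau>'"
    using tauD(1,3) sum.permute[OF s, of "\<tau> _"] by (auto simp: simplex_rows_def \<tau>'_def o_def)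
  \<comment> \<open>Each of the at most \<open>CARD('m)^2\<close> off-matching entries of
    \<open>R\<close> is at most \<open>e\<close>, which is the origin of
    \<open>\<eta>\<close>.\<close>
  have near: "(\<Sum>j<d. 1 - \<nu>' j (w j)) \<le> \<eta> * real d"
  proof -
    have "(\<Sum>j<d. 1 - \<nu>' j (w j)) = (\<Sum>j<d. \<Sum>l'\<in>UNIV. ind w j l' * (\<Sum>l\<in>UNIV - {t l'}. \<nu> j l))"
    proof (intro sum.cong refl)
      fix j assume "j \<in> {..<d}"
      then show "1 - \<nu>' j (w j) = (\<Sum>l'\<in>UNIV. ind w j l' * (\<Sum>l\<in>UNIV - {t l'}. \<nu> j l))"
        using nuD(3)[of j] by (simp add: sum.remove[of UNIV "t (w j)"] \<nu>'_def)
    qed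
    also have "\<dots> = (\<Sum>l'\<in>UNIV. \<Sum>j<d. ind w j l' * (\<Sum>l\<in>UNIV - {t l'}. \<nu> j l))"
      by (rule sum.swap)
    also have "\<dots> = (\<Sum>l'\<in>UNIV. \<Sum>l\<in>UNIV - {t l'}. \<Sum>j<d. ind w j l' * \<nu> j l)"
      unfolding sum_distrib_left by (intro sum.cong refl sum.swap)
    also have "\<dots> \<le> (\<Sum>l'\<in>(UNIV::'m set). \<Sum>l\<in>(UNIV::'m set). e * real d)"
    proof (rule sum_mono)
      fix l'
      have "(\<Sum>l\<in>UNIV - {t l'}. \<Sum>j<d. ind w j l' * \<nu> j l) \<le> (\<Sum>l\<in>UNIV - {t l'}. e * real d)"
      proof (rule sum_mono)
        fix l assume "l \<in> UNIV - {t l'}"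
        then have "R l' l \<le> e" using off by auto
        then show "(\<Sum>j<d. ind w j l' * \<nu> j l) \<le> e * real d"
          unfolding R_def using nd by (simp add: pos_divide_le_eq)
      qed
      also have "\<dots> \<le> (\<Sum>l\<in>(UNIV::'m set). e * real d)"
        using e by (intro sum_mono2) auto
      finally show "(\<Sum>l\<in>UNIV - {t l'}. \<Sum>j<d. ind w j l' * \<nu> j l) \<le> (\<Sum>l\<in>(UNIV::'m set). e * real d)" .
    qed
    also have "\<dots> = \<eta> * real d" by (simp add: \<eta> power2_eq_square)
    finally show ?thesis .
  qed
  \<comment> \<open>True rows differ by \<open>\<Delta>\<close> somewhere; replacing one of them by
    its estimate costs at most \<open>e \<le> \<Delta> / 4\<close>.\<close>
  have away_row: "\<exists>l0. \<bar>\<alpha>0 k l0 - \<alpha> (s k') (t l0)\<bar> \<ge> \<Delta> / 2" if ne: "k \<noteq> k'" for k k'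
  proof -
    obtain l where "\<Delta> \<le> \<bar>\<alpha>0 k l - \<alpha>0 k' l\<bar>" using sep(2)[OF ne] by blast
    then have "\<bar>\<alpha>0 k l - \<alpha> (s k') (t l)\<bar> \<ge> \<Delta> / 2" using close[of k' l] e sep(1) by linarith
    then show ?thesis ..
  qed
  have away_col: "\<exists>k0. \<bar>\<alpha>0 k0 l - \<alpha> (s k0) (t l')\<bar> \<ge> \<Delta> / 2" if ne: "l \<noteq> l'" for l l'
  proof -
    obtain k where "\<Delta> \<le> \<bar>\<alpha>0 k l - \<alpha>0 k l'\<bar>" using sep(3)[OF ne] by blast
    then have "\<bar>\<alpha>0 k l - \<alpha> (s k) (t l')\<bar> \<ge> \<Delta> / 2" using close[of k l'] e sep(1) by linarith
    then show ?thesis ..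
  qed
  show thesis
  proof (rule that[OF s t])
    have "variational_objective \<psi> n d x \<tau> \<nu> \<pi> \<rho> \<alpha> =
        variational_objective \<psi> n d x \<tau>' \<nu>' (\<lambda>k. \<pi> (s k)) (\<lambda>l. \<rho> (t l)) (\<lambda>k l. \<alpha> (s k) (t l))"
      unfolding \<tau>'_def \<nu>'_def by (rule variational_objective_permute[OF s t])
    also have "\<dots> \<le> complete_loglik \<psi> n d x z w (\<lambda>k. \<pi> (s k)) (\<lambda>l. \<rho> (t l)) (\<lambda>k l. \<alpha> (s k) (t l)) +
      (real n * exp (- (c' * real d)) + real d * exp (- (c' * real n))) / c"
    proof (rule variational_objective_le[OF tau' nu' c])
      show "(\<Sum>k\<in>UNIV. \<pi> (s k)) = 1" "(\<Sum>l\<in>UNIV. \<rho> (t l)) = 1"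
        using p sum.permute[OF s, of \<pi>] sum.permute[OF t, of \<rho>] by (auto simp: o_def)
      show "(\<Sum>j<d. \<Sum>l\<in>UNIV. \<nu>' j l * (lin \<psi> (\<alpha> (s k) (t l)) (x (i, j)) - lin \<psi> (\<alpha> (s (z i)) (t l)) (x (i, j)))) \<le> - (c' * real d)"
        if i: "i < n" and ne: "k \<noteq> z i" for i k
      proof -
        obtain l0 where l0: "\<bar>\<alpha>0 (z i) l0 - \<alpha> (s k) (t l0)\<bar> \<ge> \<Delta> / 2" using away_row[OF ne[symmetric]] by blast
        have "(\<Sum>j<d. \<Sum>l\<in>UNIV. \<nu>' j l * (lin \<psi> (\<alpha> (s k) (t l)) (x (i, j)) - lin \<psi> (\<alpha> (s (z i)) (t l)) (x (i, j))))
          \<le> - (\<kappa> * (\<Delta>\<^sup>2 / 4) * (c0 - \<eta>) - K * (e\<^sup>2 + \<eta> * (hi - lo)\<^sup>2) - real CARD('m) * (hi - lo) * (2 * \<epsilon>2 + T * \<eta>)) * real d"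
        proof (rule row_gap[where ?a0.0 = "\<lambda>l. \<alpha>0 (z i) l" and ?l0.0 = l0 and w = w])
          show "\<bar>\<Sum>j<d. \<nu>' j l * (x (i, j) - deriv \<psi> (\<alpha>0 (z i) (w j)))\<bar> \<le> (2 * \<epsilon>2 + T * \<eta>) * real d" for l
            by (rule row_noise[OF nu' T near noise_row noise_tail]) (rule i)+
        qed (use nu' breg \<kappa> K I close l0 sep freq near in auto)
        also have "\<dots> \<le> - c' * real d" using gap_row by (intro mult_right_mono) auto
        finally show ?thesis by simp
      qed
      show "(\<Sum>i<n. lin \<psi> (\<alpha> (s (z i)) (t l)) (x (i, j)) - lin \<psi> (\<alpha> (s (z i)) (t (w j))) (x (i, j))) \<le> - (c' * real n)"
        if j: "j < d" and ne: "l \<noteq> w j" for j l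
      proof -
        obtain k0 where k0: "\<bar>\<alpha>0 k0 (w j) - \<alpha> (s k0) (t l)\<bar> \<ge> \<Delta> / 2" using away_col[OF ne[symmetric]] by blast
        \<comment> \<open>\<open>row_gap\<close> for a column: the weights are the true row labels,
          so the misplaced mass is 0 and class-wise noise suffices.\<close>
        have "(\<Sum>i<n. \<Sum>k\<in>UNIV. ind z i k * (lin \<psi> (\<alpha> (s k) (t l)) (x (i, j)) - lin \<psi> (\<alpha> (s k) (t (w j))) (x (i, j))))
          \<le> - (\<kappa> * (\<Delta>\<^sup>2 / 4) * (c0 - 0) - K * (e\<^sup>2 + 0 * (hi - lo)\<^sup>2) - real CARD('g) * (hi - lo) * \<epsilon>2) * real n"
        proof (rule row_gap[where ?a0.0 = "\<lambda>k. \<alpha>0 k (w j)" and ?l0.0 = k0 and w = z])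
          show "(\<Sum>i<n. 1 - ind z i (z i)) \<le> 0 * real n" by (simp add: ind_def)
        qed (use simplex_rows_ind breg \<kappa> K I close k0 sep freq noise_col[OF j] in auto)
        also have "\<dots> \<le> - c' * real n" using gap_col by (intro mult_right_mono) auto
        finally show ?thesis by simp
      qed
    qed (use p in auto)
    finally show "variational_objective \<psi> n d x \<tau> \<nu> \<pi> \<rho> \<alpha> \<le>
      complete_loglik \<psi> n d x z w (\<lambda>k. \<pi> (s k)) (\<lambda>l. \<rho> (t l)) (\<lambda>k l. \<alpha> (s k) (t l)) +
      (real n * exp (- (c' * real d)) + real d * exp (- (c' * real n))) / c" .
  qed
qed

section \<open>Quadratic drop of the complete log-likelihood\<close>

text \<open>With \<open>p = u\<^sup>2\<close> and \<open>q = v\<^sup>2\<close> this is \<open>ln (v / u) \<le> v / u - 1\<close> and \<open>u + v \<le> 2\<close>.\<close>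

lemma entropy_term_ge:
  fixes p q :: real
  assumes "0 < p" "p \<le> 1" "0 < q" "q \<le> 1"
  shows "p * (ln p - ln q) \<ge> p - q + (p - q)\<^sup>2 / 4"
proof -
  define u v where "u = sqrt p" and "v = sqrt q"
  have uv: "0 < u" "u \<le> 1" "0 < v" "v \<le> 1" "p = u\<^sup>2" "q = v\<^sup>2"
    using assms by (auto simp: u_def v_def)
  have "ln v - ln u \<le> v / u - 1"
    using uv ln_div[of v u] ln_le_minus_one[of "v / u"] by simp
  then have "2 * u\<^sup>2 * (ln v - ln u) \<le> 2 * u\<^sup>2 * (v / u - 1)"
    by (intro mult_left_mono) auto
  then have 1: "p * (ln p - ln q) \<ge> 2 * u\<^sup>2 - 2 * u * v"
  proof -
    have "ln p = 2 * ln u" "ln q = 2 * ln v" using uv by (simp_all add: ln_realpow)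
    then have "p * (ln p - ln q) = - (2 * u\<^sup>2 * (ln v - ln u))"
      by (simp add: uv(5) algebra_simps)
    moreover have "2 * u\<^sup>2 * (v / u - 1) = 2 * u * v - 2 * u\<^sup>2"
      using uv by (simp add: power2_eq_square field_simps)
    ultimately show ?thesis using \<open>2 * u\<^sup>2 * (ln v - ln u) \<le> 2 * u\<^sup>2 * (v / u - 1)\<close> by linarith
  qed
  have "(u + v)\<^sup>2 \<le> 2\<^sup>2" using uv by (intro power_mono) auto
  then have "(u - v)\<^sup>2 * (u + v)\<^sup>2 \<le> (u - v)\<^sup>2 * 4" by (intro mult_left_mono) auto
  then have 2: "(p - q)\<^sup>2 \<le> 4 * (u - v)\<^sup>2"
    by (simp add: uv(5,6) power_mult_distrib[symmetric] power2_eq_square[of u] power2_eq_square[of v] algebra_simps)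
  have "(u - v)\<^sup>2 = u\<^sup>2 + v\<^sup>2 - 2 * u * v" by (rule power2_diff)
  then show ?thesis using 1 2 uv(5,6) by linarith
qed

text \<open>A Pinsker-type bound in Euclidean norm: the linear terms of
  \<open>entropy_term_ge\<close> cancel because both vectors sum to 1.\<close>

lemma entropy_gap:
  fixes p q :: "'k::finite \<Rightarrow> real"
  assumes "\<And>k. 0 < p k" "\<And>k. 0 < q k" "(\<Sum>k\<in>UNIV. p k) = 1" "(\<Sum>k\<in>UNIV. q k) = 1"
  shows "(\<Sum>k\<in>UNIV. p k * (ln (p k) - ln (q k))) \<ge> (\<Sum>k\<in>UNIV. (p k - q k)\<^sup>2) / 4"
proof -
  have le1: "p k \<le> 1" "q k \<le> 1" for k
    using member_le_sum[of k UNIV p] member_le_sum[of k UNIV q] assms by (auto simp: less_imp_le)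
  have "(\<Sum>k\<in>UNIV. p k - q k + (p k - q k)\<^sup>2 / 4) \<le> (\<Sum>k\<in>UNIV. p k * (ln (p k) - ln (q k)))"
    using assms le1 by (intro sum_mono entropy_term_ge) auto
  then show ?thesis using assms by (simp add: sum.distrib sum_subtractf sum_divide_distrib)
qed

text \<open>The parameters \<open>\<pi>h\<close>, \<open>\<rho>h\<close>, \<open>\<alpha>h\<close>
  maximise the complete likelihood. The score equations remove the terms linear in the data, leaving
  relative entropies and Bregman divergences weighted by class sizes, which are at least
  \<open>c0 * n\<close> and \<open>c0 * d\<close>.\<close>

lemma complete_mle_gap:
  fixes z :: "nat \<Rightarrow> 'g::finite" and w :: "nat \<Rightarrow> 'm::finite"
  assumes nd: "n > 0" "d > 0"
    and p: "\<And>k. 0 < \<pi> k" "(\<Sum>k\<in>UNIV. \<pi> k) = 1" "\<And>l. 0 < \<rho> l" "(\<Sum>l\<in>UNIV. \<rho> l) = 1"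
    and ph: "\<And>k. \<pi>h k = (\<Sum>i<n. ind z i k) / real n" "\<And>l. \<rho>h l = (\<Sum>j<d. ind w j l) / real d"
    and freq: "c0 > 0" "\<And>k. c0 * real n \<le> (\<Sum>i<n. ind z i k)" "\<And>l. c0 * real d \<le> (\<Sum>j<d. ind w j l)"
    and score: "\<And>k l. (\<Sum>i<n. \<Sum>j<d. ind z i k * ind w j l * (x (i, j) - deriv \<psi> (\<alpha>h k l))) = 0"
    and breg: "\<And>a a'. a \<in> {lo..hi} \<Longrightarrow> a' \<in> {lo..hi} \<Longrightarrow> \<kappa> * (a - a')\<^sup>2 \<le> bregman \<psi> a a'"
    and \<kappa>: "\<kappa> > 0"
    and I: "\<And>k l. \<alpha> k l \<in> {lo..hi}" "\<And>k l. \<alpha>h k l \<in> {lo..hi}"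
  shows "complete_loglik \<psi> n d x z w \<pi>h \<rho>h \<alpha>h - complete_loglik \<psi> n d x z w \<pi> \<rho> \<alpha> \<ge>
    real n / 4 * (\<Sum>k\<in>UNIV. (\<pi>h k - \<pi> k)\<^sup>2) + real d / 4 * (\<Sum>l\<in>UNIV. (\<rho>h l - \<rho> l)\<^sup>2)
    + \<kappa> * c0\<^sup>2 * (real n * real d) * (\<Sum>k\<in>UNIV. \<Sum>l\<in>UNIV. (\<alpha>h k l - \<alpha> k l)\<^sup>2)"
proof -
  have "c0 * real n > 0" "c0 * real d > 0" using nd freq by auto
  then have hpos: "\<pi>h k > 0" "\<rho>h l > 0" for k l
    using freq(2)[of k] freq(3)[of l] nd unfolding ph by auto
  have hsum: "(\<Sum>k\<in>UNIV. \<pi>h k) = 1" "(\<Sum>l\<in>UNIV. \<rho>h l) = 1"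
    using sum_ind_expand[of "\<lambda>_. 1" z n] sum_ind_expand[of "\<lambda>_. 1" w d] nd
    by (simp_all add: ph sum_divide_distrib[symmetric])
  have ph': "(\<Sum>i<n. ind z i k) = real n * \<pi>h k" "(\<Sum>j<d. ind w j l) = real d * \<rho>h l" for k l
    using nd by (auto simp: ph)
  have A: "(\<Sum>i<n. ln (\<pi>h (z i)) - ln (\<pi> (z i))) \<ge> real n / 4 * (\<Sum>k\<in>UNIV. (\<pi>h k - \<pi> k)\<^sup>2)"
  proof -
    have "(\<Sum>i<n. ln (\<pi>h (z i)) - ln (\<pi> (z i))) = real n * (\<Sum>k\<in>UNIV. \<pi>h k * (ln (\<pi>h k) - ln (\<pi> k)))"
      unfolding sum_ind_expand[of "\<lambda>k. ln (\<pi>h k) - ln (\<pi> k)"] ph' by (simp add: sum_distrib_left mult.assoc)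
    also have "\<dots> \<ge> real n * ((\<Sum>k\<in>UNIV. (\<pi>h k - \<pi> k)\<^sup>2) / 4)"
      by (intro mult_left_mono entropy_gap hpos hsum p) simp
    finally show ?thesis by simp
  qed
  have B: "(\<Sum>j<d. ln (\<rho>h (w j)) - ln (\<rho> (w j))) \<ge> real d / 4 * (\<Sum>l\<in>UNIV. (\<rho>h l - \<rho> l)\<^sup>2)"
  proof -
    have "(\<Sum>j<d. ln (\<rho>h (w j)) - ln (\<rho> (w j))) = real d * (\<Sum>l\<in>UNIV. \<rho>h l * (ln (\<rho>h l) - ln (\<rho> l)))"
      unfolding sum_ind_expand[of "\<lambda>l. ln (\<rho>h l) - ln (\<rho> l)"] ph' by (simp add: sum_distrib_left mult.assoc)
    also have "\<dots> \<ge> real d * ((\<Sum>l\<in>UNIV. (\<rho>h l - \<rho> l)\<^sup>2) / 4)"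
      by (intro mult_left_mono entropy_gap hpos hsum p) simp
    finally show ?thesis by simp
  qed
  have C: "(\<Sum>i<n. \<Sum>j<d. lin \<psi> (\<alpha>h (z i) (w j)) (x (i, j)) - lin \<psi> (\<alpha> (z i) (w j)) (x (i, j)))
      \<ge> \<kappa> * c0\<^sup>2 * (real n * real d) * (\<Sum>k\<in>UNIV. \<Sum>l\<in>UNIV. (\<alpha>h k l - \<alpha> k l)\<^sup>2)"
  proof -
    have "(\<Sum>i<n. \<Sum>j<d. lin \<psi> (\<alpha>h (z i) (w j)) (x (i, j)) - lin \<psi> (\<alpha> (z i) (w j)) (x (i, j)))
      = (\<Sum>i<n. \<Sum>j<d. (\<alpha>h (z i) (w j) - \<alpha> (z i) (w j)) * (x (i, j) - deriv \<psi> (\<alpha>h (z i) (w j))))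
        + (\<Sum>i<n. \<Sum>j<d. bregman \<psi> (\<alpha>h (z i) (w j)) (\<alpha> (z i) (w j)) * 1)"
      unfolding sum.distrib[symmetric] by (intro sum.cong refl) (simp add: lin_def bregman_def algebra_simps)
    also have "(\<Sum>i<n. \<Sum>j<d. (\<alpha>h (z i) (w j) - \<alpha> (z i) (w j)) * (x (i, j) - deriv \<psi> (\<alpha>h (z i) (w j)))) = 0"
    proof -
      have "(\<Sum>i<n. \<Sum>j<d. (\<alpha>h (z i) (w j) - \<alpha> (z i) (w j)) * (x (i, j) - deriv \<psi> (\<alpha>h (z i) (w j))))
        = (\<Sum>k\<in>UNIV. \<Sum>l\<in>UNIV. (\<alpha>h k l - \<alpha> k l) * (\<Sum>i<n. \<Sum>j<d. ind z i k * ind w j l * (x (i, j) - deriv \<psi> (\<alpha>h (z i) (w j)))))"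
        by (rule sum_class_expand2[where G = "\<lambda>k l. \<alpha>h k l - \<alpha> k l"])
      also have "\<dots> = (\<Sum>k\<in>UNIV. \<Sum>l\<in>UNIV. (\<alpha>h k l - \<alpha> k l) * (\<Sum>i<n. \<Sum>j<d. ind z i k * ind w j l * (x (i, j) - deriv \<psi> (\<alpha>h k l))))"
      proof -
        have "ind z i k * ind w j l * (x (i, j) - deriv \<psi> (\<alpha>h (z i) (w j)))
          = ind z i k * ind w j l * (x (i, j) - deriv \<psi> (\<alpha>h k l))" for i j k l
          by (simp add: ind_def)
        then show ?thesis by (simp only:)
      qed
      finally show ?thesis by (simp add: score)
    qed
    also have "(\<Sum>i<n. \<Sum>j<d. bregman \<psi> (\<alpha>h (z i) (w j)) (\<alpha> (z i) (w j)) * 1)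
      = (\<Sum>k\<in>UNIV. \<Sum>l\<in>UNIV. bregman \<psi> (\<alpha>h k l) (\<alpha> k l) * (\<Sum>i<n. \<Sum>j<d. ind z i k * ind w j l * 1))"
      by (rule sum_class_expand2[where G = "\<lambda>k l. bregman \<psi> (\<alpha>h k l) (\<alpha> k l)"])
    finally have eq: "(\<Sum>i<n. \<Sum>j<d. lin \<psi> (\<alpha>h (z i) (w j)) (x (i, j)) - lin \<psi> (\<alpha> (z i) (w j)) (x (i, j)))
      = (\<Sum>k\<in>UNIV. \<Sum>l\<in>UNIV. bregman \<psi> (\<alpha>h k l) (\<alpha> k l) * ((\<Sum>i<n. ind z i k) * (\<Sum>j<d. ind w j l)))"
      by (simp add: sum_product)
    have "\<kappa> * c0\<^sup>2 * (real n * real d) * (\<Sum>k\<in>UNIV. \<Sum>l\<in>UNIV. (\<alpha>h k l - \<alpha> k l)\<^sup>2)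
      = (\<Sum>k\<in>UNIV. \<Sum>l\<in>UNIV. \<kappa> * (\<alpha>h k l - \<alpha> k l)\<^sup>2 * ((c0 * real n) * (c0 * real d)))"
      by (simp add: sum_distrib_left power2_eq_square mult_ac)
    also have "\<dots> \<le> (\<Sum>k\<in>UNIV. \<Sum>l\<in>UNIV. bregman \<psi> (\<alpha>h k l) (\<alpha> k l) * ((\<Sum>i<n. ind z i k) * (\<Sum>j<d. ind w j l)))"
    proof (intro sum_mono mult_mono freq breg I)
      show "0 \<le> bregman \<psi> (\<alpha>h k l) (\<alpha> k l)" for k l
        using breg[OF I(2) I(1), of k l k l] \<kappa> by (meson mult_nonneg_nonneg less_imp_le zero_le_power2 order_trans)
    qed (use freq \<kappa> in \<open>auto intro!: sum_nonneg\<close>)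
    finally show ?thesis unfolding eq .
  qed
  have "complete_loglik \<psi> n d x z w \<pi>h \<rho>h \<alpha>h - complete_loglik \<psi> n d x z w \<pi> \<rho> \<alpha> =
    (\<Sum>i<n. ln (\<pi>h (z i)) - ln (\<pi> (z i))) + (\<Sum>j<d. ln (\<rho>h (w j)) - ln (\<rho> (w j)))
    + (\<Sum>i<n. \<Sum>j<d. lin \<psi> (\<alpha>h (z i) (w j)) (x (i, j)) - lin \<psi> (\<alpha> (z i) (w j)) (x (i, j)))"
    by (simp add: complete_loglik_def sum_subtractf)
  then show ?thesis using A B C by linarith
qed

section \<open>Factorized distributions\<close>

lemma asg_eq_1_iff: "asg z i k = 1 \<longleftrightarrow> z i = k"
  by (simp add: asg_def)

lemma prod_power_asg: "(\<Prod>k\<in>UNIV. a k ^ asg z i k) = (a (z i :: 'k::finite) :: real)"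
proof -
  have "(\<Prod>k\<in>UNIV. a k ^ asg z i k) = (\<Prod>k\<in>UNIV. if z i = k then a k else 1)"
    by (intro prod.cong) (auto simp: asg_def)
  then show ?thesis by simp
qed

lemma sum_weight:
  fixes \<tau> :: "nat \<Rightarrow> 'k::finite \<Rightarrow> real"
  assumes "simplex_rows n \<tau>"
  shows "(\<Sum>z\<in>assignments n. \<Prod>i<n. \<tau> i (z i)) = 1"
proof -
  have "(\<Sum>z\<in>assignments n. \<Prod>i<n. \<tau> i (z i)) = (\<Prod>i<n. \<Sum>k\<in>UNIV. \<tau> i k)"
    unfolding assignments_def by (rule prod_sum_PiE[symmetric]) auto
  then show ?thesis using simplex_rowsD(3)[OF assms] by simp
qed

text \<open>Absorb \<open>f\<close> into the factor of coordinate \<open>i\<close>; the sum over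
  assignments then factorises and every other factor is 1.\<close>

lemma sum_weight_coordinate:
  fixes \<tau> :: "nat \<Rightarrow> 'k::finite \<Rightarrow> real"
  assumes "simplex_rows n \<tau>" "i < n"
  shows "(\<Sum>z\<in>assignments n. f (z i) * (\<Prod>i<n. \<tau> i (z i))) = (\<Sum>k\<in>UNIV. \<tau> i k * f k)"
proof -
  define g where "g i' k = (if i' = i then f k else 1) * \<tau> i' k" for i' k
  have "f (z i) * (\<Prod>i<n. \<tau> i (z i)) = (\<Prod>i'<n. g i' (z i'))" for z
    using assms(2) by (simp add: g_def prod.distrib)
  then have "(\<Sum>z\<in>assignments n. f (z i) * (\<Prod>i<n. \<tau> i (z i))) = (\<Sum>z\<in>assignments n. \<Prod>i'<n. g i' (z i'))"
    by simp
  also have "\<dots> = (\<Prod>i'<n. \<Sum>k\<in>UNIV. g i' k)"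
    unfolding assignments_def by (rule prod_sum_PiE[symmetric]) auto
  also have "\<dots> = (\<Sum>k\<in>UNIV. g i k) * (\<Prod>i'\<in>{..<n} - {i}. \<Sum>k\<in>UNIV. g i' k)"
    using assms(2) by (intro prod.remove) auto
  also have "(\<Prod>i'\<in>{..<n} - {i}. \<Sum>k\<in>UNIV. g i' k) = 1"
    using simplex_rowsD(3)[OF assms(1)] by (intro prod.neutral) (auto simp: g_def)
  finally show ?thesis by (simp add: g_def mult.commute)
qed

definition row_marginal :: "((nat \<Rightarrow> 'g) \<times> (nat \<Rightarrow> 'm)) pmf \<Rightarrow> nat \<Rightarrow> 'g \<Rightarrow> real" where
  "row_marginal Q i k = measure_pmf.prob Q {(z, w). z i = k}"

definition col_marginal :: "((nat \<Rightarrow> 'g) \<times> (nat \<Rightarrow> 'm)) pmf \<Rightarrow> nat \<Rightarrow> 'm \<Rightarrow> real" where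
  "col_marginal Q j l = measure_pmf.prob Q {(z, w). w j = l}"

lemma simplex_rows_marginal:
  fixes Q :: "((nat \<Rightarrow> 'g::finite) \<times> (nat \<Rightarrow> 'm::finite)) pmf"
  shows "simplex_rows n (row_marginal Q)" "simplex_rows d (col_marginal Q)"
proof -
  have "(\<Sum>k\<in>UNIV. row_marginal Q i k) = measure_pmf.prob Q (\<Union>k\<in>UNIV. {(z, w). z i = k})" for i
    unfolding row_marginal_def
    by (intro measure_pmf.finite_measure_finite_Union[symmetric]) (auto simp: disjoint_family_on_def)
  moreover have "(\<Union>k\<in>UNIV. {(z, w). z i = k}) = (UNIV :: ((nat \<Rightarrow> 'g) \<times> (nat \<Rightarrow> 'm)) set)" for i by auto
  ultimately show "simplex_rows n (row_marginal Q)"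
    by (simp add: simplex_rows_def row_marginal_def)
  have "(\<Sum>l\<in>UNIV. col_marginal Q j l) = measure_pmf.prob Q (\<Union>l\<in>UNIV. {(z, w). w j = l})" for j
    unfolding col_marginal_def
    by (intro measure_pmf.finite_measure_finite_Union[symmetric]) (auto simp: disjoint_family_on_def)
  moreover have "(\<Union>l\<in>UNIV. {(z, w). w j = l}) = (UNIV :: ((nat \<Rightarrow> 'g) \<times> (nat \<Rightarrow> 'm)) set)" for j by auto
  ultimately show "simplex_rows d (col_marginal Q)"
    by (simp add: simplex_rows_def col_marginal_def)
qed

lemma factorizedD:
  assumes "Q \<in> factorized n d"
  shows "set_pmf Q \<subseteq> assignments n \<times> assignments d"
    and "z \<in> assignments n \<Longrightarrow> w \<in> assignments d \<Longrightarrow>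
      pmf Q (z, w) = (\<Prod>i<n. row_marginal Q i (z i)) * (\<Prod>j<d. col_marginal Q j (w j))"
proof -
  show "set_pmf Q \<subseteq> assignments n \<times> assignments d" using assms by (simp add: factorized_def)
  assume zw: "z \<in> assignments n" "w \<in> assignments d"
  have "pmf Q (z, w) =
        (\<Prod>i<n. \<Prod>k\<in>UNIV. measure_pmf.prob Q {(z', w'). asg z' i k = 1} ^ asg z i k) *
        (\<Prod>j<d. \<Prod>l\<in>UNIV. measure_pmf.prob Q {(z', w'). asg w' j l = 1} ^ asg w j l)"
    using assms zw by (simp add: factorized_def)
  then show "pmf Q (z, w) = (\<Prod>i<n. row_marginal Q i (z i)) * (\<Prod>j<d. col_marginal Q j (w j))"
    unfolding prod_power_asg asg_eq_1_iff row_marginal_def col_marginal_def .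
qed

lemma ln_complete_lik:
  assumes pos: "\<And>k. \<pi> $ k > 0" "\<And>l. \<rho> $ l > 0" "\<And>i j. i < n \<Longrightarrow> j < d \<Longrightarrow> b (x (i, j)) > 0"
  shows "ln (complete_lik b \<psi> n d x z w (\<pi>, \<rho>, \<alpha>)) =
    (\<Sum>i<n. ln (\<pi> $ z i)) + (\<Sum>j<d. ln (\<rho> $ w j)) + (\<Sum>i<n. \<Sum>j<d. ln (b (x (i, j))) + lin \<psi> (\<alpha> $ z i $ w j) (x (i, j)))"
proof -
  have inner: "(\<Prod>k\<in>UNIV. \<Prod>l\<in>UNIV. phi b \<psi> (x (i, j)) (\<alpha> $ k $ l) ^ (asg z i k * asg w j l))
      = phi b \<psi> (x (i, j)) (\<alpha> $ z i $ w j)" for i j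
  proof -
    have "(\<Prod>l\<in>UNIV. phi b \<psi> (x (i, j)) (\<alpha> $ k $ l) ^ (asg z i k * asg w j l))
      = (\<Prod>l\<in>UNIV. phi b \<psi> (x (i, j)) (\<alpha> $ k $ l) ^ asg w j l) ^ asg z i k" for k
      by (simp add: prod_power_distrib power_mult[symmetric] mult.commute)
    then show ?thesis by (simp add: prod_power_asg)
  qed
  have pp: "phi b \<psi> (x (i, j)) a > 0" "ln (phi b \<psi> (x (i, j)) a) = ln (b (x (i, j))) + lin \<psi> a (x (i, j))"
    if "i < n" "j < d" for i j a
    using pos(3)[OF that] by (auto simp: phi_def ln_mult lin_def)
  have "complete_lik b \<psi> n d x z w (\<pi>, \<rho>, \<alpha>) =
     (\<Prod>i<n. \<pi> $ z i) * (\<Prod>j<d. \<rho> $ w j) * (\<Prod>i<n. \<Prod>j<d. phi b \<psi> (x (i, j)) (\<alpha> $ z i $ w j))"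
    unfolding complete_lik_def by (simp add: prod_power_asg inner)
  moreover have "(\<Prod>i<n. \<pi> $ z i) > 0" "(\<Prod>j<d. \<rho> $ w j) > 0"
      "(\<Prod>i<n. \<Prod>j<d. phi b \<psi> (x (i, j)) (\<alpha> $ z i $ w j)) > 0"
    using pos pp by (auto intro!: prod_pos)
  moreover have "ln (p * q * r) = ln p + ln q + ln r" if "p > 0" "q > 0" "r > 0" for p q r :: real
    using that by (simp add: ln_mult)
  ultimately have "ln (complete_lik b \<psi> n d x z w (\<pi>, \<rho>, \<alpha>)) =
     ln (\<Prod>i<n. \<pi> $ z i) + ln (\<Prod>j<d. \<rho> $ w j) + ln (\<Prod>i<n. \<Prod>j<d. phi b \<psi> (x (i, j)) (\<alpha> $ z i $ w j))"
    by presburger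
  also have "ln (\<Prod>i<n. \<pi> $ z i) = (\<Sum>i<n. ln (\<pi> $ z i))"
    using pos by (intro ln_prod) (auto simp: less_imp_neq[symmetric])
  also have "ln (\<Prod>j<d. \<rho> $ w j) = (\<Sum>j<d. ln (\<rho> $ w j))"
    using pos by (intro ln_prod) (auto simp: less_imp_neq[symmetric])
  also have "ln (\<Prod>i<n. \<Prod>j<d. phi b \<psi> (x (i, j)) (\<alpha> $ z i $ w j)) = (\<Sum>i<n. ln (\<Prod>j<d. phi b \<psi> (x (i, j)) (\<alpha> $ z i $ w j)))"
    using pp(1) by (intro ln_prod) (auto intro!: prod_pos less_imp_neq[symmetric])
  also have "\<dots> = (\<Sum>i<n. \<Sum>j<d. ln (b (x (i, j))) + lin \<psi> (\<alpha> $ z i $ w j) (x (i, j)))"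
  proof (intro sum.cong refl)
    fix i assume i: "i \<in> {..<n}"
    have "ln (\<Prod>j<d. phi b \<psi> (x (i, j)) (\<alpha> $ z i $ w j)) = (\<Sum>j<d. ln (phi b \<psi> (x (i, j)) (\<alpha> $ z i $ w j)))"
      using pp(1) i by (intro ln_prod) (auto intro!: less_imp_neq[symmetric])
    also have "\<dots> = (\<Sum>j<d. ln (b (x (i, j))) + lin \<psi> (\<alpha> $ z i $ w j) (x (i, j)))"
      using pp(2) i by (intro sum.cong) auto
    finally show "ln (\<Prod>j<d. phi b \<psi> (x (i, j)) (\<alpha> $ z i $ w j)) = \<dots>" .
  qed
  finally show ?thesis .
qed

text \<open>By linearity only one or two coordinates matter at a time. A row and a column coordinate
  are independent under a factorized distribution, so each cell contributes a bilinear form in the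
  marginals.\<close>

lemma expectation_factorized:
  fixes Q :: "((nat \<Rightarrow> 'g::finite) \<times> (nat \<Rightarrow> 'm::finite)) pmf"
  assumes Q: "Q \<in> factorized n d"
  shows "measure_pmf.expectation Q (\<lambda>(z, w). (\<Sum>i<n. u i (z i)) + (\<Sum>j<d. v j (w j)) + (\<Sum>i<n. \<Sum>j<d. h i j (z i) (w j))) =
    (\<Sum>i<n. \<Sum>k\<in>UNIV. row_marginal Q i k * u i k) + (\<Sum>j<d. \<Sum>l\<in>UNIV. col_marginal Q j l * v j l) +
    (\<Sum>i<n. \<Sum>j<d. \<Sum>k\<in>UNIV. \<Sum>l\<in>UNIV. row_marginal Q i k * col_marginal Q j l * h i j k l)"
proof -
  let ?Z = "assignments n :: (nat \<Rightarrow> 'g) set" and ?W = "assignments d :: (nat \<Rightarrow> 'm) set"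
  define W where "W z = (\<Prod>i<n. row_marginal Q i (z i))" for z
  define V where "V w = (\<Prod>j<d. col_marginal Q j (w j))" for w
  have fin: "finite (set_pmf Q)"
    using factorizedD(1)[OF Q] by (rule finite_subset) simp
  have E: "measure_pmf.expectation Q f = (\<Sum>z\<in>?Z. \<Sum>w\<in>?W. f (z, w) * (W z * V w))" for f :: "_ \<Rightarrow> real"
  proof -
    have "measure_pmf.expectation Q f = (\<Sum>a\<in>?Z \<times> ?W. f a * pmf Q a)"
      using factorizedD(1)[OF Q] by (intro integral_measure_pmf_real) auto
    also have "\<dots> = (\<Sum>z\<in>?Z. \<Sum>w\<in>?W. f (z, w) * pmf Q (z, w))"
      by (simp add: sum.cartesian_product)
    also have "\<dots> = (\<Sum>z\<in>?Z. \<Sum>w\<in>?W. f (z, w) * (W z * V w))"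
      by (intro sum.cong refl) (simp add: factorizedD(2)[OF Q] W_def V_def)
    finally show ?thesis .
  qed
  have sW: "(\<Sum>z\<in>?Z. W z) = 1" and sV: "(\<Sum>w\<in>?W. V w) = 1"
    unfolding W_def V_def by (rule sum_weight simplex_rows_marginal)+
  have cW: "(\<Sum>z\<in>?Z. f (z i) * W z) = (\<Sum>k\<in>UNIV. row_marginal Q i k * f k)" if "i < n" for i f
    unfolding W_def by (rule sum_weight_coordinate[OF simplex_rows_marginal(1) that])
  have cV: "(\<Sum>w\<in>?W. f (w j) * V w) = (\<Sum>l\<in>UNIV. col_marginal Q j l * f l)" if "j < d" for j f
    unfolding V_def by (rule sum_weight_coordinate[OF simplex_rows_marginal(2) that])
  have Eu: "measure_pmf.expectation Q (\<lambda>(z, w). u i (z i)) = (\<Sum>k\<in>UNIV. row_marginal Q i k * u i k)" if "i < n" for i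
  proof -
    have "measure_pmf.expectation Q (\<lambda>(z, w). u i (z i)) = (\<Sum>z\<in>?Z. u i (z i) * W z * (\<Sum>w\<in>?W. V w))"
      unfolding E by (simp add: sum_distrib_left mult.assoc)
    then show ?thesis using cW[OF that, of "u i"] by (simp add: sV)
  qed
  have Ev: "measure_pmf.expectation Q (\<lambda>(z, w). v j (w j)) = (\<Sum>l\<in>UNIV. col_marginal Q j l * v j l)" if "j < d" for j
  proof -
    have "measure_pmf.expectation Q (\<lambda>(z, w). v j (w j)) = (\<Sum>z\<in>?Z. W z * (\<Sum>w\<in>?W. v j (w j) * V w))"
      unfolding E by (simp add: sum_distrib_left mult.left_commute)
    then show ?thesis using cV[OF that, of "v j"] by (simp add: sum_distrib_right[symmetric] sW)
  qed
  have Eh: "measure_pmf.expectation Q (\<lambda>(z, w). h i j (z i) (w j))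
      = (\<Sum>k\<in>UNIV. \<Sum>l\<in>UNIV. row_marginal Q i k * col_marginal Q j l * h i j k l)" if "i < n" "j < d" for i j
  proof -
    have "measure_pmf.expectation Q (\<lambda>(z, w). h i j (z i) (w j)) = (\<Sum>z\<in>?Z. (\<Sum>w\<in>?W. h i j (z i) (w j) * V w) * W z)"
      unfolding E sum_distrib_right by (intro sum.cong refl) (simp add: mult_ac)
    also have "\<dots> = (\<Sum>z\<in>?Z. (\<Sum>l\<in>UNIV. col_marginal Q j l * h i j (z i) l) * W z)"
      using cV[OF that(2)] by (intro sum.cong refl) (simp add: cV[OF that(2), of "h i j _"])
    also have "\<dots> = (\<Sum>k\<in>UNIV. row_marginal Q i k * (\<Sum>l\<in>UNIV. col_marginal Q j l * h i j k l))"
      by (rule cW[OF that(1)])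
    finally show ?thesis by (simp add: sum_distrib_left mult.assoc)
  qed
  note int = integrable_measure_pmf_finite[OF fin]
  have "measure_pmf.expectation Q (\<lambda>(z, w). (\<Sum>i<n. u i (z i)) + (\<Sum>j<d. v j (w j)) + (\<Sum>i<n. \<Sum>j<d. h i j (z i) (w j)))
    = (\<Sum>i<n. measure_pmf.expectation Q (\<lambda>(z, w). u i (z i))) + (\<Sum>j<d. measure_pmf.expectation Q (\<lambda>(z, w). v j (w j)))
      + (\<Sum>i<n. \<Sum>j<d. measure_pmf.expectation Q (\<lambda>(z, w). h i j (z i) (w j)))"
    by (simp add: split_def Bochner_Integration.integral_add Bochner_Integration.integral_sum int)
  then show ?thesis by (simp add: Eu Ev Eh)
qed

text \<open>On the support of \<open>Q\<close> all the marginals involved are nonzero, so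
  \<open>ln (pmf Q a)\<close> splits into a sum; outside the support the integrand is irrelevant.
  What remains is the expectation of a function to which \<open>expectation_factorized\<close>
  applies.\<close>

lemma J_eq_variational_objective:
  fixes Q :: "((nat \<Rightarrow> 'g::finite) \<times> (nat \<Rightarrow> 'm::finite)) pmf"
  assumes Q: "Q \<in> factorized n d"
    and pos: "\<And>k. \<pi> $ k > 0" "\<And>l. \<rho> $ l > 0" "\<And>i j. i < n \<Longrightarrow> j < d \<Longrightarrow> b (x (i, j)) > 0"
  shows "J b \<psi> n d x Q (\<pi>, \<rho>, \<alpha>) =
    variational_objective \<psi> n d x (row_marginal Q) (col_marginal Q) (($) \<pi>) (($) \<rho>) (\<lambda>k l. \<alpha> $ k $ l)
    + (\<Sum>i<n. \<Sum>j<d. ln (b (x (i, j))))"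
proof -
  have fin: "finite (set_pmf Q)"
    using factorizedD(1)[OF Q] by (rule finite_subset) simp
  note int = integrable_measure_pmf_finite[OF fin]
  have "J b \<psi> n d x Q (\<pi>, \<rho>, \<alpha>) = measure_pmf.expectation Q
      (\<lambda>a. ln (complete_lik b \<psi> n d x (fst a) (snd a) (\<pi>, \<rho>, \<alpha>)) - ln (pmf Q a))"
    unfolding J_def pmf_entropy_def by (simp add: int split_def)
  also have "\<dots> = measure_pmf.expectation Q (\<lambda>(z, w).
      (\<Sum>i<n. ln (\<pi> $ z i) - ln (row_marginal Q i (z i))) + (\<Sum>j<d. ln (\<rho> $ w j) - ln (col_marginal Q j (w j)))
      + (\<Sum>i<n. \<Sum>j<d. ln (b (x (i, j))) + lin \<psi> (\<alpha> $ z i $ w j) (x (i, j))))"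
  proof (rule Bochner_Integration.integral_cong_AE)
    show "AE a in measure_pmf Q. ln (complete_lik b \<psi> n d x (fst a) (snd a) (\<pi>, \<rho>, \<alpha>)) - ln (pmf Q a) =
      (case a of (z, w) \<Rightarrow>
      (\<Sum>i<n. ln (\<pi> $ z i) - ln (row_marginal Q i (z i))) + (\<Sum>j<d. ln (\<rho> $ w j) - ln (col_marginal Q j (w j)))
      + (\<Sum>i<n. \<Sum>j<d. ln (b (x (i, j))) + lin \<psi> (\<alpha> $ z i $ w j) (x (i, j))))"
    proof (subst AE_measure_pmf_iff, rule ballI)
      fix a assume a: "a \<in> set_pmf Q"
      obtain z w where zw: "a = (z, w)" by force
      have "z \<in> assignments n" "w \<in> assignments d" using a zw factorizedD(1)[OF Q] by auto
      then have eq: "pmf Q (z, w) = (\<Prod>i<n. row_marginal Q i (z i)) * (\<Prod>j<d. col_marginal Q j (w j))"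
        by (rule factorizedD(2)[OF Q])
      have "pmf Q (z, w) \<noteq> 0" using a zw by (simp add: set_pmf_iff)
      then have ne: "(\<Prod>i<n. row_marginal Q i (z i)) \<noteq> 0" "(\<Prod>j<d. col_marginal Q j (w j)) \<noteq> 0"
        using eq by auto
      then have "ln (pmf Q (z, w)) = (\<Sum>i<n. ln (row_marginal Q i (z i))) + (\<Sum>j<d. ln (col_marginal Q j (w j)))"
        using ln_prod[of "{..<n}" "\<lambda>i. row_marginal Q i (z i)"] ln_prod[of "{..<d}" "\<lambda>j. col_marginal Q j (w j)"]
        unfolding eq by (simp add: ln_mult)
      moreover have lik: "ln (complete_lik b \<psi> n d x z w (\<pi>, \<rho>, \<alpha>)) =
          (\<Sum>i<n. ln (\<pi> $ z i)) + (\<Sum>j<d. ln (\<rho> $ w j)) + (\<Sum>i<n. \<Sum>j<d. ln (b (x (i, j))) + lin \<psi> (\<alpha> $ z i $ w j) (x (i, j)))"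
        by (rule ln_complete_lik) (use pos in auto)
      ultimately show "ln (complete_lik b \<psi> n d x (fst a) (snd a) (\<pi>, \<rho>, \<alpha>)) - ln (pmf Q a) =
        (case a of (z, w) \<Rightarrow>
        (\<Sum>i<n. ln (\<pi> $ z i) - ln (row_marginal Q i (z i))) + (\<Sum>j<d. ln (\<rho> $ w j) - ln (col_marginal Q j (w j)))
        + (\<Sum>i<n. \<Sum>j<d. ln (b (x (i, j))) + lin \<psi> (\<alpha> $ z i $ w j) (x (i, j))))"
        unfolding zw using lik by (simp add: sum_subtractf)
    qed
  qed auto
  also have "\<dots> = (\<Sum>i<n. \<Sum>k\<in>UNIV. row_marginal Q i k * (ln (\<pi> $ k) - ln (row_marginal Q i k)))
      + (\<Sum>j<d. \<Sum>l\<in>UNIV. col_marginal Q j l * (ln (\<rho> $ l) - ln (col_marginal Q j l)))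
      + (\<Sum>i<n. \<Sum>j<d. \<Sum>k\<in>UNIV. \<Sum>l\<in>UNIV. row_marginal Q i k * col_marginal Q j l *
          (ln (b (x (i, j))) + lin \<psi> (\<alpha> $ k $ l) (x (i, j))))"
    by (rule expectation_factorized[OF Q])
  also have "(\<Sum>i<n. \<Sum>j<d. \<Sum>k\<in>UNIV. \<Sum>l\<in>UNIV. row_marginal Q i k * col_marginal Q j l *
          (ln (b (x (i, j))) + lin \<psi> (\<alpha> $ k $ l) (x (i, j))))
     = (\<Sum>i<n. \<Sum>j<d. ln (b (x (i, j)))) +
       (\<Sum>i<n. \<Sum>j<d. \<Sum>k\<in>UNIV. \<Sum>l\<in>UNIV. row_marginal Q i k * col_marginal Q j l * lin \<psi> (\<alpha> $ k $ l) (x (i, j)))"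
  proof -
    \<comment> \<open>The marginals sum to 1 at every index; \<open>Suc i\<close> and
      \<open>Suc j\<close> are merely lengths large enough to reach \<open>i\<close> and
      \<open>j\<close>.\<close>
    have "(\<Sum>k\<in>UNIV. \<Sum>l\<in>UNIV. row_marginal Q i k * col_marginal Q j l * q) = q" for i j q
      using simplex_rowsD(3)[OF simplex_rows_marginal(1)[of "Suc i" Q], of i]
        simplex_rowsD(3)[OF simplex_rows_marginal(2)[of "Suc j" Q], of j]
      by (simp add: sum_distrib_left[symmetric] sum_distrib_right[symmetric])
    then show ?thesis by (simp add: distrib_left sum.distrib)
  qed
  finally show ?thesis by (simp add: variational_objective_def)
qed

text \<open>Assignments are extensional, so agreement on the first \<open>n\<close> coordinates is
  equality.\<close>

lemma prod_ind:
  assumes "z' \<in> assignments n" "z \<in> assignments n"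
  shows "(\<Prod>i<n. ind z i (z' i)) = of_bool (z' = z)"
proof (cases "z' = z")
  case False
  have "\<exists>i<n. z' i \<noteq> z i"
  proof (rule ccontr)
    assume "\<not> ?thesis"
    then have "z' = z"
      using assms unfolding assignments_def by (intro PiE_ext[of z' "{..<n}" "\<lambda>_. UNIV"]) auto
    with False show False ..
  qed
  then obtain i where "i < n" "z' i \<noteq> z i" by blast
  then have "(\<Prod>i<n. ind z i (z' i)) = 0" by (intro prod_zero) (auto simp: ind_def intro!: bexI[of _ i])
  then show ?thesis using False by simp
qed (simp add: ind_def)

text \<open>Point masses are admissible in the variational problem. They have zero entropy, so the
  supremum over \<open>Q\<close> dominates every complete log-likelihood.\<close>

lemma return_pmf_factorized:
  fixes z :: "nat \<Rightarrow> 'g::finite" and w :: "nat \<Rightarrow> 'm::finite"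
  assumes zw: "z \<in> assignments n" "w \<in> assignments d"
  shows "return_pmf (z, w) \<in> factorized n d"
    and "row_marginal (return_pmf (z, w)) = ind z" "col_marginal (return_pmf (z, w)) = ind w"
proof -
  show m: "row_marginal (return_pmf (z, w)) = ind z" "col_marginal (return_pmf (z, w)) = ind w"
    by (auto simp: fun_eq_iff row_marginal_def col_marginal_def ind_def indicator_def)
  have "pmf (return_pmf (z, w)) (z', w') =
        (\<Prod>i<n. \<Prod>k\<in>UNIV. measure_pmf.prob (return_pmf (z, w)) {(z', w'). asg z' i k = 1} ^ asg z' i k) *
        (\<Prod>j<d. \<Prod>l\<in>UNIV. measure_pmf.prob (return_pmf (z, w)) {(z', w'). asg w' j l = 1} ^ asg w' j l)"
    if "z' \<in> assignments n" "w' \<in> assignments d" for z' w'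
    unfolding prod_power_asg asg_eq_1_iff row_marginal_def[symmetric] col_marginal_def[symmetric] m
    using prod_ind[OF that(1) zw(1)] prod_ind[OF that(2) zw(2)] by (auto simp: indicator_def)
  then show "return_pmf (z, w) \<in> factorized n d"
    using zw by (simp add: factorized_def)
qed

lemma variational_objective_ind:
  "variational_objective \<psi> n d x (ind z) (ind w) \<pi> \<rho> \<alpha> = complete_loglik \<psi> n d x z w \<pi> \<rho> \<alpha>"
proof -
  have "(\<Sum>k\<in>UNIV. \<Sum>l\<in>UNIV. ind z i k * ind w j l * q k l) = q (z i) (w j)" for i j q
    by (simp add: mult.assoc sum_distrib_left[symmetric])
  then show ?thesis
    by (simp add: variational_objective_def complete_loglik_def)
qed

section \<open>Exponential deviation bounds\<close>

lemma PiM_sum_measurable: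
  fixes f :: "'i \<Rightarrow> 'a \<Rightarrow> real"
  assumes "S \<subseteq> I" "\<And>i. f i \<in> borel_measurable (M i)"
  shows "(\<lambda>x. \<Sum>i\<in>S. f i (x i)) \<in> borel_measurable (PiM I M)"
proof (rule borel_measurable_sum)
  fix i assume "i \<in> S"
  then have "(\<lambda>x. x i) \<in> measurable (PiM I M) (M i)"
    using assms(1) by (intro measurable_component_singleton) auto
  then show "(\<lambda>x. f i (x i)) \<in> borel_measurable (PiM I M)"
    by (rule measurable_compose) (rule assms(2))
qed

text \<open>Chernoff's method: Markov's inequality for the exponential, which factorises over
  independent coordinates; those outside \<open>S\<close> contribute the factor 1.\<close>

lemma measure_PiM_exp_bound:
  fixes f :: "'i \<Rightarrow> 'a \<Rightarrow> real"
  assumes prob: "\<And>i. prob_space (M i)" and I: "finite I" "S \<subseteq> I"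
    and f [measurable]: "\<And>i. f i \<in> borel_measurable (M i)"
    and mgf: "\<And>i. i \<in> S \<Longrightarrow> (\<integral>\<^sup>+x. ennreal (exp (r * f i x)) \<partial>M i) \<le> ennreal (exp (a i))"
    and r: "r > 0"
  shows "measure (PiM I M) {x \<in> space (PiM I M). t \<le> (\<Sum>i\<in>S. f i (x i))} \<le> exp ((\<Sum>i\<in>S. a i) - r * t)"
proof -
  interpret product_prob_space M
    by (simp add: product_prob_space_def product_prob_space_axioms_def product_sigma_finite_def prob prob_space_imp_sigma_finite)
  interpret P: prob_space "PiM I M" by (rule prob_space_PiM) (rule prob)
  have S: "finite S" using I finite_subset by blast
  have [measurable]: "(\<lambda>x. \<Sum>i\<in>S. f i (x i)) \<in> borel_measurable (PiM I M)"
    using PiM_sum_measurable[of S I f M] I(2) f by simp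
  have "emeasure (PiM I M) {x \<in> space (PiM I M). t \<le> (\<Sum>i\<in>S. f i (x i))}
      \<le> ennreal (exp (- r * t)) * (\<integral>\<^sup>+x. ennreal (exp (r * (\<Sum>i\<in>S. f i (x i)))) * indicator (space (PiM I M)) x \<partial>PiM I M)"
    by (rule Chernoff_ineq_nn_integral_ge) (use r in auto)
  also have "(\<integral>\<^sup>+x. ennreal (exp (r * (\<Sum>i\<in>S. f i (x i)))) * indicator (space (PiM I M)) x \<partial>PiM I M)
      = (\<integral>\<^sup>+x. (\<Prod>i\<in>I. (if i \<in> S then ennreal (exp (r * f i (x i))) else 1)) \<partial>PiM I M)"
  proof (rule nn_integral_cong)
    fix x assume "x \<in> space (PiM I M)"
    have "(\<Prod>i\<in>I. (if i \<in> S then ennreal (exp (r * f i (x i))) else 1)) = (\<Prod>i\<in>S. ennreal (exp (r * f i (x i))))"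
      using I by (simp add: prod.If_cases Int_absorb1)
    also have "\<dots> = ennreal (exp (r * (\<Sum>i\<in>S. f i (x i))))"
      using S by (simp add: prod_ennreal exp_sum sum_distrib_left)
    finally show "ennreal (exp (r * (\<Sum>i\<in>S. f i (x i)))) * indicator (space (PiM I M)) x
      = (\<Prod>i\<in>I. (if i \<in> S then ennreal (exp (r * f i (x i))) else 1))"
      using \<open>x \<in> _\<close> by simp
  qed
  also have "\<dots> = (\<Prod>i\<in>I. \<integral>\<^sup>+x. (if i \<in> S then ennreal (exp (r * f i x)) else 1) \<partial>M i)"
    by (rule product_nn_integral_prod[OF I(1)]) simp
  also have "\<dots> \<le> (\<Prod>i\<in>I. ennreal (exp (if i \<in> S then a i else 0)))"
  proof (rule prod_mono_ennreal)
    fix i assume "i \<in> I"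
    show "(\<integral>\<^sup>+x. (if i \<in> S then ennreal (exp (r * f i x)) else 1) \<partial>M i) \<le> ennreal (exp (if i \<in> S then a i else 0))"
      using mgf[of i] prob_space.emeasure_space_1[OF prob, of i] by (cases "i \<in> S") auto
  qed
  also have "\<dots> = ennreal (exp (\<Sum>i\<in>I. if i \<in> S then a i else 0))"
    using I by (simp add: prod_ennreal exp_sum)
  also have "(\<Sum>i\<in>I. if i \<in> S then a i else 0) = (\<Sum>i\<in>S. a i)"
    using I by (simp add: sum.If_cases Int_absorb1)
  finally have "emeasure (PiM I M) {x \<in> space (PiM I M). t \<le> (\<Sum>i\<in>S. f i (x i))}
      \<le> ennreal (exp (- r * t)) * ennreal (exp (\<Sum>i\<in>S. a i))"
    by (simp add: mult_left_mono)
  also have "\<dots> = ennreal (exp ((\<Sum>i\<in>S. a i) - r * t))"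
    by (simp add: ennreal_mult[symmetric] exp_add[symmetric])
  finally show ?thesis by (simp add: P.emeasure_eq_measure)
qed

text \<open>The exponent obtained from \<open>r = min h (\<epsilon> / (2 * K))\<close>, the
  minimiser of \<open>K * r\<^sup>2 - r * \<epsilon>\<close> under \<open>r \<le> h\<close>; there
  this expression is at most \<open>- r * \<epsilon> / 2\<close>.\<close>

definition chernoff_rate :: "real \<Rightarrow> real \<Rightarrow> real \<Rightarrow> real" where
  "chernoff_rate K h \<epsilon> = min h (\<epsilon> / (2 * K)) * \<epsilon> / 2"

lemma chernoff_rate_pos: "K > 0 \<Longrightarrow> h > 0 \<Longrightarrow> \<epsilon> > 0 \<Longrightarrow> chernoff_rate K h \<epsilon> > 0"
  by (simp add: chernoff_rate_def)

text \<open>The scale \<open>m\<close> may exceed the number of summands. Sums over classes of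
  varying size can thus be measured against the deterministic scales \<open>n\<close>,
  \<open>d\<close> and \<open>n * d\<close>.\<close>

lemma measure_PiM_deviation:
  fixes f :: "'i \<Rightarrow> 'a \<Rightarrow> real"
  assumes prob: "\<And>i. prob_space (M i)" and I: "finite I" "S \<subseteq> I"
    and f [measurable]: "\<And>i. f i \<in> borel_measurable (M i)"
    and mgf: "\<And>i t. i \<in> S \<Longrightarrow> \<bar>t\<bar> \<le> h \<Longrightarrow> (\<integral>\<^sup>+x. ennreal (exp (t * f i x)) \<partial>M i) \<le> ennreal (exp (K * t\<^sup>2))"
    and pos: "K > 0" "h > 0" "\<epsilon> > 0" and m: "real (card S) \<le> m"
  shows "measure (PiM I M) {x \<in> space (PiM I M). \<epsilon> * m < \<bar>\<Sum>i\<in>S. f i (x i)\<bar>} \<le> 2 * exp (- chernoff_rate K h \<epsilon> * m)"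
proof -
  interpret P: prob_space "PiM I M" by (rule prob_space_PiM) (rule prob)
  have [measurable]: "(\<lambda>x. \<Sum>i\<in>S. f i (x i)) \<in> borel_measurable (PiM I M)"
    using PiM_sum_measurable[of S I f M] I(2) f by simp
  define r where "r = min h (\<epsilon> / (2 * K))"
  have r: "r > 0" "r \<le> h" "r \<le> \<epsilon> / (2 * K)" using pos by (auto simp: r_def)
  have cr: "chernoff_rate K h \<epsilon> = r * \<epsilon> / 2"
    by (simp add: chernoff_rate_def r_def)
  have "K * r\<^sup>2 \<le> r * \<epsilon> / 2"
  proof -
    have "K * r\<^sup>2 = r * (K * r)" by (simp add: power2_eq_square)
    also have "\<dots> \<le> r * (\<epsilon> / 2)" using r pos by (intro mult_left_mono) (auto simp: field_simps)
    finally show ?thesis by simp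
  qed
  then have "m * (K * r\<^sup>2) \<le> m * (r * \<epsilon> / 2)"
    using m by (intro mult_left_mono) auto
  moreover have "real (card S) * (K * r\<^sup>2) \<le> m * (K * r\<^sup>2)"
    using m pos by (intro mult_right_mono) auto
  ultimately have expo: "(\<Sum>i\<in>S. K * r\<^sup>2) - r * (\<epsilon> * m) \<le> - chernoff_rate K h \<epsilon> * m"
    unfolding cr by (simp add: algebra_simps)
  have up: "measure (PiM I M) {x \<in> space (PiM I M). \<epsilon> * m \<le> (\<Sum>i\<in>S. f i (x i))} \<le> exp (- chernoff_rate K h \<epsilon> * m)"
    by (rule order_trans[OF measure_PiM_exp_bound[where r = r and a = "\<lambda>_. K * r\<^sup>2"]])
       (use prob I f r expo in \<open>auto intro!: mgf\<close>)
  have lo: "measure (PiM I M) {x \<in> space (PiM I M). \<epsilon> * m \<le> (\<Sum>i\<in>S. - f i (x i))} \<le> exp (- chernoff_rate K h \<epsilon> * m)"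
  proof (rule order_trans[OF measure_PiM_exp_bound[where r = r and a = "\<lambda>_. K * r\<^sup>2" and f = "\<lambda>i x. - f i x"]])
    show "(\<integral>\<^sup>+x. ennreal (exp (r * - f i x)) \<partial>M i) \<le> ennreal (exp (K * r\<^sup>2))" if "i \<in> S" for i
      using mgf[OF that, of "- r"] r by simp
  qed (use prob I r expo in auto)
  have "measure (PiM I M) {x \<in> space (PiM I M). \<epsilon> * m < \<bar>\<Sum>i\<in>S. f i (x i)\<bar>}
    \<le> measure (PiM I M) ({x \<in> space (PiM I M). \<epsilon> * m \<le> (\<Sum>i\<in>S. f i (x i))} \<union> {x \<in> space (PiM I M). \<epsilon> * m \<le> (\<Sum>i\<in>S. - f i (x i))})"
    by (intro P.finite_measure_mono) (auto simp: sum_negf)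
  also have "\<dots> \<le> measure (PiM I M) {x \<in> space (PiM I M). \<epsilon> * m \<le> (\<Sum>i\<in>S. f i (x i))} + measure (PiM I M) {x \<in> space (PiM I M). \<epsilon> * m \<le> (\<Sum>i\<in>S. - f i (x i))}"
    by (intro measure_Un_le) (auto simp: sum_negf)
  finally show ?thesis using up lo by simp
qed

text \<open>Bilinear forms on cubes attain their extrema at vertices.\<close>

lemma bilinear_le_subset_sum:
  fixes y :: "nat \<Rightarrow> nat \<Rightarrow> real"
  assumes u: "\<And>i. i < n \<Longrightarrow> 0 \<le> u i \<and> u i \<le> 1" and v: "\<And>j. j < d \<Longrightarrow> 0 \<le> v j \<and> v j \<le> 1"
  obtains I I' where "I \<subseteq> {..<n}" "I' \<subseteq> {..<d}" "(\<Sum>i<n. \<Sum>j<d. u i * v j * y i j) \<le> (\<Sum>i\<in>I. \<Sum>j\<in>I'. y i j)"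
proof -
  define a where "a i = (\<Sum>j<d. v j * y i j)" for i
  define I where "I = {i \<in> {..<n}. a i > 0}"
  define b where "b j = (\<Sum>i\<in>I. y i j)" for j
  define I' where "I' = {j \<in> {..<d}. b j > 0}"
  have "(\<Sum>i<n. \<Sum>j<d. u i * v j * y i j) = (\<Sum>i<n. u i * a i)"
    by (simp add: a_def sum_distrib_left mult.assoc)
  also have "\<dots> \<le> (\<Sum>i<n. if a i > 0 then a i else 0)"
    using u by (intro sum_mono) (auto intro: mult_left_le_one_le mult_nonneg_nonpos)
  also have "\<dots> = (\<Sum>i\<in>I. a i)"
    unfolding I_def by (rule sum.inter_filter[symmetric]) simp
  also have "\<dots> = (\<Sum>j<d. v j * b j)"
    unfolding a_def b_def sum_distrib_left by (rule sum.swap)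
  also have "\<dots> \<le> (\<Sum>j<d. if b j > 0 then b j else 0)"
    using v by (intro sum_mono) (auto intro: mult_left_le_one_le mult_nonneg_nonpos)
  also have "\<dots> = (\<Sum>j\<in>I'. b j)"
    unfolding I'_def by (rule sum.inter_filter[symmetric]) simp
  also have "\<dots> = (\<Sum>i\<in>I. \<Sum>j\<in>I'. y i j)"
    unfolding b_def by (rule sum.swap)
  finally have le: "(\<Sum>i<n. \<Sum>j<d. u i * v j * y i j) \<le> (\<Sum>i\<in>I. \<Sum>j\<in>I'. y i j)" .
  have I: "I \<subseteq> {..<n}" "I' \<subseteq> {..<d}" by (auto simp: I_def I'_def)
  show thesis by (rule that[OF I le])
qed

text \<open>Reduces uniformity over a continuum of weights to finitely many rectangles. The lower
  estimate is the upper one for \<open>- y\<close>.\<close>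

lemma bilinear_noise_bound:
  fixes y :: "nat \<Rightarrow> nat \<Rightarrow> real"
  assumes sub: "\<And>I I'. I \<subseteq> {..<n} \<Longrightarrow> I' \<subseteq> {..<d} \<Longrightarrow> \<bar>\<Sum>i\<in>I. \<Sum>j\<in>I'. y i j\<bar> \<le> B"
    and u: "\<And>i. i < n \<Longrightarrow> 0 \<le> u i \<and> u i \<le> 1" and v: "\<And>j. j < d \<Longrightarrow> 0 \<le> v j \<and> v j \<le> 1"
  shows "\<bar>\<Sum>i<n. \<Sum>j<d. u i * v j * y i j\<bar> \<le> B"
proof -
  obtain I I' where I: "I \<subseteq> {..<n}" "I' \<subseteq> {..<d}" "(\<Sum>i<n. \<Sum>j<d. u i * v j * y i j) \<le> (\<Sum>i\<in>I. \<Sum>j\<in>I'. y i j)"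
    by (rule bilinear_le_subset_sum[where n = n and d = d and u = u and v = v and y = y]) (use u v in auto)
  obtain L L' where L: "L \<subseteq> {..<n}" "L' \<subseteq> {..<d}" "(\<Sum>i<n. \<Sum>j<d. u i * v j * - y i j) \<le> (\<Sum>i\<in>L. \<Sum>j\<in>L'. - y i j)"
    by (rule bilinear_le_subset_sum[where n = n and d = d and u = u and v = v and y = "\<lambda>i j. - y i j"]) (use u v in auto)
  show ?thesis using I(3) L(3) sub[OF I(1,2)] sub[OF L(1,2)] by (simp add: sum_negf)
qed

lemma exp_le_quadratic:
  fixes s :: real
  assumes "\<bar>s\<bar> \<le> 1"
  shows "exp s \<le> 1 + s + s\<^sup>2"
proof (cases "s \<ge> 0")
  case True
  then show ?thesis using exp_bound assms by auto
next
  case False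
  define r where "r = - s"
  have r: "0 < r" "r \<le> 1" using False assms by (auto simp: r_def)
  \<comment> \<open>For negative \<open>s\<close> the claim multiplied by \<open>exp r\<close>
    follows from \<open>exp r \<ge> 1 + r + r\<^sup>2 / 2\<close>, because the product of the two
    polynomials is at least 1.\<close>
  have "1 \<le> (1 - r + r\<^sup>2) * (1 + r + r\<^sup>2 / 2)"
  proof -
    have "(1 - r + r\<^sup>2) * (1 + r + r\<^sup>2 / 2) = 1 + r\<^sup>2 / 2 + r ^ 3 / 2 + r ^ 4 / 2"
      by (simp add: power2_eq_square power3_eq_cube power4_eq_xxxx field_simps)
    then show ?thesis using r by simp
  qed
  also have "\<dots> \<le> (1 - r + r\<^sup>2) * exp r"
    using r exp_lower_Taylor_quadratic[of r] by (intro mult_left_mono) auto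
  finally have "exp (- r) \<le> 1 - r + r\<^sup>2"
    by (simp add: exp_minus field_simps)
  then show ?thesis by (simp add: r_def)
qed

lemma space_PiM_discrete:
  assumes "\<And>i. space (M i) = (UNIV :: 'k::finite set)"
  shows "space (PiM {..<n} M) = assignments n"
  by (simp add: space_PiM assignments_def assms)

text \<open>There are finitely many assignments and each singleton is a measurable box, so the
  product sigma-algebra is discrete.\<close>

lemma sets_PiM_discrete:
  assumes "\<And>i. sets (M i) = (UNIV :: 'k::finite set set)"
  shows "sets (PiM {..<n} M) = Pow (assignments n)"
proof
  have sp: "space (M i) = UNIV" for i using assms[of i] sets.sets_into_space[of UNIV "M i"] by auto
  show "sets (PiM {..<n} M) \<subseteq> Pow (assignments n)"
    using sets.sets_into_space[of _ "PiM {..<n} M"] unfolding space_PiM_discrete[of M n, OF sp] by auto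
  show "Pow (assignments n) \<subseteq> sets (PiM {..<n} M)"
  proof
    fix B :: "(nat \<Rightarrow> 'k) set" assume B: "B \<in> Pow (assignments n)"
    have "{z} \<in> sets (PiM {..<n} M)" if "z \<in> B" for z
    proof -
      have "z \<in> extensional {..<n}" using that B by (auto simp: assignments_def PiE_def)
      then have "{z} = (\<Pi>\<^sub>E i\<in>{..<n}. {z i})"
        by (rule PiE_singleton[symmetric])
      also have "\<dots> \<in> sets (PiM {..<n} M)" by (intro sets_PiM_I_finite) (auto simp: assms)
      finally show ?thesis .
    qed
    then have "(\<Union>z\<in>B. {z}) \<in> sets (PiM {..<n} M)"
      using B finite_subset[OF _ finite_assignments] by (intro sets.finite_UN) auto
    then show "B \<in> sets (PiM {..<n} M)" by simp
  qed
qed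

lemma space_lbm_space: "space (lbm_space n d) = assignments n \<times> assignments d \<times> space (PiM (cells n d) (\<lambda>_. borel))"
  unfolding lbm_space_def by (simp add: space_pair_measure space_PiM assignments_def)

text \<open>The labels being discrete, measurability is a matter of the sections in the data.\<close>

lemma measurable_lbm_spaceI:
  fixes f :: "(nat \<Rightarrow> 'g::finite) \<times> (nat \<Rightarrow> 'm::finite) \<times> (nat \<times> nat \<Rightarrow> real) \<Rightarrow> 'b"
  assumes sec: "\<And>z w. z \<in> assignments n \<Longrightarrow> w \<in> assignments d \<Longrightarrow>
    (\<lambda>x. f (z, w, x)) \<in> measurable (PiM (cells n d) (\<lambda>_. borel)) N"
  shows "f \<in> measurable (lbm_space n d) N"
proof (rule measurableI)
  let ?D = "PiM (cells n d) (\<lambda>_. borel) :: (nat \<times> nat \<Rightarrow> real) measure"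
  fix a :: "(nat \<Rightarrow> 'g) \<times> (nat \<Rightarrow> 'm) \<times> (nat \<times> nat \<Rightarrow> real)" assume "a \<in> space (lbm_space n d)"
  then obtain z w x where "a = (z, w, x)" "z \<in> assignments n" "w \<in> assignments d" "x \<in> space ?D"
    by (auto simp: space_lbm_space)
  then show "f a \<in> space N" using measurable_space[OF sec, of z w x] by simp
next
  let ?D = "PiM (cells n d) (\<lambda>_. borel) :: (nat \<times> nat \<Rightarrow> real) measure"
  fix B assume B: "B \<in> sets N"
  have "f -` B \<inter> space (lbm_space n d) =
      (\<Union>z\<in>assignments n. \<Union>w\<in>assignments d. {z} \<times> {w} \<times> ((\<lambda>x. f (z, w, x)) -` B \<inter> space ?D))"
    by (auto simp: space_lbm_space)
  also have "\<dots> \<in> sets (lbm_space n d)"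
    unfolding lbm_space_def
  proof (intro sets.finite_UN pair_measureI)
    fix z :: "nat \<Rightarrow> 'g" and w :: "nat \<Rightarrow> 'm" assume "z \<in> assignments n" "w \<in> assignments d"
    then show "{z} \<in> sets (PiM {..<n} (\<lambda>_. count_space UNIV))" "{w} \<in> sets (PiM {..<d} (\<lambda>_. count_space UNIV))"
      "(\<lambda>x. f (z, w, x)) -` B \<inter> space ?D \<in> sets ?D"
      using measurable_sets[OF sec B] by (auto simp: sets_PiM_discrete)
  qed simp_all
  finally show "f -` B \<inter> space (lbm_space n d) \<in> sets (lbm_space n d)" .
qed

lemma prob_space_multinomial1: "p \<in> prob_vectors \<Longrightarrow> prob_space (multinomial1 p)"
  by (rule prob_spaceI)
     (simp add: multinomial1_def space_point_measure emeasure_point_measure_finite sum_ennreal prob_vectors_def)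

lemma space_multinomial1 [simp]: "space (multinomial1 p) = UNIV"
  and sets_multinomial1 [simp]: "sets (multinomial1 p) = UNIV"
  by (auto simp: multinomial1_def space_point_measure sets_point_measure)

text \<open>A centred indicator is bounded by 1, so \<open>exp_le_quadratic\<close> applies and the
  linear term has mean 0. The bound has the shape demanded by \<open>measure_PiM_deviation\<close>
  with \<open>K = 1\<close> and \<open>h = 1\<close>, hence the factor \<open>1 *\<close>.\<close>

lemma mgf_multinomial1:
  assumes p: "p \<in> prob_vectors" and t: "\<bar>t\<bar> \<le> 1"
  shows "(\<integral>\<^sup>+k'. ennreal (exp (t * (of_bool (k' = k) - p $ k))) \<partial>multinomial1 p) \<le> ennreal (exp (1 * t\<^sup>2))"
proof -
  have p0: "0 \<le> p $ k" "(\<Sum>k\<in>UNIV. p $ k) = 1" for k using p by (auto simp: prob_vectors_def)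
  have p1: "p $ k \<le> 1" for k using p0 member_le_sum[of k UNIV "($) p"] by auto
  let ?y = "\<lambda>k'. of_bool (k' = k) - p $ k"
  have y: "\<bar>?y k'\<bar> \<le> 1" for k' using p0(1)[of k] p1[of k] by auto
  have le: "exp (t * ?y k') \<le> 1 + t * ?y k' + t\<^sup>2" for k'
  proof -
    have ty: "\<bar>t * ?y k'\<bar> \<le> \<bar>t\<bar>" unfolding abs_mult using y[of k'] by (intro mult_right_le_one_le) auto
    then have "exp (t * ?y k') \<le> 1 + t * ?y k' + (t * ?y k')\<^sup>2" using t by (intro exp_le_quadratic) simp
    moreover have "(t * ?y k')\<^sup>2 \<le> t\<^sup>2" using ty by (simp add: abs_le_square_iff)
    ultimately show ?thesis by simp
  qed
  have "(\<integral>\<^sup>+k'. ennreal (exp (t * ?y k')) \<partial>multinomial1 p) = ennreal (\<Sum>k'\<in>UNIV. p $ k' * exp (t * ?y k'))"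
    unfolding multinomial1_def
    by (simp add: nn_integral_point_measure_finite ennreal_mult[symmetric] p0 sum_ennreal mult.commute)
  also have "\<dots> \<le> ennreal (\<Sum>k'\<in>UNIV. p $ k' * (1 + t * ?y k' + t\<^sup>2))"
    by (intro ennreal_leI sum_mono mult_left_mono le p0)
  finally have "(\<integral>\<^sup>+k'. ennreal (exp (t * ?y k')) \<partial>multinomial1 p)
      \<le> ennreal (\<Sum>k'\<in>UNIV. p $ k' * (1 + t * ?y k' + t\<^sup>2))" .
  moreover have "(\<Sum>k'\<in>UNIV. p $ k' * (1 + t * ?y k' + t\<^sup>2)) = 1 + t\<^sup>2"
  proof -
    have "(\<Sum>k'\<in>UNIV. p $ k' * of_bool (k' = k)) = (\<Sum>k'\<in>UNIV. if k' = k then p $ k' else 0)"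
      by (intro sum.cong) auto
    then have "(\<Sum>k'\<in>UNIV. p $ k' * ?y k') = 0"
      by (simp add: right_diff_distrib sum_subtractf sum_distrib_right[symmetric] p0)
    moreover have "(\<Sum>k'\<in>UNIV. p $ k' * (1 + t * ?y k' + t\<^sup>2))
        = (\<Sum>k'\<in>UNIV. p $ k') * (1 + t\<^sup>2) + t * (\<Sum>k'\<in>UNIV. p $ k' * ?y k')"
      unfolding sum_distrib_right sum_distrib_left sum.distrib[symmetric]
      by (intro sum.cong refl) (simp add: algebra_simps)
    ultimately show ?thesis by (simp add: p0)
  qed
  moreover have "ennreal (1 + t\<^sup>2) \<le> ennreal (exp (1 * t\<^sup>2))"
    by (intro ennreal_leI) simp
  ultimately show ?thesis by simp
qed

section \<open>The law of the latent block model\<close>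

lemma (in finite_measure) measure_UN_le_const:
  assumes "finite I" "\<And>i. i \<in> I \<Longrightarrow> A i \<in> sets M" "\<And>i. i \<in> I \<Longrightarrow> measure M (A i) \<le> e"
  shows "measure M (\<Union>i\<in>I. A i) \<le> real (card I) * e"
proof -
  have "measure M (\<Union>i\<in>I. A i) \<le> (\<Sum>i\<in>I. measure M (A i))"
    using assms by (intro finite_measure_subadditive_finite) auto
  also have "\<dots> \<le> (\<Sum>i\<in>I. e)" by (intro sum_mono assms)
  finally show ?thesis by simp
qed

lemma multinomial_deviation:
  fixes p :: "real ^ 'k::finite"
  assumes p: "p \<in> prob_vectors" and e: "\<epsilon> > 0"
  shows "measure (PiM {..<n} (\<lambda>_. multinomial1 p)) {z \<in> space (PiM {..<n} (\<lambda>_. multinomial1 p)).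
    \<exists>k. \<epsilon> * real n < \<bar>(\<Sum>i<n. ind z i k) - real n * p $ k\<bar>} \<le> real CARD('k) * (2 * exp (- chernoff_rate 1 1 \<epsilon> * real n))"
proof -
  let ?M = "PiM {..<n} (\<lambda>_. multinomial1 p)"
  interpret M: prob_space ?M by (intro prob_space_PiM prob_space_multinomial1 p)
  have "measure ?M (\<Union>k\<in>UNIV. {z \<in> space ?M. \<epsilon> * real n < \<bar>\<Sum>i\<in>{..<n}. of_bool (z i = k) - p $ k\<bar>})
      \<le> real (card (UNIV :: 'k set)) * (2 * exp (- chernoff_rate 1 1 \<epsilon> * real n))"
  proof (rule M.measure_UN_le_const)
    fix k
    show "{z \<in> space ?M. \<epsilon> * real n < \<bar>\<Sum>i\<in>{..<n}. of_bool (z i = k) - p $ k\<bar>} \<in> sets ?M"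
      by (auto simp: sets_PiM_discrete space_PiM_discrete)
    show "measure ?M {z \<in> space ?M. \<epsilon> * real n < \<bar>\<Sum>i\<in>{..<n}. of_bool (z i = k) - p $ k\<bar>} \<le> 2 * exp (- chernoff_rate 1 1 \<epsilon> * real n)"
      by (rule measure_PiM_deviation[where f = "\<lambda>_ k'. of_bool (k' = k) - p $ k"])
         (use prob_space_multinomial1[OF p] mgf_multinomial1[OF p] e in \<open>auto simp: measurable_def\<close>)
  qed simp
  moreover have "(\<Union>k\<in>UNIV. {z \<in> space ?M. \<epsilon> * real n < \<bar>\<Sum>i\<in>{..<n}. of_bool (z i = k) - p $ k\<bar>})
     = {z \<in> space ?M. \<exists>k. \<epsilon> * real n < \<bar>(\<Sum>i<n. ind z i k) - real n * p $ k\<bar>}"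
    by (auto simp: ind_def sum_subtractf)
  ultimately show ?thesis by simp
qed

lemma measure_Un5_le:
  assumes "B1 \<in> sets M" "B2 \<in> sets M" "B3 \<in> sets M" "B4 \<in> sets M" "B5 \<in> sets M"
  shows "measure M (B1 \<union> B2 \<union> B3 \<union> B4 \<union> B5) \<le> measure M B1 + measure M B2 + measure M B3 + measure M B4 + measure M B5"
  using measure_Un_le[of "B1 \<union> B2 \<union> B3 \<union> B4" M B5] measure_Un_le[of "B1 \<union> B2 \<union> B3" M B4]
    measure_Un_le[of "B1 \<union> B2" M B3] measure_Un_le[of B1 M B2] assms
  by (simp add: sets.Un)

text \<open>Through \<open>mgf_expfam\<close>, \<open>alpha0_near\<close> says that every centred
  entry is sub-Gaussian for arguments up to \<open>h\<close>, with one constant \<open>K\<close> for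
  all classes. This keeps the deviation bounds free of the labels.\<close>

locale latent_block_model = exponential_family \<nu> b \<psi> A
  for \<nu> :: "real measure" and b \<psi> :: "real \<Rightarrow> real" and A :: "real set" +
  fixes \<pi>0 :: "real ^ 'g::finite" and \<rho>0 :: "real ^ 'm::finite" and \<alpha>0 :: "real ^ 'm ^ 'g"
    and K h :: real
  assumes pi0: "\<pi>0 \<in> prob_vectors" and rho0: "\<rho>0 \<in> prob_vectors"
    and K: "K > 0" and h: "h > 0"
    and alpha0_near: "\<And>k l t. \<bar>t\<bar> \<le> h \<Longrightarrow> \<alpha>0 $ k $ l + t \<in> A \<and> bregman \<psi> (\<alpha>0 $ k $ l) (\<alpha>0 $ k $ l + t) \<le> K * t\<^sup>2"
begin

lemma alpha0_A: "\<alpha>0 $ k $ l \<in> A"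
  using alpha0_near[of 0 k l] h by simp

definition cond_law :: "nat \<Rightarrow> nat \<Rightarrow> (nat \<Rightarrow> 'g) \<Rightarrow> (nat \<Rightarrow> 'm) \<Rightarrow> (nat \<times> nat \<Rightarrow> real) measure" where
  "cond_law n d z w = PiM (cells n d) (\<lambda>(i, j). expfam \<nu> b \<psi> (\<alpha>0 $ z i $ w j))"

definition labels :: "nat \<Rightarrow> nat \<Rightarrow> ((nat \<Rightarrow> 'g) \<times> (nat \<Rightarrow> 'm)) measure" where
  "labels n d = PiM {..<n} (\<lambda>_. multinomial1 \<pi>0) \<Otimes>\<^sub>M PiM {..<d} (\<lambda>_. multinomial1 \<rho>0)"

abbreviation law :: "nat \<Rightarrow> nat \<Rightarrow> ((nat \<Rightarrow> 'g) \<times> (nat \<Rightarrow> 'm) \<times> (nat \<times> nat \<Rightarrow> real)) measure" where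
  "law n d \<equiv> lbm \<nu> b \<psi> n d (\<pi>0, \<rho>0, \<alpha>0)"

lemma sets_cond_law [simp, measurable_cong]: "sets (cond_law n d z w) = sets (PiM (cells n d) (\<lambda>_. borel))"
  unfolding cond_law_def by (rule sets_PiM_cong) (auto simp: split_def)

lemma space_cond_law: "space (cond_law n d z w) = space (PiM (cells n d) (\<lambda>_. borel))"
  by (rule sets_eq_imp_space_eq) simp

lemma prob_space_expfam0: "prob_space (case p of (i, j) \<Rightarrow> expfam \<nu> b \<psi> (\<alpha>0 $ z i $ w j))"
  by (simp add: split_def prob_space_expfam alpha0_A)

lemma prob_space_cond_law: "prob_space (cond_law n d z w)"
  unfolding cond_law_def by (rule prob_space_PiM) (rule prob_space_expfam0)

lemma space_labels: "space (labels n d) = assignments n \<times> assignments d"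
  by (simp add: labels_def space_pair_measure space_PiM_discrete)

lemma prob_space_labels: "prob_space (labels n d)"
proof -
  interpret Z: prob_space "PiM {..<n} (\<lambda>_. multinomial1 \<pi>0)"
    by (intro prob_space_PiM prob_space_multinomial1 pi0)
  interpret W: prob_space "PiM {..<d} (\<lambda>_. multinomial1 \<rho>0)"
    by (intro prob_space_PiM prob_space_multinomial1 rho0)
  interpret pair_prob_space "PiM {..<n} (\<lambda>_. multinomial1 \<pi>0)" "PiM {..<d} (\<lambda>_. multinomial1 \<rho>0)" ..
  show ?thesis unfolding labels_def by (rule prob_space_axioms)
qed

lemma measurable_labelsI:
  assumes "\<And>z w. z \<in> assignments n \<Longrightarrow> w \<in> assignments d \<Longrightarrow> f (z, w) \<in> space N"
  shows "f \<in> measurable (labels n d) N"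
proof (rule measurableI)
  fix a assume "a \<in> space (labels n d)"
  then show "f a \<in> space N" using assms by (auto simp: space_labels)
next
  fix B assume "B \<in> sets N"
  have "f -` B \<inter> space (labels n d) = (\<Union>z\<in>assignments n. \<Union>w\<in>assignments d. if f (z, w) \<in> B then {z} \<times> {w} else {})"
    by (auto simp: space_labels split: if_splits)
  also have "\<dots> \<in> sets (labels n d)"
  proof (intro sets.finite_UN)
    fix z :: "nat \<Rightarrow> 'g" and w :: "nat \<Rightarrow> 'm" assume "z \<in> assignments n" "w \<in> assignments d"
    then have "{z} \<times> {w} \<in> sets (labels n d)"
      unfolding labels_def by (intro pair_measureI) (auto simp: sets_PiM_discrete)
    then show "(if f (z, w) \<in> B then {z} \<times> {w} else {}) \<in> sets (labels n d)" by simp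
  qed simp_all
  finally show "f -` B \<inter> space (labels n d) \<in> sets (labels n d)" .
qed

lemma embed_measurable:
  assumes "z \<in> assignments n" "w \<in> assignments d"
  shows "(\<lambda>x. (z, w, x)) \<in> measurable (cond_law n d z w) (lbm_space n d)"
proof -
  have "z \<in> space (PiM {..<n} (\<lambda>_. count_space UNIV))" "w \<in> space (PiM {..<d} (\<lambda>_. count_space UNIV))"
    using assms by (auto simp: space_PiM assignments_def)
  then show ?thesis
    unfolding lbm_space_def by (intro measurable_Pair measurable_const measurable_ident_sets) simp_all
qed

lemma kernel_measurable:
  "(\<lambda>(z, w). distr (cond_law n d z w) (lbm_space n d) (\<lambda>x. (z, w, x))) \<in> measurable (labels n d) (prob_algebra (lbm_space n d))"
proof (rule measurable_labelsI)
  fix z :: "nat \<Rightarrow> 'g" and w :: "nat \<Rightarrow> 'm" assume "z \<in> assignments n" "w \<in> assignments d"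
  then have "prob_space (distr (cond_law n d z w) (lbm_space n d) (\<lambda>x. (z, w, x)))"
    by (intro prob_space.prob_space_distr prob_space_cond_law embed_measurable)
  then show "(case (z, w) of (z, w) \<Rightarrow> distr (cond_law n d z w) (lbm_space n d) (\<lambda>x. (z, w, x))) \<in> space (prob_algebra (lbm_space n d))"
    by (simp add: space_prob_algebra)
qed

lemma P_eq_bind: "law n d = labels n d \<bind> (\<lambda>(z, w). distr (cond_law n d z w) (lbm_space n d) (\<lambda>x. (z, w, x)))"
  by (simp add: lbm_def labels_def cond_law_def)

lemma labels_prob_algebra: "labels n d \<in> space (prob_algebra (labels n d))"
  by (simp add: space_prob_algebra prob_space_labels)

lemma prob_space_P: "prob_space (law n d)"
  unfolding P_eq_bind by (rule prob_space_bind'[OF labels_prob_algebra kernel_measurable])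

lemma sets_P [simp, measurable_cong]: "sets (law n d) = sets (lbm_space n d)"
  unfolding P_eq_bind by (rule sets_bind'[OF labels_prob_algebra kernel_measurable])

lemma emeasure_P:
  assumes "X \<in> sets (lbm_space n d)"
  shows "emeasure (law n d) X = (\<integral>\<^sup>+(z, w). emeasure (cond_law n d z w) {x \<in> space (cond_law n d z w). (z, w, x) \<in> X} \<partial>labels n d)"
proof -
  have "emeasure (law n d) X = (\<integral>\<^sup>+p. emeasure (case p of (z, w) \<Rightarrow> distr (cond_law n d z w) (lbm_space n d) (\<lambda>x. (z, w, x))) X \<partial>labels n d)"
    unfolding P_eq_bind
    using prob_space.not_empty[OF prob_space_labels] measurable_prob_algebraD[OF kernel_measurable] assms
    by (rule emeasure_bind)
  also have "\<dots> = (\<integral>\<^sup>+(z, w). emeasure (cond_law n d z w) {x \<in> space (cond_law n d z w). (z, w, x) \<in> X} \<partial>labels n d)"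
  proof (rule nn_integral_cong)
    fix p assume "p \<in> space (labels n d)"
    then obtain z w where p: "p = (z, w)" "z \<in> assignments n" "w \<in> assignments d" by (auto simp: space_labels)
    show "emeasure (case p of (z, w) \<Rightarrow> distr (cond_law n d z w) (lbm_space n d) (\<lambda>x. (z, w, x))) X
      = (case p of (z, w) \<Rightarrow> emeasure (cond_law n d z w) {x \<in> space (cond_law n d z w). (z, w, x) \<in> X})"
      unfolding p prod.case using emeasure_distr[OF embed_measurable[OF p(2,3)] assms]
      by (simp add: vimage_def Collect_conj_eq Int_commute)
  qed
  finally show ?thesis .
qed

text \<open>The law is a mixture of the conditional laws, so a conditional bound that is uniform in
  the labels carries over.\<close>

lemma measure_P_le:
  assumes X: "X \<in> sets (lbm_space n d)" and e: "e \<ge> 0"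
    and le: "\<And>z w. z \<in> assignments n \<Longrightarrow> w \<in> assignments d \<Longrightarrow>
      measure (cond_law n d z w) {x \<in> space (cond_law n d z w). (z, w, x) \<in> X} \<le> e"
  shows "measure (law n d) X \<le> e"
proof -
  interpret L: prob_space "labels n d" by (rule prob_space_labels)
  interpret P: prob_space "law n d" by (rule prob_space_P)
  have "emeasure (law n d) X \<le> (\<integral>\<^sup>+p. ennreal e \<partial>labels n d)"
    unfolding emeasure_P[OF X]
  proof (rule nn_integral_mono)
    fix p assume "p \<in> space (labels n d)"
    then obtain z w where p: "p = (z, w)" "z \<in> assignments n" "w \<in> assignments d" by (auto simp: space_labels)
    interpret C: prob_space "cond_law n d z w" by (rule prob_space_cond_law)
    show "(case p of (z, w) \<Rightarrow> emeasure (cond_law n d z w) {x \<in> space (cond_law n d z w). (z, w, x) \<in> X}) \<le> ennreal e"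
      using le[OF p(2,3)] by (simp add: p(1) C.emeasure_eq_measure ennreal_leI)
  qed
  also have "\<dots> = ennreal e" by (simp add: L.emeasure_space_1)
  finally show ?thesis using e by (simp add: P.emeasure_eq_measure)
qed

lemma Collect_P_sets:
  assumes "\<And>z w. z \<in> assignments n \<Longrightarrow> w \<in> assignments d \<Longrightarrow> {x \<in> space (PiM (cells n d) (\<lambda>_. borel)). R z w x} \<in> sets (PiM (cells n d) (\<lambda>_. borel))"
  shows "{(z, w, x). (z, w, x) \<in> space (lbm_space n d) \<and> R z w x} \<in> sets (lbm_space n d)"
proof -
  have "(\<lambda>(z, w, x). R z w x) \<in> measurable (lbm_space n d) (count_space UNIV)"
    by (rule measurable_lbm_spaceI) (use assms in \<open>simp add: pred_def\<close>)
  then have "{\<omega> \<in> space (lbm_space n d). (\<lambda>(z, w, x). R z w x) \<omega>} \<in> sets (lbm_space n d)"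
    unfolding pred_def[symmetric] by simp
  also have "{\<omega> \<in> space (lbm_space n d). (\<lambda>(z, w, x). R z w x) \<omega>} = {(z, w, x). (z, w, x) \<in> space (lbm_space n d) \<and> R z w x}"
    by auto
  finally show ?thesis .
qed

lemma measure_P_labels:
  "measure (law n d) {(z, w, x). (z, w, x) \<in> space (lbm_space n d) \<and> R z w} = measure (labels n d) {p \<in> space (labels n d). R (fst p) (snd p)}"
proof -
  interpret L: prob_space "labels n d" by (rule prob_space_labels)
  interpret P: prob_space "law n d" by (rule prob_space_P)
  let ?X = "{(z, w, x). (z, w, x) \<in> space (lbm_space n d) \<and> R z w}"
  have X: "?X \<in> sets (lbm_space n d)" by (rule Collect_P_sets) simp
  have "(\<lambda>p. R (fst p) (snd p)) \<in> measurable (labels n d) (count_space UNIV)" by (rule measurable_labelsI) simp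
  then have Y: "{p \<in> space (labels n d). R (fst p) (snd p)} \<in> sets (labels n d)"
    unfolding pred_def[symmetric] by simp
  have "emeasure (law n d) ?X = (\<integral>\<^sup>+p. indicator {p \<in> space (labels n d). R (fst p) (snd p)} p \<partial>labels n d)"
    unfolding emeasure_P[OF X]
  proof (rule nn_integral_cong)
    fix p assume p: "p \<in> space (labels n d)"
    then obtain z w where zw: "p = (z, w)" "z \<in> assignments n" "w \<in> assignments d" by (auto simp: space_labels)
    interpret C: prob_space "cond_law n d z w" by (rule prob_space_cond_law)
    have "{x \<in> space (cond_law n d z w). (z, w, x) \<in> ?X} = (if R z w then space (cond_law n d z w) else {})"
      using zw by (auto simp: space_lbm_space space_cond_law)
    then show "(case p of (z, w) \<Rightarrow> emeasure (cond_law n d z w) {x \<in> space (cond_law n d z w). (z, w, x) \<in> ?X})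
       = indicator {p \<in> space (labels n d). R (fst p) (snd p)} p"
      using p by (simp add: zw(1) C.emeasure_space_1 indicator_def)
  qed
  also have "\<dots> = emeasure (labels n d) {p \<in> space (labels n d). R (fst p) (snd p)}"
    using Y by simp
  finally show ?thesis by (simp add: P.emeasure_eq_measure L.emeasure_eq_measure)
qed

lemma measure_labels_fst:
  "measure (labels n d) {p \<in> space (labels n d). R (fst p)} =
    measure (PiM {..<n} (\<lambda>_. multinomial1 \<pi>0)) {z \<in> space (PiM {..<n} (\<lambda>_. multinomial1 \<pi>0)). R z}"
proof -
  interpret Z: prob_space "PiM {..<n} (\<lambda>_. multinomial1 \<pi>0)"
    by (intro prob_space_PiM prob_space_multinomial1 pi0)
  interpret W: prob_space "PiM {..<d} (\<lambda>_. multinomial1 \<rho>0)"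
    by (intro prob_space_PiM prob_space_multinomial1 rho0)
  have "{p \<in> space (labels n d). R (fst p)} = {z \<in> space (PiM {..<n} (\<lambda>_. multinomial1 \<pi>0)). R z} \<times> space (PiM {..<d} (\<lambda>_. multinomial1 \<rho>0))"
    by (auto simp: labels_def space_pair_measure)
  moreover have "{z \<in> space (PiM {..<n} (\<lambda>_. multinomial1 \<pi>0)). R z} \<in> sets (PiM {..<n} (\<lambda>_. multinomial1 \<pi>0))"
    by (auto simp: sets_PiM_discrete space_PiM_discrete)
  ultimately show ?thesis
    by (simp add: labels_def measure_def W.emeasure_pair_measure_Times W.emeasure_space_1)
qed

lemma measure_labels_snd:
  "measure (labels n d) {p \<in> space (labels n d). R (snd p)} =
    measure (PiM {..<d} (\<lambda>_. multinomial1 \<rho>0)) {w \<in> space (PiM {..<d} (\<lambda>_. multinomial1 \<rho>0)). R w}"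
proof -
  interpret Z: prob_space "PiM {..<n} (\<lambda>_. multinomial1 \<pi>0)"
    by (intro prob_space_PiM prob_space_multinomial1 pi0)
  interpret W: prob_space "PiM {..<d} (\<lambda>_. multinomial1 \<rho>0)"
    by (intro prob_space_PiM prob_space_multinomial1 rho0)
  have "{p \<in> space (labels n d). R (snd p)} = space (PiM {..<n} (\<lambda>_. multinomial1 \<pi>0)) \<times> {w \<in> space (PiM {..<d} (\<lambda>_. multinomial1 \<rho>0)). R w}"
    by (auto simp: labels_def space_pair_measure)
  moreover have "{w \<in> space (PiM {..<d} (\<lambda>_. multinomial1 \<rho>0)). R w} \<in> sets (PiM {..<d} (\<lambda>_. multinomial1 \<rho>0))"
    by (auto simp: sets_PiM_discrete space_PiM_discrete)
  ultimately show ?thesis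
    by (simp add: labels_def measure_def W.emeasure_pair_measure_Times Z.emeasure_space_1)
qed

definition noise :: "(nat \<Rightarrow> 'g) \<Rightarrow> (nat \<Rightarrow> 'm) \<Rightarrow> (nat \<times> nat \<Rightarrow> real) \<Rightarrow> nat \<Rightarrow> nat \<Rightarrow> real" where
  "noise z w x i j = x (i, j) - deriv \<psi> (\<alpha>0 $ z i $ w j)"

lemma noise_deviation:
  assumes S: "S \<subseteq> cells n d" and m: "real (card S) \<le> m" and e: "\<epsilon> > 0"
  shows "measure (cond_law n d z w) {x \<in> space (cond_law n d z w). \<epsilon> * m < \<bar>\<Sum>(i, j)\<in>S. noise z w x i j\<bar>}
    \<le> 2 * exp (- chernoff_rate K h \<epsilon> * m)"
proof -
  have "measure (cond_law n d z w) {x \<in> space (cond_law n d z w). \<epsilon> * m < \<bar>\<Sum>p\<in>S. x p - deriv \<psi> (\<alpha>0 $ z (fst p) $ w (snd p))\<bar>}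
    \<le> 2 * exp (- chernoff_rate K h \<epsilon> * m)"
    unfolding cond_law_def
  proof (rule measure_PiM_deviation[where f = "\<lambda>p y. y - deriv \<psi> (\<alpha>0 $ z (fst p) $ w (snd p))"])
    fix p t assume t: "\<bar>t\<bar> \<le> h"
    have "(\<integral>\<^sup>+y. ennreal (exp (t * (y - deriv \<psi> (\<alpha>0 $ z (fst p) $ w (snd p))))) \<partial>expfam \<nu> b \<psi> (\<alpha>0 $ z (fst p) $ w (snd p)))
       \<le> ennreal (exp (K * t\<^sup>2))"
      using alpha0_near[OF t] alpha0_A by (subst mgf_expfam) (auto intro!: ennreal_leI)
    then show "(\<integral>\<^sup>+y. ennreal (exp (t * (y - deriv \<psi> (\<alpha>0 $ z (fst p) $ w (snd p))))) \<partial>(case p of (i, j) \<Rightarrow> expfam \<nu> b \<psi> (\<alpha>0 $ z i $ w j)))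
       \<le> ennreal (exp (K * t\<^sup>2))"
      by (simp add: split_def)
  next
    show "finite (cells n d)" by (simp add: cells_def)
    show "prob_space (case p of (i, j) \<Rightarrow> expfam \<nu> b \<psi> (\<alpha>0 $ z i $ w j))" for p by (rule prob_space_expfam0)
    show "(\<lambda>y. y - deriv \<psi> (\<alpha>0 $ z (fst p) $ w (snd p))) \<in> borel_measurable (case p of (i, j) \<Rightarrow> expfam \<nu> b \<psi> (\<alpha>0 $ z i $ w j))" for p
      by (simp add: split_def)
  qed (use S m e K h in auto)
  then show ?thesis by (simp add: noise_def split_def)
qed

text \<open>The exponential of the excess is at most 1 plus two exponential tilts damped by
  \<open>exp (- h * T)\<close>. Its expectation is thus close to 1 for large \<open>T\<close>, and
  \<open>1 + s \<le> exp s\<close> puts the bound into exponential form.\<close>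

lemma mgf_excess:
  assumes "a = \<alpha>0 $ k $ l"
  shows "(\<integral>\<^sup>+y. ennreal (exp (h * max 0 (\<bar>y - deriv \<psi> a\<bar> - T))) \<partial>expfam \<nu> b \<psi> a) \<le> ennreal (exp (2 * exp (K * h\<^sup>2 - h * T)))"
proof -
  interpret E: prob_space "expfam \<nu> b \<psi> a" using assms by (simp add: prob_space_expfam alpha0_A)
  have mgf: "(\<integral>\<^sup>+y. ennreal (exp (t * (y - deriv \<psi> a))) \<partial>expfam \<nu> b \<psi> a) \<le> ennreal (exp (K * h\<^sup>2))" if "t = h \<or> t = - h" for t
    using alpha0_near[of t k l] alpha0_A that h unfolding assms by (subst mgf_expfam) (auto intro!: ennreal_leI)
  have le: "exp (h * max 0 (\<bar>s\<bar> - T)) \<le> 1 + exp (- h * T) * (exp (h * s) + exp (- h * s))" for s :: real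
  proof -
    have 1: "exp (h * max 0 (\<bar>s\<bar> - T)) \<le> 1 + exp (h * (\<bar>s\<bar> - T))"
      by (cases "\<bar>s\<bar> \<le> T") (auto simp: max_def)
    have 2: "exp (h * (\<bar>s\<bar> - T)) = exp (- h * T) * exp (h * \<bar>s\<bar>)"
      by (simp add: exp_add[symmetric] algebra_simps)
    have "exp (h * \<bar>s\<bar>) \<le> exp (h * s) + exp (- h * s)"
      by (cases "s \<ge> 0") auto
    then have "exp (- h * T) * exp (h * \<bar>s\<bar>) \<le> exp (- h * T) * (exp (h * s) + exp (- h * s))"
      by (rule mult_left_mono) simp
    with 1 2 show ?thesis by linarith
  qed
  have "(\<integral>\<^sup>+y. ennreal (exp (h * max 0 (\<bar>y - deriv \<psi> a\<bar> - T))) \<partial>expfam \<nu> b \<psi> a)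
    \<le> (\<integral>\<^sup>+y. 1 + ennreal (exp (- h * T)) * (ennreal (exp (h * (y - deriv \<psi> a))) + ennreal (exp (- h * (y - deriv \<psi> a)))) \<partial>expfam \<nu> b \<psi> a)"
  proof (rule nn_integral_mono)
    fix y
    have "ennreal (exp (h * max 0 (\<bar>y - deriv \<psi> a\<bar> - T)))
      \<le> ennreal (1 + exp (- h * T) * (exp (h * (y - deriv \<psi> a)) + exp (- h * (y - deriv \<psi> a))))"
      by (rule ennreal_leI[OF le])
    also have "\<dots> = 1 + ennreal (exp (- h * T)) * (ennreal (exp (h * (y - deriv \<psi> a))) + ennreal (exp (- h * (y - deriv \<psi> a))))"
      by (simp only: ennreal_plus ennreal_mult ennreal_1 exp_ge_zero add_nonneg_nonneg mult_nonneg_nonneg zero_le_one)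
    finally show "ennreal (exp (h * max 0 (\<bar>y - deriv \<psi> a\<bar> - T)))
      \<le> 1 + ennreal (exp (- h * T)) * (ennreal (exp (h * (y - deriv \<psi> a))) + ennreal (exp (- h * (y - deriv \<psi> a))))" .
  qed
  also have "\<dots> = 1 + ennreal (exp (- h * T)) * ((\<integral>\<^sup>+y. ennreal (exp (h * (y - deriv \<psi> a))) \<partial>expfam \<nu> b \<psi> a) + (\<integral>\<^sup>+y. ennreal (exp (- h * (y - deriv \<psi> a))) \<partial>expfam \<nu> b \<psi> a))"
    using E.emeasure_space_1 by (simp add: nn_integral_add nn_integral_cmult)
  also have "\<dots> \<le> 1 + ennreal (exp (- h * T)) * (ennreal (exp (K * h\<^sup>2)) + ennreal (exp (K * h\<^sup>2)))"
    by (intro add_left_mono mult_left_mono add_mono mgf) auto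
  also have "\<dots> = ennreal (1 + exp (- h * T) * (exp (K * h\<^sup>2) + exp (K * h\<^sup>2)))"
    by (simp only: ennreal_plus ennreal_mult ennreal_1 exp_ge_zero add_nonneg_nonneg mult_nonneg_nonneg zero_le_one)
  also have "\<dots> \<le> ennreal (exp (2 * exp (K * h\<^sup>2 - h * T)))"
  proof (rule ennreal_leI)
    have "exp (- h * T) * (exp (K * h\<^sup>2) + exp (K * h\<^sup>2)) = 2 * exp (K * h\<^sup>2 - h * T)"
      by (simp add: exp_diff exp_minus divide_inverse)
    then show "1 + exp (- h * T) * (exp (K * h\<^sup>2) + exp (K * h\<^sup>2)) \<le> exp (2 * exp (K * h\<^sup>2 - h * T))"
      using exp_ge_add_one_self[of "2 * exp (K * h\<^sup>2 - h * T)"] by linarith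
  qed
  finally show ?thesis .
qed

text \<open>The condition on \<open>T\<close> lets the moment generating function consume at most
  half of the Chernoff gain \<open>h * \<epsilon>\<close> per entry.\<close>

lemma excess_deviation:
  assumes i: "i < n" and T: "2 * exp (K * h\<^sup>2 - h * T) \<le> h * \<epsilon> / 2"
  shows "measure (cond_law n d z w) {x \<in> space (cond_law n d z w). \<epsilon> * real d \<le> (\<Sum>j<d. max 0 (\<bar>noise z w x i j\<bar> - T))}
    \<le> exp (- (h * \<epsilon> / 2) * real d)"
proof -
  let ?a = "\<lambda>p :: nat \<times> nat. \<alpha>0 $ z (fst p) $ w (snd p)"
  have le: "measure (cond_law n d z w) {x \<in> space (cond_law n d z w). \<epsilon> * real d \<le> (\<Sum>p\<in>{i} \<times> {..<d}. max 0 (\<bar>x p - deriv \<psi> (?a p)\<bar> - T))}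
    \<le> exp ((\<Sum>p\<in>{i} \<times> {..<d}. 2 * exp (K * h\<^sup>2 - h * T)) - h * (\<epsilon> * real d))"
    unfolding cond_law_def
  proof (rule measure_PiM_exp_bound[where f = "\<lambda>p y. max 0 (\<bar>y - deriv \<psi> (?a p)\<bar> - T)"])
    show "finite (cells n d)" by (simp add: cells_def)
    show "prob_space (case p of (i, j) \<Rightarrow> expfam \<nu> b \<psi> (\<alpha>0 $ z i $ w j))" for p by (rule prob_space_expfam0)
    show "(\<lambda>y. max 0 (\<bar>y - deriv \<psi> (?a p)\<bar> - T)) \<in> borel_measurable (case p of (i, j) \<Rightarrow> expfam \<nu> b \<psi> (\<alpha>0 $ z i $ w j))" for p
      by (simp add: split_def)
    show "(\<integral>\<^sup>+y. ennreal (exp (h * max 0 (\<bar>y - deriv \<psi> (?a p)\<bar> - T))) \<partial>(case p of (i, j) \<Rightarrow> expfam \<nu> b \<psi> (\<alpha>0 $ z i $ w j)))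
        \<le> ennreal (exp (2 * exp (K * h\<^sup>2 - h * T)))" for p
      unfolding split_def by (rule mgf_excess) (rule refl)
  qed (use i h in \<open>auto simp: cells_def\<close>)
  have "(\<Sum>p\<in>{i} \<times> {..<d}. max 0 (\<bar>x p - deriv \<psi> (?a p)\<bar> - T)) = (\<Sum>j<d. max 0 (\<bar>noise z w x i j\<bar> - T))" for x
  proof -
    have "(\<Sum>p\<in>{i} \<times> {..<d}. max 0 (\<bar>x p - deriv \<psi> (?a p)\<bar> - T))
      = (\<Sum>i\<in>{i}. \<Sum>j<d. max 0 (\<bar>x (i, j) - deriv \<psi> (?a (i, j))\<bar> - T))"
      by (subst sum.cartesian_product) (auto intro!: sum.cong)
    then show ?thesis by (simp add: noise_def)
  qed
  with le have "measure (cond_law n d z w) {x \<in> space (cond_law n d z w). \<epsilon> * real d \<le> (\<Sum>j<d. max 0 (\<bar>noise z w x i j\<bar> - T))}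
    \<le> exp (real d * (2 * exp (K * h\<^sup>2 - h * T)) - h * (\<epsilon> * real d))"
    by (simp add: card_cartesian_product)
  also have "\<dots> \<le> exp (- (h * \<epsilon> / 2) * real d)"
    using mult_left_mono[OF T, of "real d"] by (simp add: algebra_simps)
  finally show ?thesis .
qed

end

section \<open>The exceptional event and its probability\<close>

context latent_block_model
begin

definition large_noise :: "nat \<Rightarrow> nat \<Rightarrow> (nat \<Rightarrow> 'g) \<Rightarrow> (nat \<Rightarrow> 'm) \<Rightarrow> (nat \<times> nat) set \<Rightarrow> real \<Rightarrow> (nat \<times> nat \<Rightarrow> real) set" where
  "large_noise n d z w S t = {x \<in> space (cond_law n d z w). t < \<bar>\<Sum>(i, j)\<in>S. noise z w x i j\<bar>}"

text \<open>The rectangles serve arbitrary soft marginals in the coarse step; the class-wise sums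
  and the excess over \<open>T\<close> serve the row and column gaps. The last part is a null set,
  excluded so that the logarithm of the likelihood splits.\<close>

definition bad_data :: "nat \<Rightarrow> nat \<Rightarrow> real \<Rightarrow> real \<Rightarrow> real \<Rightarrow> (nat \<Rightarrow> 'g) \<Rightarrow> (nat \<Rightarrow> 'm) \<Rightarrow> (nat \<times> nat \<Rightarrow> real) set" where
  "bad_data n d \<epsilon>1 \<epsilon>2 T z w =
     (\<Union>(I, I')\<in>Pow {..<n} \<times> Pow {..<d}. large_noise n d z w (I \<times> I') (\<epsilon>1 * (real n * real d))) \<union>
     (\<Union>(i, l)\<in>{..<n} \<times> UNIV. large_noise n d z w ({i} \<times> {j \<in> {..<d}. w j = l}) (\<epsilon>2 * real d)) \<union>
     (\<Union>(j, k)\<in>{..<d} \<times> UNIV. large_noise n d z w ({i \<in> {..<n}. z i = k} \<times> {j}) (\<epsilon>2 * real n)) \<union>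
     (\<Union>i\<in>{..<n}. {x \<in> space (cond_law n d z w). \<epsilon>2 * real d \<le> (\<Sum>j<d. max 0 (\<bar>noise z w x i j\<bar> - T))}) \<union>
     (\<Union>p\<in>cells n d. {x \<in> space (cond_law n d z w). \<not> b (x p) > 0})"

text \<open>A union bound: for each non-null part of \<open>bad_data\<close>, the number of its sets
  times their common Chernoff bound. The factor \<open>2 ^ n * 2 ^ d\<close> counts the
  rectangles.\<close>

definition bad_data_bound :: "nat \<Rightarrow> nat \<Rightarrow> real \<Rightarrow> real \<Rightarrow> real" where
  "bad_data_bound n d \<epsilon>1 \<epsilon>2 =
     2 ^ n * 2 ^ d * (2 * exp (- chernoff_rate K h \<epsilon>1 * (real n * real d))) +
     real n * real CARD('m) * (2 * exp (- chernoff_rate K h \<epsilon>2 * real d)) +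
     real d * real CARD('g) * (2 * exp (- chernoff_rate K h \<epsilon>2 * real n)) +
     real n * exp (- (h * \<epsilon>2 / 2) * real d)"

lemma component_measurable: "p \<in> cells n d \<Longrightarrow> (\<lambda>x. x p) \<in> borel_measurable (cond_law n d z w)"
  using measurable_component_singleton[of p "cells n d" "\<lambda>_. borel :: real measure"] by simp

lemma noise_measurable: "i < n \<Longrightarrow> j < d \<Longrightarrow> (\<lambda>x. noise z w x i j) \<in> borel_measurable (cond_law n d z w)"
  unfolding noise_def by (intro borel_measurable_diff component_measurable borel_measurable_const) (simp add: cells_def)

lemma large_noise_sets:
  assumes "S \<subseteq> cells n d"
  shows "large_noise n d z w S t \<in> sets (cond_law n d z w)"
proof -
  have "(\<lambda>x. \<Sum>(i, j)\<in>S. noise z w x i j) \<in> borel_measurable (cond_law n d z w)"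
    unfolding split_def using assms by (intro borel_measurable_sum noise_measurable) (auto simp: cells_def)
  then show ?thesis unfolding large_noise_def by measurable
qed

lemma excess_sets:
  assumes "i < n"
  shows "{x \<in> space (cond_law n d z w). t \<le> (\<Sum>j<d. max 0 (\<bar>noise z w x i j\<bar> - T))} \<in> sets (cond_law n d z w)"
proof -
  have "(\<lambda>x. \<Sum>j<d. max 0 (\<bar>noise z w x i j\<bar> - T)) \<in> borel_measurable (cond_law n d z w)"
    using assms
    by (intro borel_measurable_sum borel_measurable_max borel_measurable_diff borel_measurable_abs noise_measurable borel_measurable_const) auto
  then show ?thesis by measurable
qed

lemma nonpos_sets:
  assumes "p \<in> cells n d"
  shows "{x \<in> space (cond_law n d z w). \<not> b (x p) > 0} \<in> sets (cond_law n d z w)"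
proof -
  have "(\<lambda>x. b (x p)) \<in> borel_measurable (cond_law n d z w)"
    by (rule measurable_compose[OF component_measurable[OF assms] b_measurable])
  then show ?thesis by measurable
qed

lemma finite_cells: "finite (cells n d)"
  by (simp add: cells_def)

lemma bad_data_sets: "bad_data n d \<epsilon>1 \<epsilon>2 T z w \<in> sets (PiM (cells n d) (\<lambda>_. borel))"
  unfolding bad_data_def sets_cond_law[of n d z w, symmetric] split_def
  by (intro sets.Un sets.finite_UN large_noise_sets excess_sets nonpos_sets finite_cells)
     (auto simp: cells_def)

lemma measure_bad_data:
  assumes e: "\<epsilon>1 > 0" "\<epsilon>2 > 0" and T: "2 * exp (K * h\<^sup>2 - h * T) \<le> h * \<epsilon>2 / 2"
  shows "measure (cond_law n d z w) (bad_data n d \<epsilon>1 \<epsilon>2 T z w) \<le> bad_data_bound n d \<epsilon>1 \<epsilon>2"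
proof -
  interpret C: prob_space "cond_law n d z w" by (rule prob_space_cond_law)
  let ?\<mu> = "measure (cond_law n d z w)"
  let ?B1 = "\<Union>q\<in>Pow {..<n} \<times> Pow {..<d}. large_noise n d z w (fst q \<times> snd q) (\<epsilon>1 * (real n * real d))"
  let ?B2 = "\<Union>q\<in>{..<n} \<times> UNIV. large_noise n d z w ({fst q} \<times> {j \<in> {..<d}. w j = snd q}) (\<epsilon>2 * real d)"
  let ?B3 = "\<Union>q\<in>{..<d} \<times> UNIV. large_noise n d z w ({i \<in> {..<n}. z i = snd q} \<times> {fst q}) (\<epsilon>2 * real n)"
  let ?B4 = "\<Union>i\<in>{..<n}. {x \<in> space (cond_law n d z w). \<epsilon>2 * real d \<le> (\<Sum>j<d. max 0 (\<bar>noise z w x i j\<bar> - T))}"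
  let ?B5 = "\<Union>p\<in>cells n d. {x \<in> space (cond_law n d z w). \<not> b (x p) > 0}"
  have dev: "?\<mu> (large_noise n d z w S (\<epsilon> * r)) \<le> 2 * exp (- chernoff_rate K h \<epsilon> * r)"
    if "S \<subseteq> cells n d" "real (card S) \<le> r" "\<epsilon> > 0" for S \<epsilon> r
    unfolding large_noise_def by (rule noise_deviation[OF that])
  have card_le: "real (card I) \<le> real n" if "I \<subseteq> {..<n}" for I :: "nat set" and n
    using card_mono[OF _ that] by simp
  have 1: "?\<mu> ?B1 \<le> real (card (Pow {..<n} \<times> Pow {..<d})) * (2 * exp (- chernoff_rate K h \<epsilon>1 * (real n * real d)))"
  proof (rule C.measure_UN_le_const)
    fix q assume "q \<in> Pow {..<n} \<times> Pow {..<d}"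
    then have q: "fst q \<subseteq> {..<n}" "snd q \<subseteq> {..<d}" by auto
    then have sub: "fst q \<times> snd q \<subseteq> cells n d" by (auto simp: cells_def)
    then show "large_noise n d z w (fst q \<times> snd q) (\<epsilon>1 * (real n * real d)) \<in> sets (cond_law n d z w)"
      by (rule large_noise_sets)
    show "?\<mu> (large_noise n d z w (fst q \<times> snd q) (\<epsilon>1 * (real n * real d))) \<le> 2 * exp (- chernoff_rate K h \<epsilon>1 * (real n * real d))"
      using card_le[OF q(1)] card_le[OF q(2)] e
      by (intro dev[OF sub]) (auto simp: card_cartesian_product intro!: mult_mono)
  qed simp
  have 2: "?\<mu> ?B2 \<le> real (card ({..<n} \<times> (UNIV :: 'm set))) * (2 * exp (- chernoff_rate K h \<epsilon>2 * real d))"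
  proof (rule C.measure_UN_le_const)
    fix q :: "nat \<times> 'm" assume q: "q \<in> {..<n} \<times> UNIV"
    then have sub: "{fst q} \<times> {j \<in> {..<d}. w j = snd q} \<subseteq> cells n d" by (auto simp: cells_def)
    then show "large_noise n d z w ({fst q} \<times> {j \<in> {..<d}. w j = snd q}) (\<epsilon>2 * real d) \<in> sets (cond_law n d z w)"
      by (rule large_noise_sets)
    show "?\<mu> (large_noise n d z w ({fst q} \<times> {j \<in> {..<d}. w j = snd q}) (\<epsilon>2 * real d)) \<le> 2 * exp (- chernoff_rate K h \<epsilon>2 * real d)"
      using card_le[of "{j \<in> {..<d}. w j = snd q}" d] e
      by (intro dev[OF sub]) (auto simp: card_cartesian_product)
  qed simp
  have 3: "?\<mu> ?B3 \<le> real (card ({..<d} \<times> (UNIV :: 'g set))) * (2 * exp (- chernoff_rate K h \<epsilon>2 * real n))"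
  proof (rule C.measure_UN_le_const)
    fix q :: "nat \<times> 'g" assume q: "q \<in> {..<d} \<times> UNIV"
    then have sub: "{i \<in> {..<n}. z i = snd q} \<times> {fst q} \<subseteq> cells n d" by (auto simp: cells_def)
    then show "large_noise n d z w ({i \<in> {..<n}. z i = snd q} \<times> {fst q}) (\<epsilon>2 * real n) \<in> sets (cond_law n d z w)"
      by (rule large_noise_sets)
    show "?\<mu> (large_noise n d z w ({i \<in> {..<n}. z i = snd q} \<times> {fst q}) (\<epsilon>2 * real n)) \<le> 2 * exp (- chernoff_rate K h \<epsilon>2 * real n)"
      using card_le[of "{i \<in> {..<n}. z i = snd q}" n] e
      by (intro dev[OF sub]) (auto simp: card_cartesian_product)
  qed simp
  have 4: "?\<mu> ?B4 \<le> real (card {..<n}) * exp (- (h * \<epsilon>2 / 2) * real d)"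
    by (rule C.measure_UN_le_const) (use excess_sets excess_deviation T in auto)
  have 5: "?\<mu> ?B5 \<le> real (card (cells n d)) * 0"
  proof (rule C.measure_UN_le_const)
    fix p assume p: "p \<in> cells n d"
    show "{x \<in> space (cond_law n d z w). \<not> b (x p) > 0} \<in> sets (cond_law n d z w)" by (rule nonpos_sets[OF p])
    have "AE y in (case p of (i, j) \<Rightarrow> expfam \<nu> b \<psi> (\<alpha>0 $ z i $ w j)). b y > 0"
      unfolding split_def by (rule AE_expfam_b_pos)
    then have "AE x in cond_law n d z w. b (x p) > 0"
      unfolding cond_law_def
      by (intro AE_PiM_component[OF _ p, where P = "\<lambda>y. b y > 0"] prob_space_expfam0)
    then have "?\<mu> {x \<in> space (cond_law n d z w). \<not> b (x p) > 0} = 0"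
      using nonpos_sets[OF p] by (subst C.prob_eq_0) auto
    then show "?\<mu> {x \<in> space (cond_law n d z w). \<not> b (x p) > 0} \<le> 0" by simp
  qed (rule finite_cells)
  have m: "?B1 \<in> sets (cond_law n d z w)" "?B2 \<in> sets (cond_law n d z w)" "?B3 \<in> sets (cond_law n d z w)"
      "?B4 \<in> sets (cond_law n d z w)" "?B5 \<in> sets (cond_law n d z w)"
    by (intro sets.finite_UN large_noise_sets excess_sets nonpos_sets finite_cells; auto simp: cells_def)+
  have "bad_data n d \<epsilon>1 \<epsilon>2 T z w = ?B1 \<union> ?B2 \<union> ?B3 \<union> ?B4 \<union> ?B5"
    unfolding bad_data_def split_def ..
  then have "?\<mu> (bad_data n d \<epsilon>1 \<epsilon>2 T z w) \<le> ?\<mu> ?B1 + ?\<mu> ?B2 + ?\<mu> ?B3 + ?\<mu> ?B4 + ?\<mu> ?B5"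
    using measure_Un5_le[OF m] by (simp only:)
  also have "\<dots> \<le> bad_data_bound n d \<epsilon>1 \<epsilon>2"
    using 1 2 3 4 5 unfolding bad_data_bound_def by (simp add: card_cartesian_product card_Pow)
  finally show ?thesis .
qed

text \<open>Delivers the noise hypotheses of \<open>criterion_bound\<close> for a fixed data matrix,
  after which the argument is deterministic.\<close>

lemma not_bad_data:
  assumes nb: "x \<notin> bad_data n d \<epsilon>1 \<epsilon>2 T z w" and x: "x \<in> space (PiM (cells n d) (\<lambda>_. borel))"
  shows "(\<And>i. i < n \<Longrightarrow> 0 \<le> u i \<and> u i \<le> 1) \<Longrightarrow> (\<And>j. j < d \<Longrightarrow> 0 \<le> v j \<and> v j \<le> 1) \<Longrightarrow>
      \<bar>\<Sum>i<n. \<Sum>j<d. u i * v j * (x (i, j) - deriv \<psi> (\<alpha>0 $ z i $ w j))\<bar> \<le> \<epsilon>1 * (real n * real d)"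
    and "i < n \<Longrightarrow> \<bar>\<Sum>j<d. ind w j l * (x (i, j) - deriv \<psi> (\<alpha>0 $ z i $ w j))\<bar> \<le> \<epsilon>2 * real d"
    and "j < d \<Longrightarrow> \<bar>\<Sum>i<n. ind z i k * (x (i, j) - deriv \<psi> (\<alpha>0 $ z i $ w j))\<bar> \<le> \<epsilon>2 * real n"
    and "i < n \<Longrightarrow> (\<Sum>j<d. max 0 (\<bar>x (i, j) - deriv \<psi> (\<alpha>0 $ z i $ w j)\<bar> - T)) \<le> \<epsilon>2 * real d"
    and "i < n \<Longrightarrow> j < d \<Longrightarrow> b (x (i, j)) > 0"
proof -
  have xs: "x \<in> space (cond_law n d z w)" using x by (simp add: space_cond_law)
  have ln: "\<bar>\<Sum>(i, j)\<in>S. noise z w x i j\<bar> \<le> t" if "x \<notin> large_noise n d z w S t" for S t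
    using that xs by (auto simp: large_noise_def)
  show "\<bar>\<Sum>i<n. \<Sum>j<d. u i * v j * (x (i, j) - deriv \<psi> (\<alpha>0 $ z i $ w j))\<bar> \<le> \<epsilon>1 * (real n * real d)"
    if "\<And>i. i < n \<Longrightarrow> 0 \<le> u i \<and> u i \<le> 1" "\<And>j. j < d \<Longrightarrow> 0 \<le> v j \<and> v j \<le> 1"
  proof (rule bilinear_noise_bound[where y = "\<lambda>i j. x (i, j) - deriv \<psi> (\<alpha>0 $ z i $ w j)", OF _ that])
    fix I I' :: "nat set" assume "I \<subseteq> {..<n}" "I' \<subseteq> {..<d}"
    then have "x \<notin> large_noise n d z w (I \<times> I') (\<epsilon>1 * (real n * real d))"
      using nb unfolding bad_data_def by blast
    then have "\<bar>\<Sum>(i, j)\<in>I \<times> I'. noise z w x i j\<bar> \<le> \<epsilon>1 * (real n * real d)" by (rule ln)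
    then show "\<bar>\<Sum>i\<in>I. \<Sum>j\<in>I'. x (i, j) - deriv \<psi> (\<alpha>0 $ z i $ w j)\<bar> \<le> \<epsilon>1 * (real n * real d)"
      by (simp add: sum.cartesian_product noise_def)
  qed
  show "\<bar>\<Sum>j<d. ind w j l * (x (i, j) - deriv \<psi> (\<alpha>0 $ z i $ w j))\<bar> \<le> \<epsilon>2 * real d" if "i < n" for i l
  proof -
    have "x \<notin> large_noise n d z w ({i} \<times> {j \<in> {..<d}. w j = l}) (\<epsilon>2 * real d)"
      using nb that unfolding bad_data_def by blast
    then have "\<bar>\<Sum>(i, j)\<in>{i} \<times> {j \<in> {..<d}. w j = l}. noise z w x i j\<bar> \<le> \<epsilon>2 * real d" by (rule ln)
    moreover have "(\<Sum>(i, j)\<in>{i} \<times> {j \<in> {..<d}. w j = l}. noise z w x i j) = (\<Sum>j\<in>{j \<in> {..<d}. w j = l}. noise z w x i j)"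
      by (simp add: sum.cartesian_product[symmetric])
    moreover have "\<dots> = (\<Sum>j<d. if w j = l then noise z w x i j else 0)"
      by (rule sum.inter_filter) simp
    moreover have "\<dots> = (\<Sum>j<d. ind w j l * (x (i, j) - deriv \<psi> (\<alpha>0 $ z i $ w j)))"
      by (intro sum.cong) (auto simp: ind_def noise_def)
    ultimately show ?thesis by simp
  qed
  show "\<bar>\<Sum>i<n. ind z i k * (x (i, j) - deriv \<psi> (\<alpha>0 $ z i $ w j))\<bar> \<le> \<epsilon>2 * real n" if "j < d" for j k
  proof -
    have "x \<notin> large_noise n d z w ({i \<in> {..<n}. z i = k} \<times> {j}) (\<epsilon>2 * real n)"
      using nb that unfolding bad_data_def by blast
    then have "\<bar>\<Sum>(i, j)\<in>{i \<in> {..<n}. z i = k} \<times> {j}. noise z w x i j\<bar> \<le> \<epsilon>2 * real n" by (rule ln)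
    moreover have "(\<Sum>(i, j)\<in>{i \<in> {..<n}. z i = k} \<times> {j}. noise z w x i j) = (\<Sum>i\<in>{i \<in> {..<n}. z i = k}. noise z w x i j)"
      by (simp add: sum.cartesian_product[symmetric])
    moreover have "\<dots> = (\<Sum>i<n. if z i = k then noise z w x i j else 0)"
      by (rule sum.inter_filter) simp
    moreover have "\<dots> = (\<Sum>i<n. ind z i k * (x (i, j) - deriv \<psi> (\<alpha>0 $ z i $ w j)))"
      by (intro sum.cong) (auto simp: ind_def noise_def)
    ultimately show ?thesis by simp
  qed
  show "(\<Sum>j<d. max 0 (\<bar>x (i, j) - deriv \<psi> (\<alpha>0 $ z i $ w j)\<bar> - T)) \<le> \<epsilon>2 * real d" if "i < n" for i
  proof -
    have "x \<notin> {x \<in> space (cond_law n d z w). \<epsilon>2 * real d \<le> (\<Sum>j<d. max 0 (\<bar>noise z w x i j\<bar> - T))}"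
      using nb that unfolding bad_data_def by blast
    then show ?thesis using xs by (simp add: noise_def)
  qed
  show "b (x (i, j)) > 0" if "i < n" "j < d" for i j
  proof -
    have "(i, j) \<in> cells n d" using that by (simp add: cells_def)
    then have "x \<notin> {x \<in> space (cond_law n d z w). \<not> b (x (i, j)) > 0}"
      using nb unfolding bad_data_def by blast
    then show ?thesis using xs by simp
  qed
qed

definition bad :: "nat \<Rightarrow> nat \<Rightarrow> real \<Rightarrow> real \<Rightarrow> real \<Rightarrow> real \<Rightarrow> ((nat \<Rightarrow> 'g) \<times> (nat \<Rightarrow> 'm) \<times> (nat \<times> nat \<Rightarrow> real)) set" where
  "bad n d \<epsilon>0 \<epsilon>1 \<epsilon>2 T =
     {(z, w, x). (z, w, x) \<in> space (lbm_space n d) \<and> x \<in> bad_data n d \<epsilon>1 \<epsilon>2 T z w} \<union>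
     {(z, w, x). (z, w, x) \<in> space (lbm_space n d) \<and> (\<exists>k. \<epsilon>0 * real n < \<bar>(\<Sum>i<n. ind z i k) - real n * \<pi>0 $ k\<bar>)} \<union>
     {(z, w, x). (z, w, x) \<in> space (lbm_space n d) \<and> (\<exists>l. \<epsilon>0 * real d < \<bar>(\<Sum>j<d. ind w j l) - real d * \<rho>0 $ l\<bar>)}"

definition bad_bound :: "nat \<Rightarrow> nat \<Rightarrow> real \<Rightarrow> real \<Rightarrow> real \<Rightarrow> real" where
  "bad_bound n d \<epsilon>0 \<epsilon>1 \<epsilon>2 = bad_data_bound n d \<epsilon>1 \<epsilon>2 +
     real CARD('g) * (2 * exp (- chernoff_rate 1 1 \<epsilon>0 * real n)) + real CARD('m) * (2 * exp (- chernoff_rate 1 1 \<epsilon>0 * real d))"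

lemma bad_parts_sets:
  "{(z, w, x). (z, w, x) \<in> space (lbm_space n d) \<and> x \<in> bad_data n d \<epsilon>1 \<epsilon>2 T z w} \<in> sets (lbm_space n d)"
  "{(z, w, x). (z, w, x) \<in> space (lbm_space n d) \<and> R z w} \<in> sets (lbm_space n d)"
proof -
  show "{(z, w, x). (z, w, x) \<in> space (lbm_space n d) \<and> x \<in> bad_data n d \<epsilon>1 \<epsilon>2 T z w} \<in> sets (lbm_space n d)"
  proof (rule Collect_P_sets)
    fix z w
    have "bad_data n d \<epsilon>1 \<epsilon>2 T z w \<subseteq> space (PiM (cells n d) (\<lambda>_. borel))"
      using bad_data_sets sets.sets_into_space by blast
    then have "{x \<in> space (PiM (cells n d) (\<lambda>_. borel)). x \<in> bad_data n d \<epsilon>1 \<epsilon>2 T z w} = bad_data n d \<epsilon>1 \<epsilon>2 T z w" by auto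
    then show "{x \<in> space (PiM (cells n d) (\<lambda>_. borel)). x \<in> bad_data n d \<epsilon>1 \<epsilon>2 T z w} \<in> sets (PiM (cells n d) (\<lambda>_. borel))"
      using bad_data_sets by simp
  qed
  show "{(z, w, x). (z, w, x) \<in> space (lbm_space n d) \<and> R z w} \<in> sets (lbm_space n d)"
    by (rule Collect_P_sets) simp
qed

lemma bad_sets: "bad n d \<epsilon>0 \<epsilon>1 \<epsilon>2 T \<in> sets (lbm_space n d)"
  unfolding bad_def by (intro sets.Un bad_parts_sets)

lemma bad_data_bound_nonneg: "0 \<le> bad_data_bound n d \<epsilon>1 \<epsilon>2"
  by (auto simp: bad_data_bound_def)

lemma measure_bad:
  assumes e: "\<epsilon>0 > 0" "\<epsilon>1 > 0" "\<epsilon>2 > 0" and T: "2 * exp (K * h\<^sup>2 - h * T) \<le> h * \<epsilon>2 / 2"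
  shows "measure (law n d) (bad n d \<epsilon>0 \<epsilon>1 \<epsilon>2 T) \<le> bad_bound n d \<epsilon>0 \<epsilon>1 \<epsilon>2"
proof -
  let ?X = "{(z, w, x). (z, w, x) \<in> space (lbm_space n d) \<and> x \<in> bad_data n d \<epsilon>1 \<epsilon>2 T z w}"
  let ?Y = "{(z, w, x). (z, w, x) \<in> space (lbm_space n d) \<and> (\<exists>k. \<epsilon>0 * real n < \<bar>(\<Sum>i<n. ind z i k) - real n * \<pi>0 $ k\<bar>)} :: ((nat \<Rightarrow> 'g) \<times> (nat \<Rightarrow> 'm) \<times> (nat \<times> nat \<Rightarrow> real)) set"
  let ?Z = "{(z, w, x). (z, w, x) \<in> space (lbm_space n d) \<and> (\<exists>l. \<epsilon>0 * real d < \<bar>(\<Sum>j<d. ind w j l) - real d * \<rho>0 $ l\<bar>)} :: ((nat \<Rightarrow> 'g) \<times> (nat \<Rightarrow> 'm) \<times> (nat \<times> nat \<Rightarrow> real)) set"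
  have X: "measure (law n d) ?X \<le> bad_data_bound n d \<epsilon>1 \<epsilon>2"
  proof (rule measure_P_le[OF bad_parts_sets(1) bad_data_bound_nonneg])
    fix z :: "nat \<Rightarrow> 'g" and w :: "nat \<Rightarrow> 'm" assume zw: "z \<in> assignments n" "w \<in> assignments d"
    interpret C: prob_space "cond_law n d z w" by (rule prob_space_cond_law)
    have "measure (cond_law n d z w) {x \<in> space (cond_law n d z w). (z, w, x) \<in> ?X} \<le> measure (cond_law n d z w) (bad_data n d \<epsilon>1 \<epsilon>2 T z w)"
      using bad_data_sets by (intro C.finite_measure_mono) auto
    also have "\<dots> \<le> bad_data_bound n d \<epsilon>1 \<epsilon>2" by (rule measure_bad_data[OF e(2,3) T])
    finally show "measure (cond_law n d z w) {x \<in> space (cond_law n d z w). (z, w, x) \<in> ?X} \<le> bad_data_bound n d \<epsilon>1 \<epsilon>2" .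
  qed
  have Y: "measure (law n d) ?Y \<le> real CARD('g) * (2 * exp (- chernoff_rate 1 1 \<epsilon>0 * real n))"
    unfolding measure_P_labels measure_labels_fst[of n d "\<lambda>z. \<exists>k. \<epsilon>0 * real n < \<bar>(\<Sum>i<n. ind z i k) - real n * \<pi>0 $ k\<bar>"]
    by (rule multinomial_deviation[OF pi0 e(1)])
  have Z: "measure (law n d) ?Z \<le> real CARD('m) * (2 * exp (- chernoff_rate 1 1 \<epsilon>0 * real d))"
    unfolding measure_P_labels measure_labels_snd[of n d "\<lambda>w. \<exists>l. \<epsilon>0 * real d < \<bar>(\<Sum>j<d. ind w j l) - real d * \<rho>0 $ l\<bar>"]
    by (rule multinomial_deviation[OF rho0 e(1)])
  have m: "?X \<in> sets (law n d)" "?Y \<in> sets (law n d)" "?Z \<in> sets (law n d)"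
    unfolding sets_P by (rule bad_parts_sets)+
  have "measure (law n d) (bad n d \<epsilon>0 \<epsilon>1 \<epsilon>2 T) \<le> measure (law n d) ?X + measure (law n d) ?Y + measure (law n d) ?Z"
    unfolding bad_def using measure_Un_le[OF sets.Un[OF m(1,2)] m(3)] measure_Un_le[OF m(1,2)] by linarith
  then show ?thesis using X Y Z by (simp add: bad_bound_def)
qed

end

section \<open>Deterministic comparison with the complete-data estimator\<close>

lemma norm_vec_sq: "(norm (v :: real ^ 'k::finite))\<^sup>2 = (\<Sum>k\<in>UNIV. (v $ k)\<^sup>2)"
  by (simp add: norm_vec_def L2_set_def sum_nonneg)

lemma norm_mat_sq: "(norm (a :: real ^ 'm::finite ^ 'g::finite))\<^sup>2 = (\<Sum>k\<in>UNIV. \<Sum>l\<in>UNIV. (a $ k $ l)\<^sup>2)"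
proof -
  have "(norm a)\<^sup>2 = (\<Sum>k\<in>UNIV. (norm (a $ k))\<^sup>2)"
    by (simp add: norm_vec_def[of a] L2_set_def sum_nonneg)
  then show ?thesis by (simp add: norm_vec_sq)
qed

lemma norm_mat_le_sum: "norm (a :: real ^ 'm::finite ^ 'g::finite) \<le> (\<Sum>k\<in>UNIV. \<Sum>l\<in>UNIV. \<bar>a $ k $ l\<bar>)"
proof -
  have "norm a \<le> (\<Sum>k\<in>UNIV. norm (a $ k))"
    unfolding norm_vec_def[of a] by (rule L2_set_le_sum) simp
  also have "\<dots> \<le> (\<Sum>k\<in>UNIV. \<Sum>l\<in>UNIV. \<bar>a $ k $ l\<bar>)"
    by (intro sum_mono norm_le_l1_cart)
  finally show ?thesis .
qed

lemma dist_param_le: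
  fixes \<pi> \<pi>' :: "real ^ 'g::finite" and \<rho> \<rho>' :: "real ^ 'm::finite"
  shows "dist (\<pi>, \<rho>, \<alpha>) (\<pi>', \<rho>', \<alpha>') \<le> dist \<pi> \<pi>' + dist \<rho> \<rho>' + dist \<alpha> \<alpha>'"
proof -
  have le: "dist (p, q) (p', q') \<le> dist p p' + dist q q'" for p p' :: "'a::metric_space" and q q' :: "'b::metric_space"
    unfolding dist_Pair_Pair by (rule sqrt_sum_squares_le_sum) auto
  show ?thesis
    unfolding dist_Pair_Pair
    using sqrt_sum_squares_le_sum[of "dist \<pi> \<pi>'" "sqrt ((dist \<rho> \<rho>')\<^sup>2 + (dist \<alpha> \<alpha>')\<^sup>2)"]
      sqrt_sum_squares_le_sum[of "dist \<rho> \<rho>'" "dist \<alpha> \<alpha>'"] by simp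
qed

text \<open>A crude bound, but independent of the marginals: it makes the supremum over
  \<open>Q\<close> in the definition of the estimator a genuine least upper bound.\<close>

lemma variational_objective_bounded:
  fixes \<tau> :: "nat \<Rightarrow> 'g::finite \<Rightarrow> real" and \<nu> :: "nat \<Rightarrow> 'm::finite \<Rightarrow> real"
  assumes tau: "simplex_rows n \<tau>" and nu: "simplex_rows d \<nu>"
    and p: "\<And>k. 0 < \<pi> k" "(\<Sum>k\<in>UNIV. \<pi> k) = 1" "\<And>l. 0 < \<rho> l" "(\<Sum>l\<in>UNIV. \<rho> l) = 1"
  shows "variational_objective \<psi> n d x \<tau> \<nu> \<pi> \<rho> \<alpha> \<le> (\<Sum>i<n. \<Sum>j<d. \<Sum>k\<in>UNIV. \<Sum>l\<in>UNIV. \<bar>lin \<psi> (\<alpha> k l) (x (i, j))\<bar>)"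
proof -
  have "(\<Sum>i<n. \<Sum>k\<in>UNIV. \<tau> i k * (ln (\<pi> k) - ln (\<tau> i k))) \<le> 0"
    using p by (intro sum_nonpos sum_entropy_le_0 simplex_rowsD[OF tau]) auto
  moreover have "(\<Sum>j<d. \<Sum>l\<in>UNIV. \<nu> j l * (ln (\<rho> l) - ln (\<nu> j l))) \<le> 0"
    using p by (intro sum_nonpos sum_entropy_le_0 simplex_rowsD[OF nu]) auto
  moreover have "(\<Sum>i<n. \<Sum>j<d. \<Sum>k\<in>UNIV. \<Sum>l\<in>UNIV. \<tau> i k * \<nu> j l * lin \<psi> (\<alpha> k l) (x (i, j)))
      \<le> (\<Sum>i<n. \<Sum>j<d. \<Sum>k\<in>UNIV. \<Sum>l\<in>UNIV. \<bar>lin \<psi> (\<alpha> k l) (x (i, j))\<bar>)"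
  proof (intro sum_mono)
    fix i j k l assume "i \<in> {..<n}" "j \<in> {..<d}"
    then have t: "0 \<le> \<tau> i k" "\<tau> i k \<le> 1" "0 \<le> \<nu> j l" "\<nu> j l \<le> 1"
      using simplex_rowsD[OF tau, of i] simplex_rowsD[OF nu, of j] by auto
    have "\<tau> i k * \<nu> j l * lin \<psi> (\<alpha> k l) (x (i, j)) \<le> (\<tau> i k * \<nu> j l) * \<bar>lin \<psi> (\<alpha> k l) (x (i, j))\<bar>"
      using t by (intro mult_left_mono) auto
    also have "\<dots> \<le> 1 * \<bar>lin \<psi> (\<alpha> k l) (x (i, j))\<bar>"
      using t by (intro mult_right_mono mult_le_one) auto
    finally show "\<tau> i k * \<nu> j l * lin \<psi> (\<alpha> k l) (x (i, j)) \<le> \<bar>lin \<psi> (\<alpha> k l) (x (i, j))\<bar>" by simp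
  qed
  ultimately show ?thesis unfolding variational_objective_def by linarith
qed

lemma prop_hat_nth: "prop_hat n z $ k = (\<Sum>i<n. ind z i k) / real n"
  by (simp add: prop_hat_def asg_def ind_def)

lemma prop_hat_prob_vectors:
  assumes "n > 0"
  shows "prop_hat n (z :: nat \<Rightarrow> 'k::finite) \<in> prob_vectors"
proof -
  have "(\<Sum>k\<in>UNIV. prop_hat n z $ k) = (\<Sum>i<n. 1) / real n"
    using sum_ind_expand[of "\<lambda>_. 1" z n] by (simp add: prop_hat_nth sum_divide_distrib[symmetric])
  then show ?thesis using assms by (simp add: prob_vectors_def prop_hat_nth sum_nonneg)
qed

lemma x_hat_eq: "x_hat n d x z w k l =
    (\<Sum>i<n. \<Sum>j<d. ind z i k * ind w j l * x (i, j)) / ((\<Sum>i<n. ind z i k) * (\<Sum>j<d. ind w j l))"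
  by (simp add: x_hat_def asg_def ind_def mult_ac)

text \<open>\<open>near\<close> is the relative interior condition in metric form.
  \<open>\<kappa>\<close> and \<open>KB\<close> bound the divergence of \<open>\<psi>\<close> on an
  interval holding all admissible canonical parameters, and \<open>\<Delta>\<close> separates the
  rows and the columns of the true matrix.\<close>

locale estimation_setting = latent_block_model \<nu> b \<psi> A \<pi>0 \<rho>0 \<alpha>0 K h
  for \<nu> :: "real measure" and b \<psi> :: "real \<Rightarrow> real" and A :: "real set"
    and \<pi>0 :: "real ^ 'g::finite" and \<rho>0 :: "real ^ 'm::finite" and \<alpha>0 :: "real ^ 'm ^ 'g" and K h :: real +
  fixes \<Theta> :: "('g, 'm) param set" and c lo hi \<kappa> KB \<Delta> r :: real
  assumes Theta_params: "\<Theta> \<subseteq> params"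
    and Theta_bounds: "\<And>\<pi> \<rho> \<alpha> k l. (\<pi>, \<rho>, \<alpha>) \<in> \<Theta> \<Longrightarrow> c \<le> \<pi> $ k \<and> c \<le> \<rho> $ l \<and> \<alpha> $ k $ l \<in> {lo..hi}"
    and c: "c > 0"
    and breg: "\<And>a a'. a \<in> {lo..hi} \<Longrightarrow> a' \<in> {lo..hi} \<Longrightarrow> \<kappa> * (a - a')\<^sup>2 \<le> bregman \<psi> a a' \<and> bregman \<psi> a a' \<le> KB * (a - a')\<^sup>2"
    and \<kappa>: "\<kappa> > 0" and KB: "KB > 0"
    and sep: "\<Delta> > 0" "\<And>k k'. k \<noteq> k' \<Longrightarrow> \<exists>l. \<Delta> \<le> \<bar>\<alpha>0 $ k $ l - \<alpha>0 $ k' $ l\<bar>"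
      "\<And>l l'. l \<noteq> l' \<Longrightarrow> \<exists>k. \<Delta> \<le> \<bar>\<alpha>0 $ k $ l - \<alpha>0 $ k $ l'\<bar>"
    and theta0: "(\<pi>0, \<rho>0, \<alpha>0) \<in> \<Theta>"
    and near: "r > 0" "\<And>\<theta>. \<theta> \<in> params \<Longrightarrow> dist \<theta> (\<pi>0, \<rho>0, \<alpha>0) < r \<Longrightarrow> \<theta> \<in> \<Theta>"
begin

text \<open>The error of \<open>variational_objective_le\<close> for the row gap
  \<open>c' * d\<close> and the column gap \<open>c' * n\<close>.\<close>

definition error :: "real \<Rightarrow> nat \<Rightarrow> nat \<Rightarrow> real" where
  "error c' n d = (real n * exp (- (c' * real d)) + real d * exp (- (c' * real n))) / c"

text \<open>The lower bound of \<open>complete_mle_gap\<close> with \<open>c0 = c / 2\<close>,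
  evaluated at the relabelled \<open>\<theta>\<close>. One scalar controls all three deviations,
  each with the weight that matches its rate.\<close>

definition loss :: "nat \<Rightarrow> nat \<Rightarrow> (nat \<Rightarrow> 'g) \<Rightarrow> (nat \<Rightarrow> 'm) \<Rightarrow> (nat \<times> nat \<Rightarrow> real) \<Rightarrow> ('g, 'm) param \<Rightarrow> ('g \<Rightarrow> 'g) \<Rightarrow> ('m \<Rightarrow> 'm) \<Rightarrow> real" where
  "loss n d z w x \<theta> s t =
     real n / 4 * (norm (prop_hat n z - perm_vec s (fst \<theta>)))\<^sup>2 +
     real d / 4 * (norm (prop_hat d w - perm_vec t (fst (snd \<theta>))))\<^sup>2 +
     \<kappa> * (c / 2)\<^sup>2 * (real n * real d) * (norm (alpha_hat \<psi> A n d x z w - perm_mat s t (snd (snd \<theta>))))\<^sup>2"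

lemma Theta_sum:
  assumes "(\<pi>, \<rho>, \<alpha>) \<in> \<Theta>"
  shows "(\<Sum>k\<in>UNIV. \<pi> $ k) = 1" "(\<Sum>l\<in>UNIV. \<rho> $ l) = 1"
  using assms Theta_params by (auto simp: params_def prob_vectors_def)

lemma J_bounds:
  assumes th: "(\<pi>, \<rho>, \<alpha>) \<in> \<Theta>" and bpos: "\<And>i j. i < n \<Longrightarrow> j < d \<Longrightarrow> b (x (i, j)) > 0"
  shows "bdd_above ((\<lambda>Q. J b \<psi> n d x Q (\<pi>, \<rho>, \<alpha>)) ` factorized n d)"
    and "z \<in> assignments n \<Longrightarrow> w \<in> assignments d \<Longrightarrow>
      complete_loglik \<psi> n d x z w (($) \<pi>) (($) \<rho>) (\<lambda>k l. \<alpha> $ k $ l) + (\<Sum>i<n. \<Sum>j<d. ln (b (x (i, j))))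
      \<le> (SUP Q\<in>factorized n d. J b \<psi> n d x Q (\<pi>, \<rho>, \<alpha>))"
proof -
  have pos: "\<pi> $ k > 0" "\<rho> $ l > 0" for k l
    using Theta_bounds[OF th, of k l] c by auto
  have J_eq: "J b \<psi> n d x Q (\<pi>, \<rho>, \<alpha>) =
      variational_objective \<psi> n d x (row_marginal Q) (col_marginal Q) (($) \<pi>) (($) \<rho>) (\<lambda>k l. \<alpha> $ k $ l)
      + (\<Sum>i<n. \<Sum>j<d. ln (b (x (i, j))))" if "Q \<in> factorized n d" for Q
    by (rule J_eq_variational_objective[OF that]) (use pos bpos in auto)
  show bdd: "bdd_above ((\<lambda>Q. J b \<psi> n d x Q (\<pi>, \<rho>, \<alpha>)) ` factorized n d)"
  proof (rule bdd_aboveI2)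
    fix Q :: "((nat \<Rightarrow> 'g) \<times> (nat \<Rightarrow> 'm)) pmf" assume Q: "Q \<in> factorized n d"
    show "J b \<psi> n d x Q (\<pi>, \<rho>, \<alpha>) \<le> (\<Sum>i<n. \<Sum>j<d. \<Sum>k\<in>UNIV. \<Sum>l\<in>UNIV. \<bar>lin \<psi> (\<alpha> $ k $ l) (x (i, j))\<bar>) + (\<Sum>i<n. \<Sum>j<d. ln (b (x (i, j))))"
      unfolding J_eq[OF Q]
      by (intro add_right_mono variational_objective_bounded simplex_rows_marginal pos Theta_sum[OF th])
  qed
  assume zw: "z \<in> assignments n" "w \<in> assignments d"
  have "complete_loglik \<psi> n d x z w (($) \<pi>) (($) \<rho>) (\<lambda>k l. \<alpha> $ k $ l) + (\<Sum>i<n. \<Sum>j<d. ln (b (x (i, j))))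
      = J b \<psi> n d x (return_pmf (z, w)) (\<pi>, \<rho>, \<alpha>)"
    unfolding J_eq[OF return_pmf_factorized(1)[OF zw]] return_pmf_factorized(2,3)[OF zw] variational_objective_ind ..
  also have "\<dots> \<le> (SUP Q\<in>factorized n d. J b \<psi> n d x Q (\<pi>, \<rho>, \<alpha>))"
    by (rule cSUP_upper[OF return_pmf_factorized(1)[OF zw] bdd])
  finally show "complete_loglik \<psi> n d x z w (($) \<pi>) (($) \<rho>) (\<lambda>k l. \<alpha> $ k $ l) + (\<Sum>i<n. \<Sum>j<d. ln (b (x (i, j))))
      \<le> (SUP Q\<in>factorized n d. J b \<psi> n d x Q (\<pi>, \<rho>, \<alpha>))" .
qed

text \<open>The complete-data estimator always consists of probability vectors and a matrix, so
  closeness to the true parameter places it in \<open>\<Theta>\<close>. It then competes with the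
  variational estimator. The two bounds \<open>r / 4\<close> leave a total distance below
  \<open>r\<close>.\<close>

lemma mle_in_Theta:
  assumes nd: "n > 0" "d > 0"
    and dev: "\<And>k. \<bar>(\<Sum>i<n. ind z i k) - real n * \<pi>0 $ k\<bar> \<le> \<epsilon>0 * real n"
      "\<And>l. \<bar>(\<Sum>j<d. ind w j l) - real d * \<rho>0 $ l\<bar> \<le> \<epsilon>0 * real d"
    and \<epsilon>0: "\<epsilon>0 * real (CARD('g) + CARD('m)) \<le> r / 4"
    and ah: "\<And>k l. \<bar>a $ k $ l - \<alpha>0 $ k $ l\<bar> \<le> r / (4 * real (CARD('g) * CARD('m)))"
  shows "(prop_hat n z, prop_hat d w, a) \<in> \<Theta>"
proof (rule near(2))
  show "(prop_hat n z, prop_hat d w, a) \<in> params"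
    using prop_hat_prob_vectors[OF nd(1), of z] prop_hat_prob_vectors[OF nd(2), of w] by (auto simp: params_def)
  have p: "\<bar>prop_hat n z $ k - \<pi>0 $ k\<bar> \<le> \<epsilon>0" for k
  proof -
    have "prop_hat n z $ k - \<pi>0 $ k = ((\<Sum>i<n. ind z i k) - real n * \<pi>0 $ k) / real n"
      using nd by (simp add: prop_hat_nth diff_divide_distrib)
    then have "\<bar>prop_hat n z $ k - \<pi>0 $ k\<bar> = \<bar>(\<Sum>i<n. ind z i k) - real n * \<pi>0 $ k\<bar> / real n" by simp
    then show ?thesis using dev(1)[of k] nd by (simp add: pos_divide_le_eq)
  qed
  have q: "\<bar>prop_hat d w $ l - \<rho>0 $ l\<bar> \<le> \<epsilon>0" for l
  proof -
    have "prop_hat d w $ l - \<rho>0 $ l = ((\<Sum>j<d. ind w j l) - real d * \<rho>0 $ l) / real d"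
      using nd by (simp add: prop_hat_nth diff_divide_distrib)
    then have "\<bar>prop_hat d w $ l - \<rho>0 $ l\<bar> = \<bar>(\<Sum>j<d. ind w j l) - real d * \<rho>0 $ l\<bar> / real d" by simp
    then show ?thesis using dev(2)[of l] nd by (simp add: pos_divide_le_eq)
  qed
  have "dist (prop_hat n z) \<pi>0 \<le> (\<Sum>k\<in>(UNIV :: 'g set). \<epsilon>0)"
    unfolding dist_norm by (rule order_trans[OF norm_le_l1_cart sum_mono]) (simp add: p)
  moreover have "dist (prop_hat d w) \<rho>0 \<le> (\<Sum>l\<in>(UNIV :: 'm set). \<epsilon>0)"
    unfolding dist_norm by (rule order_trans[OF norm_le_l1_cart sum_mono]) (simp add: q)
  moreover have "dist a \<alpha>0 \<le> (\<Sum>k\<in>(UNIV :: 'g set). \<Sum>l\<in>(UNIV :: 'm set). r / (4 * real (CARD('g) * CARD('m))))"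
    unfolding dist_norm by (rule order_trans[OF norm_mat_le_sum], intro sum_mono) (use ah in simp)
  moreover have "(\<Sum>k\<in>(UNIV :: 'g set). \<Sum>l\<in>(UNIV :: 'm set). r / (4 * real (CARD('g) * CARD('m)))) = r / 4"
    by simp
  ultimately show "dist (prop_hat n z, prop_hat d w, a) (\<pi>0, \<rho>0, \<alpha>0) < r"
    using dist_param_le[of "prop_hat n z" "prop_hat d w" a \<pi>0 \<rho>0 \<alpha>0] \<epsilon>0 near(1) by (simp add: distrib_left mult.commute)
qed

text \<open>A class mean differs from its expectation by the class noise divided by the class size,
  which is at least \<open>(c / 2)^2 * n * d\<close>. Within the radius of
  \<open>inv_deriv_psi_near\<close> the likelihood equation is solved, and its solution satisfies
  the score equation needed in \<open>complete_mle_gap\<close>.\<close>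

lemma alpha_hat_near:
  assumes e: "e > 0"
  obtains r1 where "r1 > 0"
    "\<And>n d z w x k l. n > 0 \<Longrightarrow> d > 0 \<Longrightarrow> (\<And>k. c / 2 * real n \<le> (\<Sum>i<n. ind z i k)) \<Longrightarrow> (\<And>l. c / 2 * real d \<le> (\<Sum>j<d. ind w j l)) \<Longrightarrow>
      (\<And>k l. \<bar>\<Sum>i<n. \<Sum>j<d. ind z i k * ind w j l * (x (i, j) - deriv \<psi> (\<alpha>0 $ z i $ w j))\<bar> \<le> r1 * (real n * real d)) \<Longrightarrow>
      \<bar>alpha_hat \<psi> A n d x z w $ k $ l - \<alpha>0 $ k $ l\<bar> \<le> e \<and>
      (\<Sum>i<n. \<Sum>j<d. ind z i k * ind w j l * (x (i, j) - deriv \<psi> (alpha_hat \<psi> A n d x z w $ k $ l))) = 0"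
proof -
  have "\<exists>q>0. \<forall>y. \<bar>y - deriv \<psi> (\<alpha>0 $ k $ l)\<bar> \<le> q \<longrightarrow>
      \<bar>inv_into (interior A) (deriv \<psi>) y - \<alpha>0 $ k $ l\<bar> \<le> e \<and> deriv \<psi> (inv_into (interior A) (deriv \<psi>) y) = y" for k l
    using inv_deriv_psi_near[OF alpha0_A e, of k l] by metis
  then obtain q where q: "\<And>k l. q k l > 0" "\<And>k l y. \<bar>y - deriv \<psi> (\<alpha>0 $ k $ l)\<bar> \<le> q k l \<Longrightarrow>
      \<bar>inv_into (interior A) (deriv \<psi>) y - \<alpha>0 $ k $ l\<bar> \<le> e \<and> deriv \<psi> (inv_into (interior A) (deriv \<psi>) y) = y"
    by metis
  \<comment> \<open>One radius valid for all of the finitely many class pairs.\<close>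
  define q0 where "q0 = Min (range (\<lambda>(k, l). q k l))"
  have q0: "q0 > 0" "q0 \<le> q k l" for k l
  proof -
    show "q0 > 0" unfolding q0_def by (subst Min_gr_iff) (auto simp: q)
    have "q0 \<le> (\<lambda>(k, l). q k l) (k, l)" unfolding q0_def by (intro Min_le) auto
    then show "q0 \<le> q k l" by simp
  qed
  show thesis
  proof (rule that[of "(c / 2)\<^sup>2 * q0"])
    show "(c / 2)\<^sup>2 * q0 > 0" using c q0 by simp
    fix n d :: nat and z :: "nat \<Rightarrow> 'g" and w :: "nat \<Rightarrow> 'm" and x :: "nat \<times> nat \<Rightarrow> real" and k l
    assume nd: "n > 0" "d > 0"
      and f: "\<And>k. c / 2 * real n \<le> (\<Sum>i<n. ind z i k)" "\<And>l. c / 2 * real d \<le> (\<Sum>j<d. ind w j l)"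
      and noise: "\<And>k l. \<bar>\<Sum>i<n. \<Sum>j<d. ind z i k * ind w j l * (x (i, j) - deriv \<psi> (\<alpha>0 $ z i $ w j))\<bar> \<le> (c / 2)\<^sup>2 * q0 * (real n * real d)"
    define N where "N = (\<Sum>i<n. ind z i k) * (\<Sum>j<d. ind w j l)"
    have "(c / 2 * real n) * (c / 2 * real d) \<le> N"
      unfolding N_def using f c by (intro mult_mono) (auto intro!: sum_nonneg)
    then have N: "(c / 2)\<^sup>2 * (real n * real d) \<le> N" by (simp add: power2_eq_square mult_ac)
    moreover have "(c / 2)\<^sup>2 * (real n * real d) > 0" using c nd by simp
    ultimately have N0: "N > 0" by linarith
    have Nsum: "N = (\<Sum>i<n. \<Sum>j<d. ind z i k * ind w j l)" unfolding N_def by (rule sum_product)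
    have split: "(\<Sum>i<n. \<Sum>j<d. ind z i k * ind w j l * (x (i, j) - y)) = (\<Sum>i<n. \<Sum>j<d. ind z i k * ind w j l * x (i, j)) - N * y" for y
      unfolding Nsum sum_distrib_right by (simp add: right_diff_distrib sum_subtractf)
    have xh: "x_hat n d x z w k l = (\<Sum>i<n. \<Sum>j<d. ind z i k * ind w j l * x (i, j)) / N"
      unfolding x_hat_eq N_def ..
    have "(\<Sum>i<n. \<Sum>j<d. ind z i k * ind w j l * (x (i, j) - deriv \<psi> (\<alpha>0 $ z i $ w j)))
       = (\<Sum>i<n. \<Sum>j<d. ind z i k * ind w j l * (x (i, j) - deriv \<psi> (\<alpha>0 $ k $ l)))"
      by (intro sum.cong refl) (auto simp: ind_def)
    also have "\<dots> = N * (x_hat n d x z w k l - deriv \<psi> (\<alpha>0 $ k $ l))"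
      unfolding split xh using N0 by (simp add: right_diff_distrib)
    finally have "N * \<bar>x_hat n d x z w k l - deriv \<psi> (\<alpha>0 $ k $ l)\<bar> \<le> (c / 2)\<^sup>2 * q0 * (real n * real d)"
      using noise[of k l] N0 by (simp add: abs_mult)
    also have "\<dots> \<le> N * q0" using mult_right_mono[OF N, of q0] q0 by (simp add: mult_ac)
    finally have "\<bar>x_hat n d x z w k l - deriv \<psi> (\<alpha>0 $ k $ l)\<bar> \<le> q k l"
      using N0 q0(2)[of k l] by simp
    then have *: "\<bar>alpha_hat \<psi> A n d x z w $ k $ l - \<alpha>0 $ k $ l\<bar> \<le> e"
      "deriv \<psi> (alpha_hat \<psi> A n d x z w $ k $ l) = x_hat n d x z w k l"
      using q(2) by (auto simp: alpha_hat_def)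
    moreover have "(\<Sum>i<n. \<Sum>j<d. ind z i k * ind w j l * (x (i, j) - deriv \<psi> (alpha_hat \<psi> A n d x z w $ k $ l))) = 0"
      unfolding split * xh using N0 by simp
    ultimately show "\<bar>alpha_hat \<psi> A n d x z w $ k $ l - \<alpha>0 $ k $ l\<bar> \<le> e \<and>
      (\<Sum>i<n. \<Sum>j<d. ind z i k * ind w j l * (x (i, j) - deriv \<psi> (alpha_hat \<psi> A n d x z w $ k $ l))) = 0" by blast
  qed
qed

end

section \<open>From a regular sample to a bound on the loss\<close>

context estimation_setting
begin

text \<open>A sandwich: the log-likelihood of the complete-data estimator is at most the supremum
  for \<open>\<theta>\<close>, which up to one \<open>error\<close> is attained by some
  \<open>Q\<close>, whose objective up to another \<open>error\<close> is the complete
  log-likelihood of the relabelled \<open>\<theta>\<close>. The drop between the two log-likelihoods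
  dominates the loss.\<close>

lemma loss_le_error:
  assumes nd: "n > 0" "d > 0" and sp: "z \<in> assignments n" "w \<in> assignments d" "x \<in> space (PiM (cells n d) (\<lambda>_. borel))"
    and good: "(z, w, x) \<notin> bad n d \<epsilon>0 \<epsilon>1 \<epsilon>2 T"
    and est: "variational_estimate b \<psi> \<Theta> n d x \<theta>"
    and small: "error c' n d \<le> 1"
    and T: "T \<ge> 0"
    and e: "0 < e" "e \<le> \<Delta> / 4"
    and \<delta>: "\<delta> \<le> (c / 2 / real CARD('g)) * (c / 2 / real CARD('m)) * e\<^sup>2" "4 * \<delta> \<le> (c / 2 / real CARD('g)) * \<Delta>\<^sup>2 * e"
    and size: "1 - (real n + real d) * ln c \<le> \<kappa> * \<delta> / 2 * (real n * real d)"
    and eps1: "(real (CARD('g) * CARD('m)))\<^sup>2 * (hi - lo) * \<epsilon>1 \<le> \<kappa> * \<delta> / 2"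
    and \<eta>: "\<eta> = (real CARD('m))\<^sup>2 * e"
    and gap_row: "c' \<le> \<kappa> * (\<Delta>\<^sup>2 / 4) * (c / 2 - \<eta>) - KB * (e\<^sup>2 + \<eta> * (hi - lo)\<^sup>2) - real CARD('m) * (hi - lo) * (2 * \<epsilon>2 + T * \<eta>)"
    and gap_col: "c' \<le> \<kappa> * (\<Delta>\<^sup>2 / 4) * (c / 2) - KB * e\<^sup>2 - real CARD('g) * (hi - lo) * \<epsilon>2"
    and \<epsilon>0: "\<epsilon>0 \<le> c / 2" "\<epsilon>0 * real (CARD('g) + CARD('m)) \<le> r / 4"
    and ah: "\<And>k l. (\<And>k. c / 2 * real n \<le> (\<Sum>i<n. ind z i k)) \<Longrightarrow> (\<And>l. c / 2 * real d \<le> (\<Sum>j<d. ind w j l)) \<Longrightarrow>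
      (\<And>k l. \<bar>\<Sum>i<n. \<Sum>j<d. ind z i k * ind w j l * (x (i, j) - deriv \<psi> (\<alpha>0 $ z i $ w j))\<bar> \<le> \<epsilon>1 * (real n * real d)) \<Longrightarrow>
      \<bar>alpha_hat \<psi> A n d x z w $ k $ l - \<alpha>0 $ k $ l\<bar> \<le> r / (4 * real (CARD('g) * CARD('m))) \<and>
      (\<Sum>i<n. \<Sum>j<d. ind z i k * ind w j l * (x (i, j) - deriv \<psi> (alpha_hat \<psi> A n d x z w $ k $ l))) = 0"
  shows "\<exists>s t. s permutes UNIV \<and> t permutes UNIV \<and> loss n d z w x \<theta> s t \<le> 2 * error c' n d"
proof -
  let ?E = "error c' n d" and ?B = "\<Sum>i<n. \<Sum>j<d. ln (b (x (i, j)))"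
  let ?S = "\<lambda>\<theta>. SUP Q\<in>factorized n d. J b \<psi> n d x Q \<theta>"
  have spl: "(z, w, x) \<in> space (lbm_space n d)" using sp by (simp add: space_lbm_space)
  have nb: "x \<notin> bad_data n d \<epsilon>1 \<epsilon>2 T z w" using good spl by (auto simp: bad_def)
  have dev: "\<bar>(\<Sum>i<n. ind z i k) - real n * \<pi>0 $ k\<bar> \<le> \<epsilon>0 * real n"
      "\<bar>(\<Sum>j<d. ind w j l) - real d * \<rho>0 $ l\<bar> \<le> \<epsilon>0 * real d" for k l
  proof -
    show "\<bar>(\<Sum>i<n. ind z i k) - real n * \<pi>0 $ k\<bar> \<le> \<epsilon>0 * real n"
      using good spl unfolding bad_def by (simp add: not_less)
    show "\<bar>(\<Sum>j<d. ind w j l) - real d * \<rho>0 $ l\<bar> \<le> \<epsilon>0 * real d"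
      using good spl unfolding bad_def by (simp add: not_less)
  qed
  note noise = not_bad_data[OF nb sp(3)]
  have E: "?E > 0" unfolding error_def using nd c by (simp add: add_pos_pos)
  have b0: "c \<le> \<pi>0 $ k" "c \<le> \<rho>0 $ l" "\<alpha>0 $ k $ l \<in> {lo..hi}" for k l
    using Theta_bounds[OF theta0] by auto
  \<comment> \<open>True proportions are at least \<open>c\<close>, and
    \<open>\<epsilon>0 \<le> c / 2\<close>.\<close>
  have freq: "c / 2 * real n \<le> (\<Sum>i<n. ind z i k)" "c / 2 * real d \<le> (\<Sum>j<d. ind w j l)" for k l
  proof -
    have "c * real n \<le> real n * \<pi>0 $ k" "\<epsilon>0 * real n \<le> c * real n / 2"
      using mult_right_mono[OF b0(1)[of k], of "real n"] mult_right_mono[OF \<epsilon>0(1), of "real n"] by (simp_all add: mult.commute)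
    then have "c * real n / 2 \<le> (\<Sum>i<n. ind z i k)" using dev(1)[of k] by linarith
    then show "c / 2 * real n \<le> (\<Sum>i<n. ind z i k)" by simp
    have "c * real d \<le> real d * \<rho>0 $ l" "\<epsilon>0 * real d \<le> c * real d / 2"
      using mult_right_mono[OF b0(2)[of l], of "real d"] mult_right_mono[OF \<epsilon>0(1), of "real d"] by (simp_all add: mult.commute)
    then have "c * real d / 2 \<le> (\<Sum>j<d. ind w j l)" using dev(2)[of l] by linarith
    then show "c / 2 * real d \<le> (\<Sum>j<d. ind w j l)" by simp
  qed
  define a where "a = alpha_hat \<psi> A n d x z w"
  have "\<bar>\<Sum>i<n. \<Sum>j<d. ind z i k * ind w j l * (x (i, j) - deriv \<psi> (\<alpha>0 $ z i $ w j))\<bar> \<le> \<epsilon>1 * (real n * real d)" for k l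
    by (rule noise(1)) auto
  then have a: "\<bar>a $ k $ l - \<alpha>0 $ k $ l\<bar> \<le> r / (4 * real (CARD('g) * CARD('m)))"
    "(\<Sum>i<n. \<Sum>j<d. ind z i k * ind w j l * (x (i, j) - deriv \<psi> (a $ k $ l))) = 0" for k l
    using ah[OF freq(1) freq(2)] unfolding a_def by blast+
  have mle: "(prop_hat n z, prop_hat d w, a) \<in> \<Theta>"
    by (rule mle_in_Theta[OF nd dev \<epsilon>0(2) a(1)])
  obtain \<pi> \<rho> \<alpha> where th: "\<theta> = (\<pi>, \<rho>, \<alpha>)" by (cases \<theta>) auto
  have thin: "(\<pi>, \<rho>, \<alpha>) \<in> \<Theta>" and max: "\<And>\<theta>'. \<theta>' \<in> \<Theta> \<Longrightarrow> ?S \<theta>' \<le> ?S \<theta>"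
    using est unfolding variational_estimate_def is_arg_max_def th by (auto simp: not_less)
  have tb: "c \<le> \<pi> $ k" "c \<le> \<rho> $ l" "\<alpha> $ k $ l \<in> {lo..hi}" for k l
    using Theta_bounds[OF thin] by auto
  have tpos: "\<pi> $ k > 0" "\<rho> $ l > 0" for k l
    using tb(1)[of k] tb(2)[of l] c by linarith+
  have ne: "factorized n d \<noteq> ({} :: ((nat \<Rightarrow> 'g) \<times> (nat \<Rightarrow> 'm)) pmf set)"
    using return_pmf_factorized(1)[OF sp(1,2)] by auto
  have bdd: "bdd_above ((\<lambda>Q. J b \<psi> n d x Q (\<pi>, \<rho>, \<alpha>)) ` factorized n d)"
    by (rule J_bounds(1)[OF thin]) (rule noise(5))
  \<comment> \<open>A near-maximiser \<open>Q\<close> is enough. Its deficit is below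
    \<open>error\<close>, hence below the slack 1 in the competitiveness hypothesis.\<close>
  have "?S \<theta> - ?E < ?S \<theta>" using E by simp
  then obtain Q where Q: "Q \<in> factorized n d" "?S \<theta> - ?E < J b \<psi> n d x Q \<theta>"
    using less_cSUP_iff[OF ne bdd] unfolding th by blast
  have JQ: "J b \<psi> n d x Q \<theta> = variational_objective \<psi> n d x (row_marginal Q) (col_marginal Q) (($) \<pi>) (($) \<rho>) (\<lambda>k l. \<alpha> $ k $ l) + ?B"
    unfolding th by (rule J_eq_variational_objective[OF Q(1)]) (use tpos noise(5) in auto)
  let ?vo = "variational_objective \<psi> n d x (row_marginal Q) (col_marginal Q) (($) \<pi>) (($) \<rho>) (\<lambda>k l. \<alpha> $ k $ l)"
  have low: "complete_loglik \<psi> n d x z w (($) \<pi>') (($) \<rho>') (\<lambda>k l. \<alpha>' $ k $ l) + ?B \<le> ?S \<theta>" if "(\<pi>', \<rho>', \<alpha>') \<in> \<Theta>" for \<pi>' \<rho>' \<alpha>'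
  proof -
    have "complete_loglik \<psi> n d x z w (($) \<pi>') (($) \<rho>') (\<lambda>k l. \<alpha>' $ k $ l) + ?B \<le> ?S (\<pi>', \<rho>', \<alpha>')"
      by (rule J_bounds(2)[OF that _ sp(1,2)]) (rule noise(5))
    then show ?thesis using max[OF that] by linarith
  qed
  have comp: "complete_loglik \<psi> n d x z w (($) \<pi>0) (($) \<rho>0) (\<lambda>k l. \<alpha>0 $ k $ l) - 1 \<le> ?vo"
    using low[OF theta0] Q(2) JQ small by linarith
  have c2: "c / 2 > 0" using c by simp
  have "\<exists>s t. s permutes UNIV \<and> t permutes UNIV \<and>
    ?vo \<le> complete_loglik \<psi> n d x z w (\<lambda>k. \<pi> $ s k) (\<lambda>l. \<rho> $ t l) (\<lambda>k l. \<alpha> $ s k $ t l) +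
      (real n * exp (- (c' * real d)) + real d * exp (- (c' * real n))) / c"
    by (rule criterion_bound[where n = n and d = d and \<tau> = "row_marginal Q" and \<nu> = "col_marginal Q" and c = c
        and \<pi> = "($) \<pi>" and \<rho> = "($) \<rho>" and ?\<pi>0.0 = "($) \<pi>0" and ?\<rho>0.0 = "($) \<rho>0" and lo = lo and hi = hi
        and \<kappa> = \<kappa> and \<psi> = \<psi> and K = KB and \<alpha> = "\<lambda>k l. \<alpha> $ k $ l" and ?\<alpha>0.0 = "\<lambda>k l. \<alpha>0 $ k $ l" and \<Delta> = \<Delta>
        and ?c0.0 = "c / 2" and z = z and w = w and x = x and ?\<epsilon>1.0 = \<epsilon>1 and ?\<epsilon>2.0 = \<epsilon>2 and T = T and e = e and \<delta> = \<delta> and \<eta> = \<eta> and c' = c'];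
      (fact simplex_rows_marginal c tb b0 Theta_sum[OF thin] breg \<kappa> KB sep nd freq noise T e \<delta> size eps1 \<eta> gap_row gap_col comp c2
        | blast))
  then obtain s t where st: "s permutes UNIV" "t permutes UNIV"
    and le: "?vo \<le> complete_loglik \<psi> n d x z w (\<lambda>k. \<pi> $ s k) (\<lambda>l. \<rho> $ t l) (\<lambda>k l. \<alpha> $ s k $ t l) +
      (real n * exp (- (c' * real d)) + real d * exp (- (c' * real n))) / c"
    by blast
  have perm_sum: "(\<Sum>k\<in>UNIV. \<pi> $ s k) = 1" "(\<Sum>l\<in>UNIV. \<rho> $ t l) = 1"
    using sum.permute[OF st(1), of "($) \<pi>"] sum.permute[OF st(2), of "($) \<rho>"] Theta_sum[OF thin] by (auto simp: o_def)
  have gap: "complete_loglik \<psi> n d x z w (($) (prop_hat n z)) (($) (prop_hat d w)) (\<lambda>k l. a $ k $ l)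
      - complete_loglik \<psi> n d x z w (\<lambda>k. \<pi> $ s k) (\<lambda>l. \<rho> $ t l) (\<lambda>k l. \<alpha> $ s k $ t l) \<ge>
    real n / 4 * (\<Sum>k\<in>UNIV. (prop_hat n z $ k - \<pi> $ s k)\<^sup>2) + real d / 4 * (\<Sum>l\<in>UNIV. (prop_hat d w $ l - \<rho> $ t l)\<^sup>2)
    + \<kappa> * (c / 2)\<^sup>2 * (real n * real d) * (\<Sum>k\<in>UNIV. \<Sum>l\<in>UNIV. (a $ k $ l - \<alpha> $ s k $ t l)\<^sup>2)"
  proof (rule complete_mle_gap)
    show "a $ k $ l \<in> {lo..hi}" for k l using Theta_bounds[OF mle] by blast
  qed (use nd tpos perm_sum freq a(2) breg \<kappa> tb(3) c prop_hat_nth in auto)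
  have "loss n d z w x \<theta> s t =
    real n / 4 * (\<Sum>k\<in>UNIV. (prop_hat n z $ k - \<pi> $ s k)\<^sup>2) + real d / 4 * (\<Sum>l\<in>UNIV. (prop_hat d w $ l - \<rho> $ t l)\<^sup>2)
    + \<kappa> * (c / 2)\<^sup>2 * (real n * real d) * (\<Sum>k\<in>UNIV. \<Sum>l\<in>UNIV. (a $ k $ l - \<alpha> $ s k $ t l)\<^sup>2)"
    by (simp add: loss_def th norm_vec_sq norm_mat_sq perm_vec_def perm_mat_def a_def)
  then have "loss n d z w x \<theta> s t \<le> 2 * ?E"
    using gap le low[OF mle] Q(2) JQ unfolding error_def by linarith
  then show ?thesis using st by blast
qed

text \<open>The constants depend on each other only backwards in the order \<open>c'\<close>,
  \<open>\<epsilon>2\<close>, \<open>T\<close>, \<open>e\<close>, \<open>\<delta>\<close>,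
  \<open>\<epsilon>1\<close>. The leading gap is \<open>4 * c'\<close>: noise takes at most one
  \<open>c'\<close>, the terms proportional to \<open>e\<close> take at most two, and one
  remains.\<close>

lemma loss_constants:
  obtains c' \<epsilon>0 \<epsilon>1 \<epsilon>2 T N0 where "c' > 0" "\<epsilon>0 > 0" "\<epsilon>1 > 0" "\<epsilon>2 > 0" "2 * exp (K * h\<^sup>2 - h * T) \<le> h * \<epsilon>2 / 2"
    "\<And>n d z w x \<theta>. real n \<ge> N0 \<Longrightarrow> real d \<ge> N0 \<Longrightarrow> (z, w, x) \<in> space (lbm_space n d) \<Longrightarrow> (z, w, x) \<notin> bad n d \<epsilon>0 \<epsilon>1 \<epsilon>2 T \<Longrightarrow>
      variational_estimate b \<psi> \<Theta> n d x \<theta> \<Longrightarrow> error c' n d \<le> 1 \<Longrightarrow>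
      \<exists>s t. s permutes UNIV \<and> t permutes UNIV \<and> loss n d z w x \<theta> s t \<le> 2 * error c' n d"
proof -
  define g m where "g = real CARD('g)" and "m = real CARD('m)"
  have g: "g \<ge> 1" and m: "m \<ge> 1" by (auto simp: g_def m_def Suc_le_eq)
  define D where "D = hi - lo"
  have D: "D \<ge> 0" using Theta_bounds[OF theta0, of undefined undefined] by (auto simp: D_def)
  define c' where "c' = \<kappa> * \<Delta>\<^sup>2 * c / 32"
  have c'0: "c' > 0" using \<kappa> sep(1) c by (simp add: c'_def)
  have c'4: "\<kappa> * (\<Delta>\<^sup>2 / 4) * (c / 2) = 4 * c'" by (simp add: c'_def)
  \<comment> \<open>Chosen so that the \<open>\<epsilon>2\<close> terms of both gaps together stay
    below \<open>c'\<close>; the \<open>+ 1\<close> keeps the denominator positive when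
    \<open>D = 0\<close>.\<close>
  define \<epsilon>2 where "\<epsilon>2 = c' / ((2 * m + g) * D + 1)"
  have den: "(2 * m + g) * D + 1 > 0" using g m D by (intro add_nonneg_pos mult_nonneg_nonneg) auto
  have \<epsilon>2: "\<epsilon>2 > 0" using c'0 den by (simp add: \<epsilon>2_def)
  have "\<epsilon>2 * ((2 * m + g) * D + 1) = c'" using den by (simp add: \<epsilon>2_def)
  then have "\<epsilon>2 * ((2 * m + g) * D) \<le> c'" using \<epsilon>2 by (simp add: distrib_left)
  then have e2sum: "2 * (m * D * \<epsilon>2) + g * D * \<epsilon>2 \<le> c'" by (simp add: algebra_simps)
  have nn2: "m * D * \<epsilon>2 \<ge> 0" "g * D * \<epsilon>2 \<ge> 0" using m g D \<epsilon>2 by simp_all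
  \<comment> \<open>The solution in \<open>T\<close> of
    \<open>2 * exp (K * h\<^sup>2 - h * T) = h * \<epsilon>2 / 2\<close>, raised to 0 if it is
    negative.\<close>
  define T where "T = max 0 ((K * h\<^sup>2 - ln (h * \<epsilon>2 / 4)) / h)"
  have T0: "T \<ge> 0" by (simp add: T_def)
  have "(K * h\<^sup>2 - ln (h * \<epsilon>2 / 4)) / h \<le> T" by (simp add: T_def)
  then have "K * h\<^sup>2 - h * T \<le> ln (h * \<epsilon>2 / 4)" using h by (simp add: pos_divide_le_eq mult.commute)
  then have "exp (K * h\<^sup>2 - h * T) \<le> exp (ln (h * \<epsilon>2 / 4))" by simp
  then have T: "2 * exp (K * h\<^sup>2 - h * T) \<le> h * \<epsilon>2 / 2" using h \<epsilon>2 by simp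
  \<comment> \<open>The total coefficient of \<open>e\<close> in the row gap, after
    \<open>e\<^sup>2 \<le> e\<close> and \<open>\<eta> = m\<^sup>2 * e\<close>.\<close>
  define G where "G = \<kappa> * (\<Delta>\<^sup>2 / 4) * m\<^sup>2 + KB + KB * m\<^sup>2 * D\<^sup>2 + m * D * T * m\<^sup>2"
  have G: "G > 0" unfolding G_def using \<kappa> KB m D T0 by (intro add_nonneg_pos add_pos_nonneg) auto
  define e where "e = min (min 1 (\<Delta> / 4)) (2 * c' / G)"
  have e: "0 < e" "e \<le> 1" "e \<le> \<Delta> / 4" "e \<le> 2 * c' / G" using G c'0 sep(1) by (auto simp: e_def)
  have eG: "G * e \<le> 2 * c'" using e(4) G by (simp add: pos_le_divide_eq mult.commute)
  have ee: "e\<^sup>2 \<le> e" using e by (simp add: power2_eq_square mult_left_le)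
  define \<eta> where "\<eta> = m\<^sup>2 * e"
  have "KB * e\<^sup>2 \<le> KB * e" using ee KB by simp
  then have Gsum: "\<kappa> * (\<Delta>\<^sup>2 / 4) * \<eta> + KB * e\<^sup>2 + KB * \<eta> * D\<^sup>2 + m * D * (T * \<eta>) \<le> 2 * c'"
    using eG by (simp add: G_def \<eta>_def algebra_simps)
  have nnG: "\<kappa> * (\<Delta>\<^sup>2 / 4) * \<eta> \<ge> 0" "KB * \<eta> * D\<^sup>2 \<ge> 0" "m * D * (T * \<eta>) \<ge> 0"
    using \<kappa> KB m D T0 e by (simp_all add: \<eta>_def)
  have gap_row: "c' \<le> \<kappa> * (\<Delta>\<^sup>2 / 4) * (c / 2 - \<eta>) - KB * (e\<^sup>2 + \<eta> * D\<^sup>2) - m * D * (2 * \<epsilon>2 + T * \<eta>)"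
    using c'4 e2sum Gsum nn2 by (simp add: algebra_simps)
  have gap_col: "c' \<le> \<kappa> * (\<Delta>\<^sup>2 / 4) * (c / 2) - KB * e\<^sup>2 - g * D * \<epsilon>2"
    using c'4 e2sum Gsum nn2 nnG by linarith
  define \<delta> where "\<delta> = min ((c / 2 / g) * (c / 2 / m) * e\<^sup>2) ((c / 2 / g) * \<Delta>\<^sup>2 * e / 4)"
  have \<delta>: "\<delta> > 0" "\<delta> \<le> (c / 2 / g) * (c / 2 / m) * e\<^sup>2" "4 * \<delta> \<le> (c / 2 / g) * \<Delta>\<^sup>2 * e"
    using c g m e sep(1) unfolding \<delta>_def by auto
  have "r / (4 * real (CARD('g) * CARD('m))) > 0" using near(1) by simp
  then obtain r1 where r1: "r1 > 0" and ah: "\<And>n d z w x k l. n > 0 \<Longrightarrow> d > 0 \<Longrightarrow>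
      (\<And>k. c / 2 * real n \<le> (\<Sum>i<n. ind z i k)) \<Longrightarrow> (\<And>l. c / 2 * real d \<le> (\<Sum>j<d. ind w j l)) \<Longrightarrow>
      (\<And>k l. \<bar>\<Sum>i<n. \<Sum>j<d. ind z i k * ind w j l * (x (i, j) - deriv \<psi> (\<alpha>0 $ z i $ w j))\<bar> \<le> r1 * (real n * real d)) \<Longrightarrow>
      \<bar>alpha_hat \<psi> A n d x z w $ k $ l - \<alpha>0 $ k $ l\<bar> \<le> r / (4 * real (CARD('g) * CARD('m))) \<and>
      (\<Sum>i<n. \<Sum>j<d. ind z i k * ind w j l * (x (i, j) - deriv \<psi> (alpha_hat \<psi> A n d x z w $ k $ l))) = 0"
    using alpha_hat_near by blast
  define \<epsilon>1 where "\<epsilon>1 = min r1 (\<kappa> * \<delta> / 2 / ((g * m)\<^sup>2 * D + 1))"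
  have den1: "(g * m)\<^sup>2 * D + 1 > 0" using D by (intro add_nonneg_pos) auto
  have \<epsilon>1: "\<epsilon>1 > 0" "\<epsilon>1 \<le> r1" "\<epsilon>1 \<le> \<kappa> * \<delta> / 2 / ((g * m)\<^sup>2 * D + 1)"
    using r1 \<kappa> \<delta>(1) den1 by (auto simp: \<epsilon>1_def)
  have "\<epsilon>1 * ((g * m)\<^sup>2 * D + 1) \<le> \<kappa> * \<delta> / 2" using \<epsilon>1(3) unfolding pos_le_divide_eq[OF den1] .
  then have eps1: "(g * m)\<^sup>2 * D * \<epsilon>1 \<le> \<kappa> * \<delta> / 2" using \<epsilon>1(1) by (simp add: distrib_left mult.commute)
  define \<epsilon>0 where "\<epsilon>0 = min (c / 2) (r / 4 / (g + m))"
  have gm: "g + m > 0" using g m by simp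
  have "\<epsilon>0 \<le> r / 4 / (g + m)" by (simp add: \<epsilon>0_def)
  then have "\<epsilon>0 * (g + m) \<le> r / 4" unfolding pos_le_divide_eq[OF gm] .
  moreover have "\<epsilon>0 > 0" using c near(1) gm by (simp add: \<epsilon>0_def)
  moreover have "\<epsilon>0 \<le> c / 2" unfolding \<epsilon>0_def by (rule min.cobounded1)
  ultimately have \<epsilon>0: "\<epsilon>0 > 0" "\<epsilon>0 \<le> c / 2" "\<epsilon>0 * (g + m) \<le> r / 4" by blast+
  \<comment> \<open>The terms of order \<open>n + d\<close> are at most
    \<open>(1 + 2 * \<bar>ln c\<bar>) * max n d\<close>, and \<open>n * d\<close> is the product of
    the minimum and the maximum; so it suffices that the minimum is large.\<close>
  define N0 where "N0 = max 1 ((1 + 2 * \<bar>ln c\<bar>) / (\<kappa> * \<delta> / 2))"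
  show thesis
  proof (rule that[OF c'0 \<epsilon>0(1) \<epsilon>1(1) \<epsilon>2 T, of N0])
    fix n d :: nat and z :: "nat \<Rightarrow> 'g" and w :: "nat \<Rightarrow> 'm" and x \<theta>
    assume N: "N0 \<le> real n" "N0 \<le> real d" and sp: "(z, w, x) \<in> space (lbm_space n d)"
      and good: "(z, w, x) \<notin> bad n d \<epsilon>0 \<epsilon>1 \<epsilon>2 T" and est: "variational_estimate b \<psi> \<Theta> n d x \<theta>" and small: "error c' n d \<le> 1"
    have N1: "real n \<ge> 1" "real d \<ge> 1" using N by (auto simp: N0_def)
    then have nd: "n > 0" "d > 0" by auto
    have size: "1 - (real n + real d) * ln c \<le> \<kappa> * \<delta> / 2 * (real n * real d)"
    proof -
      have "1 + 2 * \<bar>ln c\<bar> \<le> \<kappa> * \<delta> / 2 * N0"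
        unfolding N0_def using \<kappa> \<delta>(1) by (simp add: max_def pos_divide_le_eq not_le mult.commute)
      also have "\<dots> \<le> \<kappa> * \<delta> / 2 * min (real n) (real d)"
        using N \<kappa> \<delta>(1) by (intro mult_left_mono) auto
      finally have 1: "(1 + 2 * \<bar>ln c\<bar>) * max (real n) (real d) \<le> \<kappa> * \<delta> / 2 * min (real n) (real d) * max (real n) (real d)"
        using N1 by (intro mult_right_mono) auto
      have 2: "min (real n) (real d) * max (real n) (real d) = real n * real d" by (auto simp: min_def max_def)
      have "- ((real n + real d) * ln c) = (real n + real d) * (- ln c)" by (rule mult_minus_right[symmetric])
      also have "\<dots> \<le> (real n + real d) * \<bar>ln c\<bar>" by (intro mult_left_mono) auto
      also have "\<dots> \<le> (2 * max (real n) (real d)) * \<bar>ln c\<bar>" by (intro mult_right_mono) auto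
      finally have "1 - (real n + real d) * ln c \<le> max (real n) (real d) + 2 * max (real n) (real d) * \<bar>ln c\<bar>" using N1 by linarith
      also have "\<dots> = (1 + 2 * \<bar>ln c\<bar>) * max (real n) (real d)" by (simp add: algebra_simps)
      finally show ?thesis using 1 2 by (simp add: mult.assoc)
    qed
    show "\<exists>s t. s permutes UNIV \<and> t permutes UNIV \<and> loss n d z w x \<theta> s t \<le> 2 * error c' n d"
    proof (rule loss_le_error[where e = e and \<delta> = \<delta> and \<eta> = \<eta>])
      show "z \<in> assignments n" "w \<in> assignments d" "x \<in> space (PiM (cells n d) (\<lambda>_. borel))"
        using sp by (auto simp: space_lbm_space)
      show "\<bar>alpha_hat \<psi> A n d x z w $ k $ l - \<alpha>0 $ k $ l\<bar> \<le> r / (4 * real (CARD('g) * CARD('m))) \<and>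
        (\<Sum>i<n. \<Sum>j<d. ind z i k * ind w j l * (x (i, j) - deriv \<psi> (alpha_hat \<psi> A n d x z w $ k $ l))) = 0"
        if "\<And>k. c / 2 * real n \<le> (\<Sum>i<n. ind z i k)" "\<And>l. c / 2 * real d \<le> (\<Sum>j<d. ind w j l)"
        "\<And>k l. \<bar>\<Sum>i<n. \<Sum>j<d. ind z i k * ind w j l * (x (i, j) - deriv \<psi> (\<alpha>0 $ z i $ w j))\<bar> \<le> \<epsilon>1 * (real n * real d)" for k l
      proof (rule ah[OF nd that(1,2)])
        show "\<bar>\<Sum>i<n. \<Sum>j<d. ind z i k * ind w j l * (x (i, j) - deriv \<psi> (\<alpha>0 $ z i $ w j))\<bar> \<le> r1 * (real n * real d)" for k l
          using that(3)[of k l] mult_right_mono[OF \<epsilon>1(2), of "real n * real d"] by simp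
      qed
    qed (use nd good est small T0 e \<delta> size eps1 \<epsilon>0 gap_row gap_col in \<open>auto simp: g_def m_def D_def \<eta>_def\<close>)
  qed
qed

end

section \<open>Asymptotics\<close>

text \<open>Since \<open>ln a / b\<close> tends to 0, eventually
  \<open>a \<le> exp (q / 2 * b)\<close>: half of the exponent absorbs the factor. This is where the
  growth conditions on \<open>n\<close> and \<open>d\<close> act.\<close>

lemma mult_exp_tendsto_0:
  fixes a b :: "nat \<Rightarrow> nat"
  assumes a: "filterlim a at_top sequentially" and b: "filterlim b at_top sequentially"
    and ln: "(\<lambda>N. ln (real (a N)) / real (b N)) \<longlonglongrightarrow> 0" and q: "q > 0"
  shows "(\<lambda>N. real (a N) * exp (- q * real (b N))) \<longlonglongrightarrow> 0"
proof (rule Lim_null_comparison)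
  have b': "filterlim (\<lambda>N. real (b N)) at_top sequentially"
    by (rule filterlim_compose[OF filterlim_real_sequentially b])
  have "filterlim (\<lambda>N. - (q / 2) * real (b N)) at_bot sequentially"
    using filterlim_tendsto_neg_mult_at_bot[OF tendsto_const _ b', of "- (q / 2)"] q by simp
  then show "(\<lambda>N. exp (- (q / 2) * real (b N))) \<longlonglongrightarrow> 0"
    by (rule filterlim_compose[OF exp_at_bot])
  have "\<forall>\<^sub>F N in sequentially. ln (real (a N)) / real (b N) < q / 2"
    using order_tendstoD(2)[OF ln, of "q / 2"] q by simp
  moreover have "\<forall>\<^sub>F N in sequentially. 1 \<le> a N" "\<forall>\<^sub>F N in sequentially. 1 \<le> b N"
    using a b by (auto simp: filterlim_at_top)
  ultimately show "\<forall>\<^sub>F N in sequentially. norm (real (a N) * exp (- q * real (b N))) \<le> exp (- (q / 2) * real (b N))"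
  proof eventually_elim
    case (elim N)
    then have "ln (real (a N)) \<le> q / 2 * real (b N)" by (simp add: pos_divide_less_eq)
    then have "exp (ln (real (a N))) \<le> exp (q / 2 * real (b N))" by simp
    then have "real (a N) \<le> exp (q / 2 * real (b N))" using elim by simp
    then have "real (a N) * exp (- q * real (b N)) \<le> exp (q / 2 * real (b N)) * exp (- q * real (b N))"
      by (rule mult_right_mono) simp
    also have "\<dots> = exp (- (q / 2) * real (b N))" by (simp add: exp_add[symmetric])
    finally show ?case by simp
  qed
qed

lemma exp_tendsto_0:
  fixes b :: "nat \<Rightarrow> nat"
  assumes b: "filterlim b at_top sequentially" and q: "q > 0"
  shows "(\<lambda>N. exp (- q * real (b N))) \<longlonglongrightarrow> 0"
proof -
  have b': "filterlim (\<lambda>N. real (b N)) at_top sequentially"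
    by (rule filterlim_compose[OF filterlim_real_sequentially b])
  have "filterlim (\<lambda>N. - q * real (b N)) at_bot sequentially"
    using filterlim_tendsto_neg_mult_at_bot[OF tendsto_const _ b', of "- q"] q by simp
  then show ?thesis by (rule filterlim_compose[OF exp_at_bot])
qed

text \<open>Once \<open>n\<close> and \<open>d\<close> exceed \<open>4 * ln 2 / q\<close>, each of
  the two powers of 2 uses at most a quarter of the exponent \<open>q * n * d\<close>. The remaining
  half still tends to infinity.\<close>

lemma subset_count_exp_tendsto_0:
  fixes n d :: "nat \<Rightarrow> nat"
  assumes n: "filterlim n at_top sequentially" and d: "filterlim d at_top sequentially" and q: "q > 0"
  shows "(\<lambda>N. 2 ^ n N * 2 ^ d N * (2 * exp (- q * (real (n N) * real (d N))))) \<longlonglongrightarrow> 0"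
proof (rule Lim_null_comparison)
  show "(\<lambda>N. 2 * exp (- (q / 2) * real (n N))) \<longlonglongrightarrow> 0"
    using tendsto_mult[OF tendsto_const[of 2] exp_tendsto_0[OF n, of "q / 2"]] q by simp
  define m where "m = nat \<lceil>4 * ln 2 / q\<rceil> + 1"
  have "\<forall>\<^sub>F N in sequentially. m \<le> n N" "\<forall>\<^sub>F N in sequentially. m \<le> d N"
    using n d by (auto simp: filterlim_at_top)
  then show "\<forall>\<^sub>F N in sequentially. norm (2 ^ n N * 2 ^ d N * (2 * exp (- q * (real (n N) * real (d N))))) \<le> 2 * exp (- (q / 2) * real (n N))"
  proof eventually_elim
    case (elim N)
    have m: "4 * ln 2 / q \<le> real m" unfolding m_def by linarith
    then have nd: "4 * ln 2 \<le> q * real (n N)" "4 * ln 2 \<le> q * real (d N)" "1 \<le> d N"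
      using elim q order_trans[OF m, of "real (n N)"] order_trans[OF m, of "real (d N)"]
      by (auto simp: pos_divide_le_eq mult.commute m_def)
    have "real (n N) * ln 2 \<le> q * (real (n N) * real (d N)) / 4" "real (d N) * ln 2 \<le> q * (real (n N) * real (d N)) / 4"
      using mult_left_mono[OF nd(2), of "real (n N)"] mult_left_mono[OF nd(1), of "real (d N)"] by (simp_all add: mult_ac)
    moreover have "q * real (n N) * 1 \<le> q * real (n N) * real (d N)"
      using nd(3) q by (intro mult_left_mono) auto
    ultimately have "real (n N) * ln 2 + real (d N) * ln 2 - q * (real (n N) * real (d N)) \<le> - (q / 2) * real (n N)"
      by (simp add: mult_ac)
    then have "exp (real (n N) * ln 2 + real (d N) * ln 2 - q * (real (n N) * real (d N))) \<le> exp (- (q / 2) * real (n N))" by simp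
    moreover have "exp (real (n N) * ln 2 + real (d N) * ln 2 - q * (real (n N) * real (d N))) = 2 ^ n N * 2 ^ d N * exp (- q * (real (n N) * real (d N)))"
    proof -
      have "exp (real k * ln 2) = (2::real) ^ k" for k by (simp add: exp_of_nat_mult)
      then show ?thesis by (simp add: exp_add exp_diff exp_minus divide_inverse)
    qed
    ultimately show ?case by simp
  qed
qed

section \<open>Measurable selection and auxiliary measurability\<close>

text \<open>Enumerate the finite set and take the least index of a minimiser, a \<open>LEAST\<close>
  over measurable predicates. It makes the random permutations measurable, as
  \<open>small_oP\<close> requires of the differences.\<close>

lemma measurable_argmin:
  fixes f :: "'p \<Rightarrow> 'a \<Rightarrow> real"
  assumes S: "finite S" "S \<noteq> {}" and f: "\<And>p. p \<in> S \<Longrightarrow> f p \<in> borel_measurable M"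
  obtains sel where "\<And>\<omega>. sel \<omega> \<in> S" "\<And>\<omega> p. p \<in> S \<Longrightarrow> f (sel \<omega>) \<omega> \<le> f p \<omega>" "sel \<in> measurable M (count_space S)"
proof -
  obtain e where e: "bij_betw e {0..<card S} S" using ex_bij_betw_nat_finite[OF S(1)] by blast
  define Q where "Q i \<omega> \<longleftrightarrow> i < card S \<and> (\<forall>j\<in>{..<card S}. f (e i) \<omega> \<le> f (e j) \<omega>)" for i \<omega>
  define L where "L \<omega> = (LEAST i. Q i \<omega>)" for \<omega>
  have eS: "e i \<in> S" if "i < card S" for i using e that by (auto simp: bij_betw_def)
  have ex: "\<exists>i. Q i \<omega>" for \<omega>
  proof -
    have "\<exists>p\<in>S. \<forall>p'\<in>S. f p \<omega> \<le> f p' \<omega>"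
    proof -
      have "Min ((\<lambda>p. f p \<omega>) ` S) \<in> (\<lambda>p. f p \<omega>) ` S" using S by (intro Min_in) auto
      then obtain p where "p \<in> S" "f p \<omega> = Min ((\<lambda>p. f p \<omega>) ` S)" by auto
      then show ?thesis using S by (intro bexI[of _ p]) (auto intro!: Min_le)
    qed
    then obtain p where p: "p \<in> S" "\<And>p'. p' \<in> S \<Longrightarrow> f p \<omega> \<le> f p' \<omega>" by blast
    moreover have "p \<in> e ` {0..<card S}" using p(1) bij_betw_imp_surj_on[OF e] by simp
    ultimately obtain i where "i < card S" "e i = p" by auto
    then show ?thesis using p eS unfolding Q_def by auto
  qed
  have L: "Q (L \<omega>) \<omega>" for \<omega> unfolding L_def using ex[of \<omega>] by (rule LeastI_ex)
  show thesis
  proof (rule that[of "\<lambda>\<omega>. e (L \<omega>)"])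
    show "e (L \<omega>) \<in> S" for \<omega> using L[of \<omega>] eS by (auto simp: Q_def)
    show "f (e (L \<omega>)) \<omega> \<le> f p \<omega>" if "p \<in> S" for \<omega> p
    proof -
      have "p \<in> e ` {0..<card S}" using that bij_betw_imp_surj_on[OF e] by simp
      then obtain j where "j < card S" "p = e j" by auto
      then show ?thesis using L[of \<omega>] by (auto simp: Q_def)
    qed
    have "(\<lambda>\<omega>. Q i \<omega>) \<in> measurable M (count_space UNIV)" for i
    proof (cases "i < card S")
      case True
      have [measurable]: "f (e j) \<in> borel_measurable M" if "j < card S" for j by (rule f[OF eS[OF that]])
      have "{\<omega> \<in> space M. \<forall>j\<in>{..<card S}. f (e i) \<omega> \<le> f (e j) \<omega>} \<in> sets M"
        using True by (intro sets.sets_Collect_finite_All borel_measurable_le f eS) auto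
      then show ?thesis using True by (simp add: Q_def pred_def)
    next
      case False
      then show ?thesis by (simp add: Q_def)
    qed
    then have Lm: "L \<in> measurable M (count_space UNIV)" unfolding L_def by (rule measurable_Least)
    show "(\<lambda>\<omega>. e (L \<omega>)) \<in> measurable M (count_space S)"
      unfolding measurable_count_space_eq2[OF S(1)]
    proof (intro conjI ballI Pi_I)
      show "e (L \<omega>) \<in> S" for \<omega> using L[of \<omega>] eS by (auto simp: Q_def)
      fix p
      have "(\<lambda>\<omega>. e (L \<omega>)) -` {p} \<inter> space M = L -` {i. e i = p} \<inter> space M" by auto
      also have "\<dots> \<in> sets M" by (rule measurable_sets[OF Lm]) simp
      finally show "(\<lambda>\<omega>. e (L \<omega>)) -` {p} \<inter> space M \<in> sets M" .
    qed
  qed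
qed

lemma borel_measurable_vec:
  fixes f :: "'a \<Rightarrow> 'b::euclidean_space ^ 'k::finite"
  assumes "\<And>k. (\<lambda>\<omega>. f \<omega> $ k) \<in> borel_measurable M"
  shows "f \<in> borel_measurable M"
  unfolding borel_measurable_euclidean_space[where f = f]
proof
  fix i :: "'b ^ 'k" assume "i \<in> Basis"
  then obtain k u where i: "i = axis k u" by (auto simp: Basis_vec_def)
  have "(\<lambda>\<omega>. f \<omega> $ k \<bullet> u) \<in> borel_measurable M" using assms by (intro borel_measurable_inner borel_measurable_const)
  then show "(\<lambda>\<omega>. f \<omega> \<bullet> i) \<in> borel_measurable M" by (simp add: i inner_axis)
qed

lemma norm_le_powr_of_weighted_sq_le:
  fixes q a \<epsilon> y E :: real
  assumes "q > 0" "a > 0" "\<epsilon> > 0" "q * a * y\<^sup>2 \<le> E" "E \<le> q * \<epsilon>\<^sup>2"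
  shows "y \<le> \<epsilon> * a powr (- 1 / 2)"
proof (rule power2_le_imp_le)
  have "q * a * y\<^sup>2 \<le> q * \<epsilon>\<^sup>2" using assms by linarith
  then have "a * y\<^sup>2 \<le> \<epsilon>\<^sup>2" using assms(1) by (simp add: mult.assoc)
  then have "y\<^sup>2 \<le> \<epsilon>\<^sup>2 / a" using assms(2) by (simp add: pos_le_divide_eq mult.commute)
  also have "\<epsilon>\<^sup>2 / a = (\<epsilon> * a powr (- 1 / 2))\<^sup>2"
  proof -
    have "(a powr (- 1 / 2))\<^sup>2 = a powr (- 1)" using assms(2) by (simp add: power2_eq_square powr_add[symmetric])
    moreover have "a powr (- 1) = inverse a" using assms(2) powr_minus[of a 1] by simp
    ultimately show ?thesis unfolding power_mult_distrib divide_inverse by (simp only:)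
  qed
  finally show "y\<^sup>2 \<le> (\<epsilon> * a powr (- 1 / 2))\<^sup>2" .
qed (use assms in simp)

section \<open>Convergence in probability\<close>

context estimation_setting
begin

lemma bad_bound_tendsto_0:
  assumes n: "filterlim n at_top sequentially" and d: "filterlim d at_top sequentially"
    and ld: "(\<lambda>N. ln (real (d N)) / real (n N)) \<longlonglongrightarrow> 0" and lnn: "(\<lambda>N. ln (real (n N)) / real (d N)) \<longlonglongrightarrow> 0"
    and e: "\<epsilon>0 > 0" "\<epsilon>1 > 0" "\<epsilon>2 > 0"
  shows "(\<lambda>N. bad_bound (n N) (d N) \<epsilon>0 \<epsilon>1 \<epsilon>2) \<longlonglongrightarrow> 0"
proof -
  note R1 = chernoff_rate_pos[OF K h e(2)] and R2 = chernoff_rate_pos[OF K h e(3)]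
  have R0: "chernoff_rate 1 1 \<epsilon>0 > 0" by (rule chernoff_rate_pos) (use e in auto)
  have T: "h * \<epsilon>2 / 2 > 0" using h e by simp
  have 2: "(\<lambda>N. real (n N) * real CARD('m) * (2 * exp (- chernoff_rate K h \<epsilon>2 * real (d N)))) \<longlonglongrightarrow> 0"
    using tendsto_mult[OF tendsto_const[of "2 * real CARD('m)"] mult_exp_tendsto_0[OF n d lnn R2]] by (simp add: mult_ac)
  have 3: "(\<lambda>N. real (d N) * real CARD('g) * (2 * exp (- chernoff_rate K h \<epsilon>2 * real (n N)))) \<longlonglongrightarrow> 0"
    using tendsto_mult[OF tendsto_const[of "2 * real CARD('g)"] mult_exp_tendsto_0[OF d n ld R2]] by (simp add: mult_ac)
  have 5: "(\<lambda>N. real CARD('g) * (2 * exp (- chernoff_rate 1 1 \<epsilon>0 * real (n N)))) \<longlonglongrightarrow> 0"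
    using tendsto_mult[OF tendsto_const[of "2 * real CARD('g)"] exp_tendsto_0[OF n R0]] by (simp add: mult_ac)
  have 6: "(\<lambda>N. real CARD('m) * (2 * exp (- chernoff_rate 1 1 \<epsilon>0 * real (d N)))) \<longlonglongrightarrow> 0"
    using tendsto_mult[OF tendsto_const[of "2 * real CARD('m)"] exp_tendsto_0[OF d R0]] by (simp add: mult_ac)
  show ?thesis
    unfolding bad_bound_def bad_data_bound_def
    using tendsto_add[OF tendsto_add[OF tendsto_add[OF tendsto_add[OF tendsto_add[OF subset_count_exp_tendsto_0[OF n d R1] 2] 3]
      mult_exp_tendsto_0[OF n d lnn T]] 5] 6] by simp
qed

lemma error_tendsto_0:
  assumes n: "filterlim n at_top sequentially" and d: "filterlim d at_top sequentially"
    and ld: "(\<lambda>N. ln (real (d N)) / real (n N)) \<longlonglongrightarrow> 0" and lnn: "(\<lambda>N. ln (real (n N)) / real (d N)) \<longlonglongrightarrow> 0"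
    and c': "c' > 0"
  shows "(\<lambda>N. error c' (n N) (d N)) \<longlonglongrightarrow> 0"
  unfolding error_def
  using tendsto_divide[OF tendsto_add[OF mult_exp_tendsto_0[OF n d lnn c'] mult_exp_tendsto_0[OF d n ld c']] tendsto_const[of c]] c
  by simp

text \<open>\<open>loss_constants\<close> gives some permutations with small loss; the selected ones
  minimise the loss and inherit the bound. Each of the three differences is one summand of the loss,
  with weight \<open>q * a N\<close>, so all three claims are instances.\<close>

lemma small_oP_of_loss:
  fixes Y :: "nat \<Rightarrow> (nat \<Rightarrow> 'g) \<times> (nat \<Rightarrow> 'm) \<times> (nat \<times> nat \<Rightarrow> real) \<Rightarrow> 'v::real_normed_vector"
  assumes n: "filterlim n at_top sequentially" and d: "filterlim d at_top sequentially"
    and ld: "(\<lambda>N. ln (real (d N)) / real (n N)) \<longlonglongrightarrow> 0" and lnn: "(\<lambda>N. ln (real (n N)) / real (d N)) \<longlonglongrightarrow> 0"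
    and est: "\<And>N. AE (z, w, x) in law (n N) (d N). variational_estimate b \<psi> \<Theta> (n N) (d N) x (\<theta>v N x)"
    and Y: "\<And>N. Y N \<in> borel_measurable (law (n N) (d N))"
    and min: "\<And>N z w x s' t'. s' permutes UNIV \<Longrightarrow> t' permutes UNIV \<Longrightarrow>
      loss (n N) (d N) z w x (\<theta>v N x) (s N (z, w, x)) (t N (z, w, x)) \<le> loss (n N) (d N) z w x (\<theta>v N x) s' t'"
    and q: "q > 0" and a: "\<And>N. n N > 0 \<Longrightarrow> d N > 0 \<Longrightarrow> a N > 0"
    and bound: "\<And>N z w x. q * a N * (norm (Y N (z, w, x)))\<^sup>2 \<le> loss (n N) (d N) z w x (\<theta>v N x) (s N (z, w, x)) (t N (z, w, x))"
  shows "small_oP (\<lambda>N. law (n N) (d N)) Y (\<lambda>N. a N powr (- 1 / 2))"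
  unfolding small_oP_def
proof (intro conjI allI impI)
  show "Y N \<in> borel_measurable (law (n N) (d N))" for N by (rule Y)
  fix \<epsilon> :: real assume \<epsilon>: "\<epsilon> > 0"
  obtain c' \<epsilon>0 \<epsilon>1 \<epsilon>2 T N0 where pos: "c' > 0" "\<epsilon>0 > 0" "\<epsilon>1 > 0" "\<epsilon>2 > 0" and T: "2 * exp (K * h\<^sup>2 - h * T) \<le> h * \<epsilon>2 / 2"
    and main: "\<And>n d z w x \<theta>. real n \<ge> N0 \<Longrightarrow> real d \<ge> N0 \<Longrightarrow> (z, w, x) \<in> space (lbm_space n d) \<Longrightarrow> (z, w, x) \<notin> bad n d \<epsilon>0 \<epsilon>1 \<epsilon>2 T \<Longrightarrow>
      variational_estimate b \<psi> \<Theta> n d x \<theta> \<Longrightarrow> error c' n d \<le> 1 \<Longrightarrow>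
      \<exists>s t. s permutes UNIV \<and> t permutes UNIV \<and> loss n d z w x \<theta> s t \<le> 2 * error c' n d"
    using loss_constants by metis
  let ?X = "\<lambda>N. {\<omega> \<in> space (law (n N) (d N)). norm (Y N \<omega>) > \<epsilon> * a N powr (- 1 / 2)}"
  show "(\<lambda>N. measure (law (n N) (d N)) (?X N)) \<longlonglongrightarrow> 0"
  proof (rule Lim_null_comparison[OF _ bad_bound_tendsto_0[OF n d ld lnn pos(2-4)]])
    \<comment> \<open>The 1 meets the requirement \<open>error \<le> 1\<close>; the other bound
      makes \<open>2 * error\<close> at most \<open>q * \<epsilon>\<^sup>2\<close>.\<close>
    have "0 < min 1 (q * \<epsilon>\<^sup>2 / 2)" using q \<epsilon> by simp
    then have "\<forall>\<^sub>F N in sequentially. error c' (n N) (d N) < min 1 (q * \<epsilon>\<^sup>2 / 2)"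
      by (rule order_tendstoD(2)[OF error_tendsto_0[OF n d ld lnn pos(1)]])
    moreover have "\<forall>\<^sub>F N in sequentially. nat \<lceil>N0\<rceil> + 1 \<le> n N" "\<forall>\<^sub>F N in sequentially. nat \<lceil>N0\<rceil> + 1 \<le> d N"
      using n d by (auto simp: filterlim_at_top)
    ultimately show "\<forall>\<^sub>F N in sequentially. norm (measure (law (n N) (d N)) (?X N)) \<le> bad_bound (n N) (d N) \<epsilon>0 \<epsilon>1 \<epsilon>2"
    proof eventually_elim
      case (elim N)
      interpret PN: prob_space "law (n N) (d N)" by (rule prob_space_P)
      have N: "real (n N) \<ge> N0" "real (d N) \<ge> N0" "n N > 0" "d N > 0" using elim by linarith+
      have "measure (law (n N) (d N)) (?X N) \<le> measure (law (n N) (d N)) (bad (n N) (d N) \<epsilon>0 \<epsilon>1 \<epsilon>2 T)"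
      \<comment> \<open>The estimator maximises the criterion only almost surely, so the inclusion
        in the exceptional event holds up to a null set.\<close>
      proof (rule PN.finite_measure_mono_AE)
        show "bad (n N) (d N) \<epsilon>0 \<epsilon>1 \<epsilon>2 T \<in> sets (law (n N) (d N))" unfolding sets_P by (rule bad_sets)
        show "AE \<omega> in law (n N) (d N). \<omega> \<in> ?X N \<longrightarrow> \<omega> \<in> bad (n N) (d N) \<epsilon>0 \<epsilon>1 \<epsilon>2 T"
          using est[of N]
        proof (rule AE_mp, intro AE_I2 impI)
          fix \<omega> assume v: "case \<omega> of (z, w, x) \<Rightarrow> variational_estimate b \<psi> \<Theta> (n N) (d N) x (\<theta>v N x)" and X: "\<omega> \<in> ?X N"
          obtain z w x where \<omega>: "\<omega> = (z, w, x)" by (cases \<omega>) auto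
          show "\<omega> \<in> bad (n N) (d N) \<epsilon>0 \<epsilon>1 \<epsilon>2 T"
          proof (rule ccontr)
            assume nb: "\<omega> \<notin> bad (n N) (d N) \<epsilon>0 \<epsilon>1 \<epsilon>2 T"
            have sp: "(z, w, x) \<in> space (lbm_space (n N) (d N))"
              using X sets_eq_imp_space_eq[OF sets_P] by (simp add: \<omega>)
            have "(z, w, x) \<notin> bad (n N) (d N) \<epsilon>0 \<epsilon>1 \<epsilon>2 T" "variational_estimate b \<psi> \<Theta> (n N) (d N) x (\<theta>v N x)"
              "error c' (n N) (d N) \<le> 1"
              using nb v elim by (simp_all add: \<omega>)
            then obtain s' t' where "s' permutes UNIV" "t' permutes UNIV" "loss (n N) (d N) z w x (\<theta>v N x) s' t' \<le> 2 * error c' (n N) (d N)"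
              using main[OF N(1,2) sp] by blast
            then have "q * a N * (norm (Y N (z, w, x)))\<^sup>2 \<le> 2 * error c' (n N) (d N)"
              using bound[of N z w x] min[of s' t' N z w x] by linarith
            then have "norm (Y N (z, w, x)) \<le> \<epsilon> * a N powr (- 1 / 2)"
              by (rule norm_le_powr_of_weighted_sq_le[OF q a[OF N(3,4)] \<epsilon>]) (use elim in simp)
            then show False using X by (simp add: \<omega>)
          qed
        qed
      qed
      also have "\<dots> \<le> bad_bound (n N) (d N) \<epsilon>0 \<epsilon>1 \<epsilon>2" by (rule measure_bad[OF pos(2-4) T])
      finally show ?case by simp
    qed
  qed
qed

end

lemma continuous_perm_vec: "continuous_on UNIV (\<lambda>\<theta> :: ('g::finite, 'm::finite) param. perm_vec s (fst \<theta>))"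
  and continuous_perm_vec': "continuous_on UNIV (\<lambda>\<theta> :: ('g::finite, 'm::finite) param. perm_vec t (fst (snd \<theta>)))"
  and continuous_perm_mat: "continuous_on UNIV (\<lambda>\<theta> :: ('g::finite, 'm::finite) param. perm_mat s t (snd (snd \<theta>)))"
  unfolding perm_vec_def perm_mat_def by (intro continuous_intros)+

lemma (in exponential_family) alpha_hat_measurable:
  fixes z :: "nat \<Rightarrow> 'g::finite" and w :: "nat \<Rightarrow> 'm::finite"
  shows "(\<lambda>x. alpha_hat \<psi> A n d x z w) \<in> borel_measurable (PiM (cells n d) (\<lambda>_. borel))"
proof (intro borel_measurable_vec)
  fix k l
  have "(\<lambda>x. x (i, j)) \<in> borel_measurable (PiM (cells n d) (\<lambda>_. borel :: real measure))" if "i < n" "j < d" for i j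
    using that by (intro measurable_component_singleton) (simp add: cells_def)
  then have "(\<lambda>x. x_hat n d x z w k l) \<in> borel_measurable (PiM (cells n d) (\<lambda>_. borel))"
    unfolding x_hat_def
    by (intro borel_measurable_divide borel_measurable_sum borel_measurable_times borel_measurable_const) auto
  then show "(\<lambda>x. alpha_hat \<psi> A n d x z w $ k $ l) \<in> borel_measurable (PiM (cells n d) (\<lambda>_. borel))"
    unfolding alpha_hat_def by (simp add: measurable_compose[OF _ inv_deriv_psi_measurable])
qed

text \<open>The least nonzero distance between entries of the matrix; the element 1 is inserted so
  that the minimum exists even if all entries agree.\<close>

lemma separation_constant:
  fixes \<alpha> :: "real ^ 'm::finite ^ 'g::finite"
  assumes "inj (\<lambda>k. row k \<alpha>)" "inj (\<lambda>l. column l \<alpha>)"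
  obtains \<Delta> where "\<Delta> > 0" "\<And>k k'. k \<noteq> k' \<Longrightarrow> \<exists>l. \<Delta> \<le> \<bar>\<alpha> $ k $ l - \<alpha> $ k' $ l\<bar>"
    "\<And>l l'. l \<noteq> l' \<Longrightarrow> \<exists>k. \<Delta> \<le> \<bar>\<alpha> $ k $ l - \<alpha> $ k $ l'\<bar>"
proof -
  define S where "S = insert 1 ((\<lambda>(k, l, k', l'). \<bar>\<alpha> $ k $ l - \<alpha> $ k' $ l'\<bar>) ` UNIV - {0})"
  have S: "finite S" "S \<noteq> {}" by (auto simp: S_def)
  have pos: "s > 0" if "s \<in> S" for s using that by (auto simp: S_def)
  have le: "Min S \<le> \<bar>\<alpha> $ k $ l - \<alpha> $ k' $ l'\<bar>" if "\<alpha> $ k $ l \<noteq> \<alpha> $ k' $ l'" for k l k' l'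
  proof (rule Min_le[OF S(1)])
    have "\<bar>\<alpha> $ k $ l - \<alpha> $ k' $ l'\<bar> \<in> (\<lambda>(k, l, k', l'). \<bar>\<alpha> $ k $ l - \<alpha> $ k' $ l'\<bar>) ` UNIV"
      by (rule image_eqI[of _ _ "(k, l, k', l')"]) auto
    then show "\<bar>\<alpha> $ k $ l - \<alpha> $ k' $ l'\<bar> \<in> S" using that by (auto simp: S_def)
  qed
  show thesis
  proof (rule that[of "Min S"])
    show "Min S > 0" using pos Min_in[OF S] by blast
    show "\<exists>l. Min S \<le> \<bar>\<alpha> $ k $ l - \<alpha> $ k' $ l\<bar>" if "k \<noteq> k'" for k k'
    proof -
      have "row k \<alpha> \<noteq> row k' \<alpha>" using assms(1) that by (auto dest: injD)
      then obtain l where "\<alpha> $ k $ l \<noteq> \<alpha> $ k' $ l" by (auto simp: row_def vec_eq_iff)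
      then show ?thesis using le by blast
    qed
    show "\<exists>k. Min S \<le> \<bar>\<alpha> $ k $ l - \<alpha> $ k $ l'\<bar>" if "l \<noteq> l'" for l l'
    proof -
      have "column l \<alpha> \<noteq> column l' \<alpha>" using assms(2) that by (auto dest: injD)
      then obtain k where "\<alpha> $ k $ l \<noteq> \<alpha> $ k $ l'" by (auto simp: column_def vec_eq_iff)
      then show ?thesis using le by blast
    qed
  qed
qed

text \<open>A compact set need not be connected, but \<open>A\<close> is an interval and so contains
  its convex hull. The margin \<open>h\<close> leaves room for the tilts in the moment generating
  functions.\<close>

lemma (in exponential_family) enclosing_interval:
  assumes "compact C" "C \<subseteq> A" "C \<noteq> {}"
  obtains lo hi h where "C \<subseteq> {lo..hi}" "lo \<le> hi" "h > 0" "{lo - h..hi + h} \<subseteq> A"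
proof -
  obtain lo where lo: "lo \<in> C" "\<And>t. t \<in> C \<Longrightarrow> lo \<le> t" using compact_attains_inf[OF assms(1,3)] by blast
  obtain hi where hi: "hi \<in> C" "\<And>t. t \<in> C \<Longrightarrow> t \<le> hi" using compact_attains_sup[OF assms(1,3)] by blast
  obtain h1 where h1: "h1 > 0" "\<And>t. \<bar>t - lo\<bar> \<le> h1 \<Longrightarrow> t \<in> A" using A_neighbourhood lo(1) assms(2) by blast
  obtain h2 where h2: "h2 > 0" "\<And>t. \<bar>t - hi\<bar> \<le> h2 \<Longrightarrow> t \<in> A" using A_neighbourhood hi(1) assms(2) by blast
  show thesis
  proof (rule that[of lo hi "min h1 h2"])
    show "C \<subseteq> {lo..hi}" "lo \<le> hi" using lo hi by auto
    show "{lo - min h1 h2..hi + min h1 h2} \<subseteq> A"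
      using h1 h2 by (intro A_interval) auto
  qed (use h1 h2 in auto)
qed

text \<open>The permutations are functions of the index and of the sample, because nothing ties the
  labelling of the estimator on one sample to that on another.\<close>

theorem theorem6p2:
  fixes \<nu> :: "real measure" and b \<psi> :: "real \<Rightarrow> real" and A C :: "real set" and c :: real
    and \<Theta> :: "('g::finite, 'm::finite) param set"
    and \<pi>\<^sub>0 :: "real ^ 'g" and \<rho>\<^sub>0 :: "real ^ 'm" and \<alpha>\<^sub>0 :: "real ^ 'm ^ 'g"
    and n d :: "nat \<Rightarrow> nat"
    and \<theta>var :: "nat \<Rightarrow> (nat \<times> nat \<Rightarrow> real) \<Rightarrow> ('g, 'm) param"
  defines "P \<equiv> \<lambda>N. lbm \<nu> b \<psi> (n N) (d N) (\<pi>\<^sub>0, \<rho>\<^sub>0, \<alpha>\<^sub>0)"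
  assumes family: "regular_expfam \<nu> b \<psi> A"
    and param_set: "\<Theta> \<subseteq> params"
    and H1: "c > 0" "compact C" "C \<subseteq> interior A"
      "\<Theta> \<subseteq> {(\<pi>, \<rho>, \<alpha>). (\<forall>k. \<pi> $ k \<in> {c..1 - c}) \<and> (\<forall>l. \<rho> $ l \<in> {c..1 - c}) \<and>
                         (\<forall>k l. \<alpha> $ k $ l \<in> C)}"
    and H2: "(\<pi>\<^sub>0, \<rho>\<^sub>0, \<alpha>\<^sub>0) \<in> top_of_set params interior_of \<Theta>"
    and H3: "identifiable_upto_labels \<nu> b \<psi> \<Theta> (\<pi>\<^sub>0, \<rho>\<^sub>0, \<alpha>\<^sub>0)"
      "inj_on (expfam \<nu> b \<psi>) A"
      "inj (\<lambda>k. row k \<alpha>\<^sub>0)" "inj (\<lambda>l. column l \<alpha>\<^sub>0)"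
    and regime: "filterlim n at_top sequentially" "filterlim d at_top sequentially"
      "(\<lambda>N. ln (real (d N)) / real (n N)) \<longlonglongrightarrow> 0"
      "(\<lambda>N. ln (real (n N)) / real (d N)) \<longlonglongrightarrow> 0"
    and estimator: "\<And>N. \<theta>var N \<in> borel_measurable (PiM (cells (n N) (d N)) (\<lambda>_. borel))"
      "\<And>N. AE (z, w, x) in P N. variational_estimate b \<psi> \<Theta> (n N) (d N) x (\<theta>var N x)"
  shows "\<exists>s t. (\<forall>N \<omega>. s N \<omega> permutes (UNIV :: 'g set) \<and> t N \<omega> permutes (UNIV :: 'm set)) \<and>
    small_oP P (\<lambda>N (z, w, x). prop_hat (n N) z
        - perm_vec (s N (z, w, x)) (fst (\<theta>var N x)))
      (\<lambda>N. real (n N) powr (-1/2)) \<and>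
    small_oP P (\<lambda>N (z, w, x). prop_hat (d N) w
        - perm_vec (t N (z, w, x)) (fst (snd (\<theta>var N x))))
      (\<lambda>N. real (d N) powr (-1/2)) \<and>
    small_oP P (\<lambda>N (z, w, x). alpha_hat \<psi> A (n N) (d N) x z w
        - perm_mat (s N (z, w, x)) (t N (z, w, x)) (snd (snd (\<theta>var N x))))
      (\<lambda>N. (real (n N) * real (d N)) powr (-1/2))"
proof -
  interpret exponential_family \<nu> b \<psi> A by standard (fact family H3(2))+
  have intA: "interior A = A" using A_open by (rule interior_open)
  obtain U where U: "openin (top_of_set params) U" "(\<pi>\<^sub>0, \<rho>\<^sub>0, \<alpha>\<^sub>0) \<in> U" "U \<subseteq> \<Theta>"
    using H2 by (auto simp: interior_of_def)
  then have th0: "(\<pi>\<^sub>0, \<rho>\<^sub>0, \<alpha>\<^sub>0) \<in> \<Theta>" by blast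
  obtain r where r: "r > 0" "\<And>\<theta>. \<theta> \<in> params \<Longrightarrow> dist \<theta> (\<pi>\<^sub>0, \<rho>\<^sub>0, \<alpha>\<^sub>0) < r \<Longrightarrow> \<theta> \<in> U"
    using U(1,2) unfolding openin_euclidean_subtopology_iff by blast
  have "C \<noteq> {}" using th0 H1(4) by auto
  then obtain lo hi h where I: "C \<subseteq> {lo..hi}" "lo \<le> hi" "h > 0" "{lo - h..hi + h} \<subseteq> A"
    using enclosing_interval[of C] H1(2,3) unfolding intA by metis
  \<comment> \<open>The divergence bounds are taken on the widened interval: it contains the true
    parameters shifted by up to \<open>h\<close>, so \<open>K\<close> can also serve as the
    sub-Gaussian constant.\<close>
  have le: "lo - h \<le> hi + h" using I(2,3) by simp
  obtain \<kappa> K where \<kappa>: "\<kappa> > 0" "K > 0"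
    "\<And>a a'. a \<in> {lo - h..hi + h} \<Longrightarrow> a' \<in> {lo - h..hi + h} \<Longrightarrow> \<kappa> * (a - a')\<^sup>2 \<le> bregman \<psi> a a' \<and> bregman \<psi> a a' \<le> K * (a - a')\<^sup>2"
    using bregman_bounds[OF I(4) le] by blast
  obtain \<Delta> where \<Delta>: "\<Delta> > 0" "\<And>k k'. k \<noteq> k' \<Longrightarrow> \<exists>l. \<Delta> \<le> \<bar>\<alpha>\<^sub>0 $ k $ l - \<alpha>\<^sub>0 $ k' $ l\<bar>"
    "\<And>l l'. l \<noteq> l' \<Longrightarrow> \<exists>k. \<Delta> \<le> \<bar>\<alpha>\<^sub>0 $ k $ l - \<alpha>\<^sub>0 $ k $ l'\<bar>"
    using separation_constant[OF H3(3,4)] by blast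
  have bounds: "c \<le> \<pi> $ k \<and> c \<le> \<rho> $ l \<and> \<alpha> $ k $ l \<in> {lo..hi}" if "(\<pi>, \<rho>, \<alpha>) \<in> \<Theta>" for \<pi> \<rho> \<alpha> k l
    using that H1(4) I(1) by fastforce
  have a0: "\<alpha>\<^sub>0 $ k $ l \<in> {lo..hi}" for k l using bounds[OF th0] by blast
  interpret estimation_setting \<nu> b \<psi> A \<pi>\<^sub>0 \<rho>\<^sub>0 \<alpha>\<^sub>0 K h \<Theta> c lo hi \<kappa> K \<Delta> r
  proof
    show "\<pi>\<^sub>0 \<in> prob_vectors" "\<rho>\<^sub>0 \<in> prob_vectors" using th0 param_set by (auto simp: params_def)
    show "\<alpha>\<^sub>0 $ k $ l + t \<in> A \<and> bregman \<psi> (\<alpha>\<^sub>0 $ k $ l) (\<alpha>\<^sub>0 $ k $ l + t) \<le> K * t\<^sup>2" if "\<bar>t\<bar> \<le> h" for k l t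
    proof -
      have "\<alpha>\<^sub>0 $ k $ l \<in> {lo - h..hi + h}" "\<alpha>\<^sub>0 $ k $ l + t \<in> {lo - h..hi + h}" using a0[of k l] that I(3) by auto
      then show ?thesis using \<kappa>(3)[of "\<alpha>\<^sub>0 $ k $ l" "\<alpha>\<^sub>0 $ k $ l + t"] I(4) by auto
    qed
    show "\<kappa> * (a - a')\<^sup>2 \<le> bregman \<psi> a a' \<and> bregman \<psi> a a' \<le> K * (a - a')\<^sup>2" if "a \<in> {lo..hi}" "a' \<in> {lo..hi}" for a a'
      using that I(3) by (intro \<kappa>(3)) auto
    show "\<theta> \<in> \<Theta>" if "\<theta> \<in> params" "dist \<theta> (\<pi>\<^sub>0, \<rho>\<^sub>0, \<alpha>\<^sub>0) < r" for \<theta>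
      using r(2)[OF that] U(3) by blast
  qed (fact param_set bounds H1 \<kappa> I \<Delta> th0 r)+
  let ?S = "{s. s permutes (UNIV :: 'g set)} \<times> {t. t permutes (UNIV :: 'm set)}"
  have S: "finite ?S" "?S \<noteq> {}"
    using permutes_id by (auto simp: finite_permutations intro!: exI[of _ id])
  define F1 where "F1 N p = (\<lambda>(z, w :: nat \<Rightarrow> 'm, x). prop_hat (n N) z - perm_vec (fst p) (fst (\<theta>var N x)))" for N and p :: "('g \<Rightarrow> 'g) \<times> ('m \<Rightarrow> 'm)"
  define F2 where "F2 N p = (\<lambda>(z :: nat \<Rightarrow> 'g, w, x). prop_hat (d N) w - perm_vec (snd p) (fst (snd (\<theta>var N x))))" for N and p :: "('g \<Rightarrow> 'g) \<times> ('m \<Rightarrow> 'm)"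
  define F3 where "F3 N p = (\<lambda>(z, w, x). alpha_hat \<psi> A (n N) (d N) x z w - perm_mat (fst p) (snd p) (snd (snd (\<theta>var N x))))" for N and p :: "('g \<Rightarrow> 'g) \<times> ('m \<Rightarrow> 'm)"
  have P: "P N = lbm \<nu> b \<psi> (n N) (d N) (\<pi>\<^sub>0, \<rho>\<^sub>0, \<alpha>\<^sub>0)" for N by (simp add: P_def)
  have estimate_comp: "(\<lambda>x. g (\<theta>var N x)) \<in> borel_measurable (PiM (cells (n N) (d N)) (\<lambda>_. borel))"
    if "continuous_on UNIV g" for N and g :: "_ \<Rightarrow> 'v::real_normed_vector"
    by (rule measurable_compose[OF estimator(1) borel_measurable_continuous_onI[OF that]])
  have F1: "F1 N p \<in> borel_measurable (P N)" for N p
    unfolding F1_def P measurable_cong_sets[OF sets_P refl]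
    by (rule measurable_lbm_spaceI)
       (simp only: prod.case, intro borel_measurable_diff borel_measurable_const estimate_comp[OF continuous_perm_vec])
  have F2: "F2 N p \<in> borel_measurable (P N)" for N p
    unfolding F2_def P measurable_cong_sets[OF sets_P refl]
    by (rule measurable_lbm_spaceI)
       (simp only: prod.case, intro borel_measurable_diff borel_measurable_const estimate_comp[OF continuous_perm_vec'])
  have F3: "F3 N p \<in> borel_measurable (P N)" for N p
    unfolding F3_def P measurable_cong_sets[OF sets_P refl]
    by (rule measurable_lbm_spaceI)
       (simp only: prod.case, intro borel_measurable_diff borel_measurable_const alpha_hat_measurable estimate_comp[OF continuous_perm_mat])
  define f where "f N p = (\<lambda>(z, w, x). loss (n N) (d N) z w x (\<theta>var N x) (fst p) (snd p))" for N p
  \<comment> \<open>Written through the squared norms of the three differences, the loss inherits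
    their measurability for each fixed pair of permutations.\<close>
  have f_eq: "f N p = (\<lambda>\<omega>. real (n N) / 4 * (norm (F1 N p \<omega>))\<^sup>2 + real (d N) / 4 * (norm (F2 N p \<omega>))\<^sup>2 +
     \<kappa> * (c / 2)\<^sup>2 * (real (n N) * real (d N)) * (norm (F3 N p \<omega>))\<^sup>2)" for N p
    by (simp add: f_def loss_def F1_def F2_def F3_def fun_eq_iff)
  have f: "f N p \<in> borel_measurable (P N)" for N p
    unfolding f_eq using F1[of N p] F2[of N p] F3[of N p] by measurable
  \<comment> \<open>One minimising pair per sample, used simultaneously for rows, columns and the
    parameter matrix.\<close>
  have "\<exists>sel. (\<forall>\<omega>. sel \<omega> \<in> ?S) \<and> (\<forall>\<omega> p. p \<in> ?S \<longrightarrow> f N (sel \<omega>) \<omega> \<le> f N p \<omega>) \<and> sel \<in> measurable (P N) (count_space ?S)" for N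
  proof (rule measurable_argmin[OF S, where f = "f N" and M = "P N"])
    show "f N p \<in> borel_measurable (P N)" for p by (rule f)
  qed blast
  then obtain sel where sel: "\<And>N \<omega>. sel N \<omega> \<in> ?S" "\<And>N \<omega> p. p \<in> ?S \<Longrightarrow> f N (sel N \<omega>) \<omega> \<le> f N p \<omega>"
    "\<And>N. sel N \<in> measurable (P N) (count_space ?S)"
    by metis
  define s where "s N \<omega> = fst (sel N \<omega>)" for N \<omega>
  define t where "t N \<omega> = snd (sel N \<omega>)" for N \<omega>
  have min: "loss (n N) (d N) z w x (\<theta>var N x) (s N (z, w, x)) (t N (z, w, x)) \<le> loss (n N) (d N) z w x (\<theta>var N x) s' t'"
    if "s' permutes UNIV" "t' permutes UNIV" for N z w x s' t'
    using sel(2)[of "(s', t')" N "(z, w, x)"] that by (simp add: f_def s_def t_def)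
  have countS: "countable ?S" using S(1) by (rule countable_finite)
  have est: "AE (z, w, x) in lbm \<nu> b \<psi> (n N) (d N) (\<pi>\<^sub>0, \<rho>\<^sub>0, \<alpha>\<^sub>0). variational_estimate b \<psi> \<Theta> (n N) (d N) x (\<theta>var N x)" for N
    using estimator(2)[of N] unfolding P .
  have nn: "0 \<le> \<kappa> * (c / 2)\<^sup>2 * (real (n N) * real (d N)) * y\<^sup>2" for N y using \<kappa>(1) by simp
  have m1: "(\<lambda>(z, w, x). prop_hat (n N) z - perm_vec (s N (z, w, x)) (fst (\<theta>var N x))) \<in> borel_measurable (P N)" for N
  proof -
    \<comment> \<open>The random permutation takes finitely many values, so measurability for each
      fixed pair suffices.\<close>
    have "(\<lambda>\<omega>. F1 N (sel N \<omega>) \<omega>) \<in> borel_measurable (P N)"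
      by (rule measurable_compose_countable'[OF F1 sel(3) countS])
    then show ?thesis by (simp add: F1_def s_def split_def)
  qed
  have m2: "(\<lambda>(z, w, x). prop_hat (d N) w - perm_vec (t N (z, w, x)) (fst (snd (\<theta>var N x)))) \<in> borel_measurable (P N)" for N
  proof -
    have "(\<lambda>\<omega>. F2 N (sel N \<omega>) \<omega>) \<in> borel_measurable (P N)"
      by (rule measurable_compose_countable'[OF F2 sel(3) countS])
    then show ?thesis by (simp add: F2_def t_def split_def)
  qed
  have m3: "(\<lambda>(z, w, x). alpha_hat \<psi> A (n N) (d N) x z w - perm_mat (s N (z, w, x)) (t N (z, w, x)) (snd (snd (\<theta>var N x)))) \<in> borel_measurable (P N)" for N
  proof -
    have "(\<lambda>\<omega>. F3 N (sel N \<omega>) \<omega>) \<in> borel_measurable (P N)"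
      by (rule measurable_compose_countable'[OF F3 sel(3) countS])
    then show ?thesis by (simp add: F3_def s_def t_def split_def)
  qed
  \<comment> \<open>In each application \<open>q\<close> is the constant with which the squared
    difference enters the loss.\<close>
  have "small_oP P (\<lambda>N (z, w, x). prop_hat (n N) z - perm_vec (s N (z, w, x)) (fst (\<theta>var N x))) (\<lambda>N. real (n N) powr (-1/2))"
    unfolding P_def
    by (rule small_oP_of_loss[OF regime est m1[unfolded P] min, where q = "1 / 4"])
       (use nn in \<open>simp_all add: loss_def\<close>)
  moreover have "small_oP P (\<lambda>N (z, w, x). prop_hat (d N) w - perm_vec (t N (z, w, x)) (fst (snd (\<theta>var N x)))) (\<lambda>N. real (d N) powr (-1/2))"
    unfolding P_def
    by (rule small_oP_of_loss[OF regime est m2[unfolded P] min, where q = "1 / 4"])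
       (use nn in \<open>simp_all add: loss_def\<close>)
  moreover have "small_oP P (\<lambda>N (z, w, x). alpha_hat \<psi> A (n N) (d N) x z w - perm_mat (s N (z, w, x)) (t N (z, w, x)) (snd (snd (\<theta>var N x))))
      (\<lambda>N. (real (n N) * real (d N)) powr (-1/2))"
    unfolding P_def
    by (rule small_oP_of_loss[OF regime est m3[unfolded P] min, where q = "\<kappa> * (c / 2)\<^sup>2"])
       (use \<kappa>(1) H1(1) in \<open>simp_all add: loss_def\<close>)
  moreover have "s N \<omega> permutes UNIV \<and> t N \<omega> permutes UNIV" for N \<omega>
    using sel(1)[of N \<omega>] by (auto simp: s_def t_def mem_Times_iff)
  ultimately show ?thesis by blast
qed

end
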